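(* Let $(M,\bar g,J,\bar\xi)$, $\dim M=2n\ge 4$, be a rotational hypersurface of type II in $\mathbb C^n\times\mathbb R$ and assume that $$t(s)>0,\qquad t'(s)\ge 1,\qquad s\in I .$$ Then the Kähler metric $$g=\bar g+(t'-1)(\bar\eta\otimes\bar\eta+\tilde{\bar\eta}\otimes\tilde{\bar\eta})$$ is of quasi-constant holomorphic sectional curvatures with functions $$a\le 0,\qquad a+k^2>0 .$$
   Context: Rotational hypersurfaces of type II: let $(\mathbb C^n,g',J_0)$ be the complex Euclidean space with standard complex structure $J_0$, and let $\mathbb R$ be spanned by $\mathbf e$ with $\mathbf e^2=-1$; the product metric on $\mathbb C^n\times\mathbb R$, also denoted $g'$, has signature $(2n,1)$. For smooth functions $t(s)>0$, $q(s)$ on an interval $I$, the rotational hypersurface $M$ (with no common points with the axis $\mathbb R\mathbf e$) consists of the points $\mathbf Z=t(s)\mathbf n+q(s)\mathbf e$, $s\in I$, $\mathbf n\in S^{2n-1}(1)\subset\mathbb C^n$; its meridian is $\gamma:\mathbf z(s)=t(s)\mathbf n+q(s)\mathbf e$ ($\mathbf n$ fixed), and its parallels are the hyperspheres $S^{2n-1}(s)$ of radius $t(s)$ with centre $q(s)\mathbf e$. $M$ is of type II if its normals are time-like; the meridian is then space-like and $s$ is taken to be a natural parameter, $t'^2-q'^2=1$. Structures on $M$: $\bar g$ is the induced (positive definite) metric; $\bar\xi=\partial\mathbf Z/\partial s=t'\mathbf n+q'\mathbf e$; $\tilde{\bar\xi}=J_0\mathbf n$; $\bar\eta=\bar g(\bar\xi,\cdot)$,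 $\tilde{\bar\eta}=\bar g(\tilde{\bar\xi},\cdot)$; $D$ is the $\bar g$-orthogonal complement of $D^\perp=\mathrm{span}\{\bar\xi,\tilde{\bar\xi}\}$ in $TM$. The almost complex structure $J$ is defined by $J|_D=J_0$, $J\bar\xi=\tilde{\bar\xi}$, $J\tilde{\bar\xi}=-\bar\xi$. Further $\xi=\frac1{\sqrt{t'}}\bar\xi$ is the $g$-unit vector field associated with $g$, and $D^\perp=\mathrm{span}\{\xi,J\xi\}$. $(M,g,J,D)$ is of quasi-constant holomorphic sectional curvatures if the $g$-sectional curvature of any $J$-invariant 2-plane $E\subset T_pM$ depends only on $p$ and on the ($g$-)angle between $E$ and $D^\perp(p)$. $a(p)$ is the holomorphic sectional curvature of $J$-invariant 2-planes contained in $D(p)$; $k$ is the function determined by $\nabla_{x_0}\xi=\frac k2x_0$ for $x_0\in D$, where $\nabla$ is the Levi-Civita connection of $g$. *)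

theory Defs
  imports "HOL-Analysis.Analysis"
begin

section \<open>Smooth maps and calculus on subsets of a Euclidean space\<close>

text \<open>For open \<open>S\<close> in a finite-dimensional space this is the class of \<open>C\<^sup>k\<close> maps: all iterated
  directional derivatives up to order \<open>k\<close> exist and are continuous.\<close>

primrec Ck_on :: "nat \<Rightarrow> ('a::euclidean_space \<Rightarrow> 'b::real_normed_vector) \<Rightarrow> 'a set \<Rightarrow> bool" where
  "Ck_on 0 f S \<longleftrightarrow> continuous_on S f"
| "Ck_on (Suc k) f S \<longleftrightarrow>
     (\<forall>x\<in>S. f differentiable (at x)) \<and> (\<forall>v. Ck_on k (\<lambda>x. frechet_derivative f (at x) v) S)"

definition smooth_on :: "'a set \<Rightarrow> ('a::euclidean_space \<Rightarrow> 'b::real_normed_vector) \<Rightarrow> bool" where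
  "smooth_on S f \<longleftrightarrow> (\<forall>k. Ck_on k f S)"

text \<open>Smoothness on an embedded submanifold \<open>M\<close>: local extendability to smooth maps of the ambient
  space.\<close>

definition smooth_map :: "'a set \<Rightarrow> ('a::euclidean_space \<Rightarrow> 'b::real_normed_vector) \<Rightarrow> bool" where
  "smooth_map M f \<longleftrightarrow>
     (\<forall>p\<in>M. \<exists>U F. open U \<and> p \<in> U \<and> smooth_on U F \<and> (\<forall>x\<in>U \<inter> M. F x = f x))"

definition tangent_space :: "'a::euclidean_space set \<Rightarrow> 'a \<Rightarrow> 'a set" where
  "tangent_space M p =
     {v. \<exists>(c :: real \<Rightarrow> 'a) \<epsilon>. \<epsilon> > 0 \<and> smooth_on {-\<epsilon><..<\<epsilon>} c \<and> c ` {-\<epsilon><..<\<epsilon>} \<subseteq> M \<and> c 0 = p \<and>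
          (c has_vector_derivative v) (at 0)}"

definition vector_field :: "'a::euclidean_space set \<Rightarrow> ('a \<Rightarrow> 'a) \<Rightarrow> bool" where
  "vector_field M X \<longleftrightarrow> smooth_map M X \<and> (\<forall>p\<in>M. X p \<in> tangent_space M p)"

text \<open>The derivative of \<open>f\<close> along \<open>X\<close>. A Frechet derivative within \<open>M\<close> is not unique as a linear map
  of the ambient space, but its values on tangent vectors of \<open>M\<close> are: along a curve \<open>c\<close> in \<open>M\<close> its
  value on the velocity of \<open>c\<close> is the derivative of \<open>f \<circ> c\<close>.\<close>

definition deriv_along ::
    "'a::euclidean_space set \<Rightarrow> ('a \<Rightarrow> 'a) \<Rightarrow> ('a \<Rightarrow> 'b::real_normed_vector) \<Rightarrow> 'a \<Rightarrow> 'b" where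
  "deriv_along M X f p = frechet_derivative f (at p within M) (X p)"

definition lie_bracket :: "'a::euclidean_space set \<Rightarrow> ('a \<Rightarrow> 'a) \<Rightarrow> ('a \<Rightarrow> 'a) \<Rightarrow> 'a \<Rightarrow> 'a" where
  "lie_bracket M X Y p = deriv_along M X Y p - deriv_along M Y X p"


section \<open>Riemannian and Kaehler geometry\<close>

text \<open>A metric (and likewise an endomorphism field) on \<open>M\<close> is given by ambient functions of which
  only the values on tangent vectors at points of \<open>M\<close> matter.\<close>

type_synonym 'a metric = "'a \<Rightarrow> 'a \<Rightarrow> 'a \<Rightarrow> real"

definition riemannian_metric :: "'a::euclidean_space set \<Rightarrow> 'a metric \<Rightarrow> bool" where
  "riemannian_metric M g \<longleftrightarrow>
     (\<forall>p\<in>M. \<forall>x\<in>tangent_space M p. \<forall>y\<in>tangent_space M p. \<forall>z\<in>tangent_space M p. \<forall>c.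
        g p x y = g p y x \<and> g p (x + y) z = g p x z + g p y z \<and> g p (c *\<^sub>R x) y = c * g p x y \<and>
        (x \<noteq> 0 \<longrightarrow> g p x x > 0)) \<and>
     (\<forall>X Y. vector_field M X \<and> vector_field M Y \<longrightarrow> smooth_map M (\<lambda>p. g p (X p) (Y p)))"

text \<open>Connections are operators \<open>conn X Y\<close>, the derivative of \<open>Y\<close> along \<open>X\<close>, on smooth vector fields of \<open>M\<close>; the clauses below are:
  linearity over smooth functions in \<open>X\<close>, additivity and the Leibniz rule in \<open>Y\<close>, vanishing torsion,
  and compatibility with the metric.\<close>

definition levi_civita_connection ::
    "'a::euclidean_space set \<Rightarrow> 'a metric \<Rightarrow> (('a \<Rightarrow> 'a) \<Rightarrow> ('a \<Rightarrow> 'a) \<Rightarrow> 'a \<Rightarrow> 'a) \<Rightarrow> bool" where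
  "levi_civita_connection M g conn \<longleftrightarrow>
     (\<forall>X Y. vector_field M X \<and> vector_field M Y \<longrightarrow> vector_field M (conn X Y)) \<and>
     (\<forall>X Y Z (f::'a \<Rightarrow> real) (h::'a \<Rightarrow> real).
        vector_field M X \<and> vector_field M Y \<and> vector_field M Z \<and> smooth_map M f \<and> smooth_map M h \<longrightarrow>
        (\<forall>p\<in>M.
           conn (\<lambda>u. f u *\<^sub>R X u + h u *\<^sub>R Y u) Z p = f p *\<^sub>R conn X Z p + h p *\<^sub>R conn Y Z p \<and>
           conn X (\<lambda>u. Y u + Z u) p = conn X Y p + conn X Z p \<and>
           conn X (\<lambda>u. f u *\<^sub>R Y u) p = deriv_along M X f p *\<^sub>R Y p + f p *\<^sub>R conn X Y p \<and>
           conn X Y p - conn Y X p = lie_bracket M X Y p \<and>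
           deriv_along M X (\<lambda>u. g u (Y u) (Z u)) p = g p (conn X Y p) (Z p) + g p (Y p) (conn X Z p)))"

text \<open>The values on \<open>M\<close> of a Levi-Civita connection are unique, so the choice is immaterial there.\<close>

definition levi_civita ::
    "'a::euclidean_space set \<Rightarrow> 'a metric \<Rightarrow> ('a \<Rightarrow> 'a) \<Rightarrow> ('a \<Rightarrow> 'a) \<Rightarrow> 'a \<Rightarrow> 'a" where
  "levi_civita M g = (SOME conn. levi_civita_connection M g conn)"

definition curvature_field ::
    "'a::euclidean_space set \<Rightarrow> 'a metric \<Rightarrow> ('a \<Rightarrow> 'a) \<Rightarrow> ('a \<Rightarrow> 'a) \<Rightarrow> ('a \<Rightarrow> 'a) \<Rightarrow> 'a \<Rightarrow> 'a" where
  "curvature_field M g X Y Z p =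
     (let conn = levi_civita M g in conn X (conn Y Z) p - conn Y (conn X Z) p - conn (lie_bracket M X Y) Z p)"

text \<open>The curvature tensor at a point, evaluated by extending the tangent vectors to vector fields.\<close>

definition curvature_tensor ::
    "'a::euclidean_space set \<Rightarrow> 'a metric \<Rightarrow> 'a \<Rightarrow> 'a \<Rightarrow> 'a \<Rightarrow> 'a \<Rightarrow> 'a" where
  "curvature_tensor M g p x y z =
     (THE w. \<exists>X Y Z. vector_field M X \<and> vector_field M Y \<and> vector_field M Z \<and>
        X p = x \<and> Y p = y \<and> Z p = z \<and> w = curvature_field M g X Y Z p)"

definition sectional_curvature :: "'a::euclidean_space set \<Rightarrow> 'a metric \<Rightarrow> 'a \<Rightarrow> 'a set \<Rightarrow> real" where
  "sectional_curvature M g p E =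
     (THE \<kappa>. \<exists>x y. x \<noteq> y \<and> independent {x, y} \<and> span {x, y} = E \<and>
        \<kappa> = g p (curvature_tensor M g p x y y) x / (g p x x * g p y y - (g p x y)\<^sup>2))"

text \<open>Almost Hermitian with parallel almost complex structure.\<close>

definition kaehler_metric :: "'a::euclidean_space set \<Rightarrow> 'a metric \<Rightarrow> ('a \<Rightarrow> 'a \<Rightarrow> 'a) \<Rightarrow> bool" where
  "kaehler_metric M g J \<longleftrightarrow>
     riemannian_metric M g \<and>
     (\<forall>p\<in>M. \<forall>x\<in>tangent_space M p. \<forall>y\<in>tangent_space M p. \<forall>c.
        J p x \<in> tangent_space M p \<and> J p (x + y) = J p x + J p y \<and> J p (c *\<^sub>R x) = c *\<^sub>R J p x \<and>
        J p (J p x) = - x \<and> g p (J p x) (J p y) = g p x y) \<and>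
     (\<forall>X. vector_field M X \<longrightarrow> vector_field M (\<lambda>p. J p (X p))) \<and>
     (\<forall>X Y. vector_field M X \<and> vector_field M Y \<longrightarrow>
        (\<forall>p\<in>M. levi_civita M g X (\<lambda>u. J u (Y u)) p = J p (levi_civita M g X Y p)))"

definition holomorphic_plane ::
    "'a::euclidean_space set \<Rightarrow> ('a \<Rightarrow> 'a \<Rightarrow> 'a) \<Rightarrow> 'a \<Rightarrow> 'a set \<Rightarrow> bool" where
  "holomorphic_plane M J p E \<longleftrightarrow>
     subspace E \<and> dim E = 2 \<and> E \<subseteq> tangent_space M p \<and> J p ` E \<subseteq> E"

definition metric_complement ::
    "'a::euclidean_space set \<Rightarrow> 'a metric \<Rightarrow> 'a \<Rightarrow> 'a set \<Rightarrow> 'a set" where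
  "metric_complement M g p V = {x \<in> tangent_space M p. \<forall>y\<in>V. g p x y = 0}"

text \<open>The angle between two planes is the least angle between their nonzero vectors. For two
  \<open>J\<close>-invariant planes and a Hermitian \<open>g\<close> both principal angles agree, so it is also the angle that any
  nonzero vector of one plane makes with the other plane.\<close>

definition plane_angle :: "'a::euclidean_space metric \<Rightarrow> 'a \<Rightarrow> 'a set \<Rightarrow> 'a set \<Rightarrow> real" where
  "plane_angle g p E F =
     Inf {arccos (g p x y / (sqrt (g p x x) * sqrt (g p y y))) | x y.
            x \<in> E \<and> x \<noteq> 0 \<and> y \<in> F \<and> y \<noteq> 0}"

definition quasi_constant_hsc ::
    "'a::euclidean_space set \<Rightarrow> 'a metric \<Rightarrow> ('a \<Rightarrow> 'a \<Rightarrow> 'a) \<Rightarrow> ('a \<Rightarrow> 'a set) \<Rightarrow> bool" where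
  "quasi_constant_hsc M g J D \<longleftrightarrow>
     (\<exists>K :: 'a \<Rightarrow> real \<Rightarrow> real. \<forall>p\<in>M. \<forall>E. holomorphic_plane M J p E \<longrightarrow>
        sectional_curvature M g p E = K p (plane_angle g p E (metric_complement M g p (D p))))"


section \<open>Rotational hypersurfaces in \<open>\<complex>\<^sup>n \<times> \<real>\<close>\<close>

text \<open>A point \<open>z + r e\<close> of the ambient space is the pair \<open>(z, r)\<close>; the inner product of the
  type \<open>complex ^ 'n\<close> is the real Euclidean one, and the unit vector \<open>e = (0, 1)\<close> is time-like.\<close>

definition lorentz :: "(complex ^ 'n) \<times> real \<Rightarrow> (complex ^ 'n) \<times> real \<Rightarrow> real" where
  "lorentz x y = fst x \<bullet> fst y - snd x * snd y"

definition J0 :: "(complex ^ 'n) \<times> real \<Rightarrow> (complex ^ 'n) \<times> real" where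
  "J0 x = (\<i> *s fst x, 0)"

definition rot_point ::
    "(real \<Rightarrow> real) \<Rightarrow> (real \<Rightarrow> real) \<Rightarrow> real \<times> (complex ^ 'n) \<Rightarrow> (complex ^ 'n) \<times> real" where
  "rot_point t q = (\<lambda>(s, n). (t s *\<^sub>R n, q s))"

definition rotational_hypersurface ::
    "real set \<Rightarrow> (real \<Rightarrow> real) \<Rightarrow> (real \<Rightarrow> real) \<Rightarrow> ((complex ^ 'n) \<times> real) set" where
  "rotational_hypersurface I t q = rot_point t q ` (I \<times> sphere 0 1)"

definition timelike_normals :: "((complex ^ 'n) \<times> real) set \<Rightarrow> bool" where
  "timelike_normals M \<longleftrightarrow>
     (\<forall>p\<in>M. \<forall>N. N \<noteq> 0 \<and> (\<forall>x\<in>tangent_space M p. lorentz N x = 0) \<longrightarrow> lorentz N N < 0)"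

text \<open>The parameters \<open>(s, n)\<close> of a point. They are unique for the hypersurfaces of type II:
  there \<open>t'\<^sup>2 = 1 + q'\<^sup>2\<close> makes \<open>t\<close> injective, and \<open>t > 0\<close>.\<close>

definition rot_param ::
    "real set \<Rightarrow> (real \<Rightarrow> real) \<Rightarrow> (real \<Rightarrow> real) \<Rightarrow> (complex ^ 'n) \<times> real \<Rightarrow> real \<times> (complex ^ 'n)" where
  "rot_param I t q = the_inv_into (I \<times> sphere 0 1) (rot_point t q)"

definition rot_xi_bar ::
    "real set \<Rightarrow> (real \<Rightarrow> real) \<Rightarrow> (real \<Rightarrow> real) \<Rightarrow> (complex ^ 'n) \<times> real \<Rightarrow> (complex ^ 'n) \<times> real" where
  "rot_xi_bar I t q p = (case rot_param I t q p of (s, n) \<Rightarrow> (deriv t s *\<^sub>R n, deriv q s))"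

definition rot_xi_tilde ::
    "real set \<Rightarrow> (real \<Rightarrow> real) \<Rightarrow> (real \<Rightarrow> real) \<Rightarrow> (complex ^ 'n) \<times> real \<Rightarrow> (complex ^ 'n) \<times> real" where
  "rot_xi_tilde I t q p = (case rot_param I t q p of (s, n) \<Rightarrow> J0 (n, 0))"

definition rot_t' :: "real set \<Rightarrow> (real \<Rightarrow> real) \<Rightarrow> (real \<Rightarrow> real) \<Rightarrow> (complex ^ 'n) \<times> real \<Rightarrow> real" where
  "rot_t' I t q p = deriv t (fst (rot_param I t q p))"

definition rot_eta_bar ::
    "real set \<Rightarrow> (real \<Rightarrow> real) \<Rightarrow> (real \<Rightarrow> real) \<Rightarrow> (complex ^ 'n) \<times> real \<Rightarrow> (complex ^ 'n) \<times> real \<Rightarrow> real" where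
  "rot_eta_bar I t q p x = lorentz (rot_xi_bar I t q p) x"

definition rot_eta_tilde ::
    "real set \<Rightarrow> (real \<Rightarrow> real) \<Rightarrow> (real \<Rightarrow> real) \<Rightarrow> (complex ^ 'n) \<times> real \<Rightarrow> (complex ^ 'n) \<times> real \<Rightarrow> real" where
  "rot_eta_tilde I t q p x = lorentz (rot_xi_tilde I t q p) x"

definition rot_Dperp ::
    "real set \<Rightarrow> (real \<Rightarrow> real) \<Rightarrow> (real \<Rightarrow> real) \<Rightarrow> (complex ^ 'n) \<times> real \<Rightarrow> ((complex ^ 'n) \<times> real) set" where
  "rot_Dperp I t q p = span {rot_xi_bar I t q p, rot_xi_tilde I t q p}"

definition rot_D ::
    "real set \<Rightarrow> (real \<Rightarrow> real) \<Rightarrow> (real \<Rightarrow> real) \<Rightarrow> (complex ^ 'n) \<times> real \<Rightarrow> ((complex ^ 'n) \<times> real) set" where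
  "rot_D I t q p =
     metric_complement (rotational_hypersurface I t q) (\<lambda>_. lorentz) p (rot_Dperp I t q p)"

text \<open>On tangent vectors the argument of \<open>J0\<close> is the \<open>D\<close>-component of \<open>x\<close>, because the two vectors
  spanning the complement of \<open>D\<close> are orthonormal for the induced metric; so this is the linear map
  that is \<open>J0\<close> on \<open>D\<close> and rotates the complement.\<close>

definition rot_J ::
    "real set \<Rightarrow> (real \<Rightarrow> real) \<Rightarrow> (real \<Rightarrow> real) \<Rightarrow>
     (complex ^ 'n) \<times> real \<Rightarrow> (complex ^ 'n) \<times> real \<Rightarrow> (complex ^ 'n) \<times> real" where
  "rot_J I t q p x =
     J0 (x - rot_eta_bar I t q p x *\<^sub>R rot_xi_bar I t q p
           - rot_eta_tilde I t q p x *\<^sub>R rot_xi_tilde I t q p)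
     + rot_eta_bar I t q p x *\<^sub>R rot_xi_tilde I t q p
     - rot_eta_tilde I t q p x *\<^sub>R rot_xi_bar I t q p"

definition rot_g ::
    "real set \<Rightarrow> (real \<Rightarrow> real) \<Rightarrow> (real \<Rightarrow> real) \<Rightarrow> ((complex ^ 'n) \<times> real) metric" where
  "rot_g I t q p x y =
     lorentz x y + (rot_t' I t q p - 1) *
       (rot_eta_bar I t q p x * rot_eta_bar I t q p y + rot_eta_tilde I t q p x * rot_eta_tilde I t q p y)"

definition rot_xi ::
    "real set \<Rightarrow> (real \<Rightarrow> real) \<Rightarrow> (real \<Rightarrow> real) \<Rightarrow> (complex ^ 'n) \<times> real \<Rightarrow> (complex ^ 'n) \<times> real" where
  "rot_xi I t q p = (1 / sqrt (rot_t' I t q p)) *\<^sub>R rot_xi_bar I t q p"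

end

(* In the chart z of the orthogonal projection to C^n, where z = t n, the hypersurface is the graph over an
   annulus of a radial function, and every object is given by functions of rho = |z|^2. The metric is
     g(u,v) = u.v + alpha (iz.u)(iz.v) + beta (z.u)(z.v),   w = t' = 1 + rho alpha,   beta = - alpha / w,
   and its Kaehler form is the standard symplectic form. The Christoffel symbols are explicit, and give
     R(u,Ju)u = (4 alpha P + 4 alpha' T) Ju + (4 alpha' P + 2 alpha'' T) J(rho u'),
   where P = g(u,u), u' is the component of u in the complex line of z, and T = rho g(u',u').
   Hence the holomorphic sectional curvature is - (4 alpha + 8 alpha' T/P + 2 alpha'' (T/P)^2), and T/P is rho times
   the squared cosine of the angle with the orthogonal complement of D. On D it is a = 4(1 - t')/t^2, while
   k^2 = 4 t'/t^2, so that a + k^2 = 4/t^2. *)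

theory Submission
  imports Defs
begin

section \<open>Calculus of smooth maps\<close>

text \<open>The deformation makes two scale factors reciprocal. On the unit radial vector of the
  chart, \<open>lorentz\<close> gives 1 - q'^2 / t'^2 = 1 / t'^2 by the natural parameter;
  multiplying by t' leaves 1 / t', while the direction iz gets t'. Areas in the complex line of z
  are therefore Euclidean, which is why the Kaehler form has constant coefficients and why \<beta>
  is forced to be - \<alpha> / w. The Christoffel symbol has a unitarily invariant shape whose two
  free coefficients are fixed by metric compatibility. The obstacle is that the connection is a
  \<open>SOME\<close>, and curvature tensor and sectional curvature are a \<open>THE\<close>, over
  ambient functions: existence, uniqueness and independence of extensions and bases must precede any
  computation. For a J-invariant plane, independence of the basis comes down to the single vector
  R(u,Ju)u, because R(u,Ju) commutes with J. The derivatives of \<alpha> enter the computation as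
  free real numbers, so that the curvature formula becomes an identity of rational
  functions.\<close>

lemma Ck_on_cong:
  assumes "open S" "\<And>x. x \<in> S \<Longrightarrow> f x = g x"
  shows "Ck_on k f S \<longleftrightarrow> Ck_on k g S"
proof -
  have "Ck_on k f S \<Longrightarrow> Ck_on k g S" if "\<And>x. x \<in> S \<Longrightarrow> f x = g x" for f g :: "'a \<Rightarrow> 'b"
    using that
  proof (induction k arbitrary: f g)
    case 0
    then show ?case by (simp cong: continuous_on_cong)
  next
    case (Suc k)
    have D: "(g has_derivative frechet_derivative f (at x)) (at x)" if "x \<in> S" for x
      using Suc.prems that frechet_derivative_works[of f "at x"]
      by (auto intro: has_derivative_transform_within_open[OF _ assms(1) that])
    then have eq: "frechet_derivative g (at x) = frechet_derivative f (at x)" if "x \<in> S" for x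
      using frechet_derivative_at[OF D] that by simp
    have "Ck_on k (\<lambda>x. frechet_derivative g (at x) v) S" for v
      by (rule Suc.IH[of "\<lambda>x. frechet_derivative f (at x) v"]) (use Suc.prems(1) in \<open>simp_all add: eq\<close>)
    then show ?case using D by (auto simp: differentiable_def)
  qed
  from this[of f g] this[of g f] show ?thesis using assms(2) by auto
qed

text \<open>\<open>Ck_on\<close> speaks of \<open>frechet_derivative\<close>; this form accepts any
  explicit derivative, so that each closure property below reduces to a differentiation rule and an
  induction on \<open>k\<close>.\<close>

lemma Ck_on_SucI:
  assumes "open S" "\<And>x. x \<in> S \<Longrightarrow> (f has_derivative f' x) (at x)"
    and "\<And>v. Ck_on k (\<lambda>x. f' x v) S"
  shows "Ck_on (Suc k) f S"
proof -
  have "Ck_on k (\<lambda>x. frechet_derivative f (at x) v) S" for v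
    using assms(3)[of v]
    by (rule iffD1[OF Ck_on_cong[OF assms(1)], rotated]) (simp add: frechet_derivative_at[OF assms(2), symmetric])
  with assms(2) show ?thesis by (auto simp: differentiable_def)
qed

lemma Ck_on_SucD:
  assumes "Ck_on (Suc k) f S"
  shows "x \<in> S \<Longrightarrow> (f has_derivative frechet_derivative f (at x)) (at x)"
    and "Ck_on k (\<lambda>x. frechet_derivative f (at x) v) S"
  using assms by (auto simp: frechet_derivative_works)

lemma Ck_on_mono_Suc: "Ck_on (Suc k) f S \<Longrightarrow> Ck_on k f S"
proof (induction k arbitrary: f)
  case 0
  then show ?case
    by (auto intro!: continuous_at_imp_continuous_on differentiable_imp_continuous_within)
next
  case (Suc k)
  have "Ck_on k (\<lambda>x. frechet_derivative f (at x) v) S" for v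
    by (rule Suc.IH) (use Suc.prems in auto)
  then show ?case using Suc.prems by auto
qed

lemma Ck_on_const: "open S \<Longrightarrow> Ck_on k (\<lambda>x. c) S"
  by (induction k arbitrary: c) (auto intro: Ck_on_SucI[where f'="\<lambda>x v. 0"])

lemma Ck_on_bounded_linear:
  assumes "open S" "bounded_linear h"
  shows "Ck_on k f S \<Longrightarrow> Ck_on k (\<lambda>x. h (f x)) S"
proof (induction k arbitrary: f)
  case 0
  then show ?case using bounded_linear.continuous_on[OF assms(2)] by auto
next
  case (Suc k)
  show ?case
    by (rule Ck_on_SucI[OF assms(1) bounded_linear.has_derivative[OF assms(2) Ck_on_SucD(1)[OF Suc.prems]]])
      (auto intro!: Suc.IH Ck_on_SucD(2)[OF Suc.prems])
qed

lemma Ck_on_ident: "open S \<Longrightarrow> Ck_on k (\<lambda>x. x) S"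
proof (cases k)
  case 0
  then show ?thesis by simp
next
  case (Suc m)
  assume "open S"
  then show ?thesis
    unfolding Suc by (intro Ck_on_SucI[where f'="\<lambda>x v. v"] Ck_on_const) auto
qed

lemma Ck_on_add:
  assumes "open S"
  shows "Ck_on k f S \<Longrightarrow> Ck_on k g S \<Longrightarrow> Ck_on k (\<lambda>x. f x + g x) S"
proof (induction k arbitrary: f g)
  case 0
  then show ?case by (auto intro: continuous_on_add)
next
  case (Suc k)
  show ?case
    by (rule Ck_on_SucI[OF assms has_derivative_add[OF Ck_on_SucD(1)[OF Suc.prems(1)] Ck_on_SucD(1)[OF Suc.prems(2)]]])
      (auto intro!: Suc.IH Ck_on_SucD(2)[OF Suc.prems(1)] Ck_on_SucD(2)[OF Suc.prems(2)])
qed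

lemma Ck_on_sum:
  assumes "open S"
  shows "(\<And>i. i \<in> B \<Longrightarrow> Ck_on k (f i) S) \<Longrightarrow> Ck_on k (\<lambda>x. \<Sum>i\<in>B. f i x) S"
  by (induction B rule: infinite_finite_induct) (auto intro: Ck_on_add Ck_on_const assms)

text \<open>Each term of the product rule leaves one factor undifferentiated;
  \<open>Ck_on_mono_Suc\<close> lowers its order, so that the induction hypothesis, general in both
  factors, applies.\<close>

lemma Ck_on_bilinear:
  assumes "open S" "bounded_bilinear h"
  shows "Ck_on k f S \<Longrightarrow> Ck_on k g S \<Longrightarrow> Ck_on k (\<lambda>x. h (f x) (g x)) S"
proof (induction k arbitrary: f g)
  case 0
  then show ?case by (auto intro: bounded_bilinear.continuous_on[OF assms(2)])
next
  case (Suc k)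
  show ?case
    by (rule Ck_on_SucI[OF assms(1) bounded_bilinear.FDERIV[OF assms(2) Ck_on_SucD(1)[OF Suc.prems(1)] Ck_on_SucD(1)[OF Suc.prems(2)]]])
      (auto intro!: Ck_on_add assms Suc.IH Ck_on_SucD(2)[OF Suc.prems(1)] Ck_on_SucD(2)[OF Suc.prems(2)]
        Ck_on_mono_Suc[OF Suc.prems(1)] Ck_on_mono_Suc[OF Suc.prems(2)])
qed

text \<open>Directions that vary with the point are expanded over \<open>Basis\<close>, because
  \<open>Ck_on\<close> controls derivatives only in fixed directions.\<close>

lemma derivative_basis_sum:
  fixes L :: "'a::euclidean_space \<Rightarrow> 'b::real_normed_vector"
  assumes "(f has_derivative L) F"
  shows "L v = (\<Sum>b\<in>Basis. (v \<bullet> b) *\<^sub>R L b)"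
proof -
  have "L v = L (\<Sum>b\<in>Basis. (v \<bullet> b) *\<^sub>R b)" by (simp add: euclidean_representation)
  then show ?thesis
    by (simp add: linear_sum[OF has_derivative_linear[OF assms]] linear_cmul[OF has_derivative_linear[OF assms]])
qed

text \<open>The chain rule differentiates \<open>g\<close> in the varying direction given by the
  derivative of \<open>f\<close>. Expansion over \<open>Basis\<close> leaves derivatives of
  \<open>g\<close> in fixed directions, composed with the same \<open>f\<close>; hence the induction
  generalises \<open>g\<close> and keeps \<open>f\<close>.\<close>

lemma Ck_on_compose:
  fixes f :: "'a::euclidean_space \<Rightarrow> 'b::euclidean_space" and g :: "'b \<Rightarrow> 'c::real_normed_vector"
  assumes "open S"
  shows "Ck_on k f S \<Longrightarrow> Ck_on k g T \<Longrightarrow> f ` S \<subseteq> T \<Longrightarrow> Ck_on k (\<lambda>x. g (f x)) S"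
proof (induction k arbitrary: g)
  case 0
  then show ?case by (auto intro: continuous_on_compose2)
next
  case (Suc k)
  let ?f = "\<lambda>x. frechet_derivative f (at x)" and ?g = "\<lambda>y. frechet_derivative g (at y)"
  have g: "(g has_derivative ?g (f x)) (at (f x))" if "x \<in> S" for x
    using Ck_on_SucD(1)[OF Suc.prems(2)] Suc.prems(3) that by auto
  have D: "((\<lambda>x. g (f x)) has_derivative (\<lambda>v. \<Sum>b\<in>Basis. (?f x v \<bullet> b) *\<^sub>R ?g (f x) b)) (at x)" if "x \<in> S" for x
    using has_derivative_compose[OF Ck_on_SucD(1)[OF Suc.prems(1) that] g[OF that]]
    by (rule has_derivative_eq_rhs) (auto simp: derivative_basis_sum[OF g[OF that], of "?f x _"])
  show ?case
    by (rule Ck_on_SucI[OF assms D])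
      (auto intro!: Ck_on_sum Ck_on_bilinear[OF _ bounded_bilinear_scaleR] assms
        Ck_on_bounded_linear[OF _ bounded_linear_inner_left] Ck_on_SucD(2)[OF Suc.prems(1)]
        Suc.IH Ck_on_mono_Suc[OF Suc.prems(1)] Ck_on_SucD(2)[OF Suc.prems(2)] Suc.prems(3))
qed

section \<open>Closure properties of smooth maps\<close>

lemma smooth_on_cong:
  "open S \<Longrightarrow> (\<And>x. x \<in> S \<Longrightarrow> f x = g x) \<Longrightarrow> smooth_on S f \<longleftrightarrow> smooth_on S g"
  unfolding smooth_on_def using Ck_on_cong by metis

lemma smooth_on_subset:
  assumes "smooth_on T f" "S \<subseteq> T"
  shows "smooth_on S f"
proof -
  have "Ck_on k f T \<Longrightarrow> Ck_on k f S" for k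
    by (induction k arbitrary: f) (use assms(2) in \<open>auto intro: continuous_on_subset\<close>)
  then show ?thesis using assms(1) by (auto simp: smooth_on_def)
qed

lemma smooth_on_has_derivative:
  "smooth_on S f \<Longrightarrow> x \<in> S \<Longrightarrow> (f has_derivative frechet_derivative f (at x)) (at x)"
  using Ck_on_SucD(1) unfolding smooth_on_def by blast

lemma smooth_on_frechet_derivative:
  "smooth_on S f \<Longrightarrow> smooth_on S (\<lambda>x. frechet_derivative f (at x) v)"
  using Ck_on_SucD(2) unfolding smooth_on_def by blast

lemma smooth_on_continuous_on: "smooth_on S f \<Longrightarrow> continuous_on S f"
  unfolding smooth_on_def by (metis Ck_on.simps(1))

named_theorems smooth_intros

lemma smooth_on_const [smooth_intros]: "open S \<Longrightarrow> smooth_on S (\<lambda>x. c)"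
  by (simp add: smooth_on_def Ck_on_const)

lemma smooth_on_ident [smooth_intros]: "open S \<Longrightarrow> smooth_on S (\<lambda>x. x)"
  by (simp add: smooth_on_def Ck_on_ident)

lemma smooth_on_bounded_linear:
  "bounded_linear h \<Longrightarrow> open S \<Longrightarrow> smooth_on S f \<Longrightarrow> smooth_on S (\<lambda>x. h (f x))"
  by (simp add: smooth_on_def Ck_on_bounded_linear)

lemma smooth_on_bilinear:
  "bounded_bilinear h \<Longrightarrow> open S \<Longrightarrow> smooth_on S f \<Longrightarrow> smooth_on S g \<Longrightarrow> smooth_on S (\<lambda>x. h (f x) (g x))"
  by (simp add: smooth_on_def Ck_on_bilinear)

lemma smooth_on_add [smooth_intros]:
  "open S \<Longrightarrow> smooth_on S f \<Longrightarrow> smooth_on S g \<Longrightarrow> smooth_on S (\<lambda>x. f x + g x)"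
  by (simp add: smooth_on_def Ck_on_add)

lemmas smooth_on_minus [smooth_intros] = smooth_on_bounded_linear[OF bounded_linear_minus[OF bounded_linear_ident]]
lemmas smooth_on_fst [smooth_intros] = smooth_on_bounded_linear[OF bounded_linear_fst]
lemmas smooth_on_snd [smooth_intros] = smooth_on_bounded_linear[OF bounded_linear_snd]
lemmas smooth_on_inner [smooth_intros] = smooth_on_bilinear[OF bounded_bilinear_inner]
lemmas smooth_on_scaleR [smooth_intros] = smooth_on_bilinear[OF bounded_bilinear_scaleR]

lemma smooth_on_mult [smooth_intros]:
  fixes f g :: "'a::euclidean_space \<Rightarrow> 'b::real_normed_algebra"
  shows "open S \<Longrightarrow> smooth_on S f \<Longrightarrow> smooth_on S g \<Longrightarrow> smooth_on S (\<lambda>x. f x * g x)"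
  by (rule smooth_on_bilinear[OF bounded_bilinear_mult])

lemma smooth_on_diff [smooth_intros]:
  "open S \<Longrightarrow> smooth_on S f \<Longrightarrow> smooth_on S g \<Longrightarrow> smooth_on S (\<lambda>x. f x - g x)"
  using smooth_on_add[of S f "\<lambda>x. - g x"] smooth_on_minus[of S g] by simp

lemma smooth_on_sum [smooth_intros]:
  "open S \<Longrightarrow> (\<And>i. i \<in> B \<Longrightarrow> smooth_on S (f i)) \<Longrightarrow> smooth_on S (\<lambda>x. \<Sum>i\<in>B. f i x)"
  by (simp add: smooth_on_def Ck_on_sum)

lemma smooth_on_Pair [smooth_intros]:
  assumes "open S" "smooth_on S f" "smooth_on S g"
  shows "smooth_on S (\<lambda>x. (f x, g x))"
proof -
  have "smooth_on S (\<lambda>x. (f x, 0) + (0, g x))"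
    by (intro smooth_on_add assms
        smooth_on_bounded_linear[of "\<lambda>y. (y, 0)", OF bounded_linear_Pair[OF bounded_linear_ident bounded_linear_zero]]
        smooth_on_bounded_linear[of "\<lambda>y. (0, y)", OF bounded_linear_Pair[OF bounded_linear_zero bounded_linear_ident]])
  then show ?thesis by simp
qed

lemma smooth_on_compose:
  fixes f :: "'a::euclidean_space \<Rightarrow> 'b::euclidean_space"
  shows "open S \<Longrightarrow> smooth_on S f \<Longrightarrow> smooth_on T g \<Longrightarrow> f ` S \<subseteq> T \<Longrightarrow> smooth_on S (\<lambda>x. g (f x))"
  unfolding smooth_on_def using Ck_on_compose by blast

lemma smooth_on_directional_derivative:
  assumes "open S" "smooth_on S f" "smooth_on S u"
  shows "smooth_on S (\<lambda>x. frechet_derivative f (at x) (u x))"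
proof -
  have "smooth_on S (\<lambda>x. \<Sum>b\<in>Basis. (u x \<bullet> b) *\<^sub>R frechet_derivative f (at x) b)"
    by (intro smooth_intros smooth_on_frechet_derivative assms)
  then show ?thesis
    by (rule iffD1[OF smooth_on_cong, rotated 2])
      (auto simp: assms(1) derivative_basis_sum[OF smooth_on_has_derivative[OF assms(2)], of _ "u _"])
qed

text \<open>Bootstrapping: if \<open>f\<close> is of class k, then so is its derivative
  \<open>F (f x)\<close>, hence \<open>f\<close> is of class k + 1. The reciprocal, the square root
  and the inverse function \<open>\<sigma>\<close> of the meridian all solve such an
  equation.\<close>

lemma smooth_on_autonomous:
  fixes f :: "real \<Rightarrow> real"
  assumes "open S" "\<And>x. x \<in> S \<Longrightarrow> (f has_real_derivative F (f x)) (at x)" "smooth_on T F" "f ` S \<subseteq> T"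
  shows "smooth_on S f"
proof -
  have "Ck_on k f S" for k
  proof (induction k)
    case 0
    show ?case
      using assms(2) by (auto intro!: continuous_at_imp_continuous_on DERIV_isCont)
  next
    case (Suc k)
    have "Ck_on k F T" using assms(3) by (simp add: smooth_on_def)
    then show ?case
      by (intro Ck_on_SucI[OF assms(1) assms(2)[unfolded has_field_derivative_def]] Ck_on_const assms(1)
          Ck_on_bilinear[OF _ bounded_bilinear_mult] Ck_on_compose[OF assms(1) Suc _ assms(4)])
  qed
  then show ?thesis by (simp add: smooth_on_def)
qed

lemma smooth_on_inverse_real: "smooth_on (- {0}) (inverse :: real \<Rightarrow> real)"
  by (rule smooth_on_autonomous[where F="\<lambda>y. - (y * y)" and T=UNIV])
    (auto intro!: smooth_intros derivative_eq_intros simp: open_Compl divide_simps)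

lemma smooth_on_inverse [smooth_intros]:
  fixes f :: "'a::euclidean_space \<Rightarrow> real"
  shows "open S \<Longrightarrow> smooth_on S f \<Longrightarrow> (\<And>x. x \<in> S \<Longrightarrow> f x \<noteq> 0) \<Longrightarrow> smooth_on S (\<lambda>x. inverse (f x))"
  by (rule smooth_on_compose[OF _ _ smooth_on_inverse_real]) auto

lemma smooth_on_divide [smooth_intros]:
  fixes f g :: "'a::euclidean_space \<Rightarrow> real"
  shows "open S \<Longrightarrow> smooth_on S f \<Longrightarrow> smooth_on S g \<Longrightarrow> (\<And>x. x \<in> S \<Longrightarrow> g x \<noteq> 0) \<Longrightarrow> smooth_on S (\<lambda>x. f x / g x)"
  unfolding divide_inverse by (intro smooth_intros)

lemma smooth_on_sqrt [smooth_intros]: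
  fixes f :: "'a::euclidean_space \<Rightarrow> real"
  assumes "open S" "smooth_on S f" "\<And>x. x \<in> S \<Longrightarrow> f x > 0"
  shows "smooth_on S (\<lambda>x. sqrt (f x))"
proof -
  have "smooth_on {0<..} sqrt"
    by (rule smooth_on_autonomous[where F="\<lambda>y. inverse y / 2" and T="{0<..}"])
      (auto intro!: smooth_intros derivative_eq_intros)
  then show ?thesis
    using assms by (intro smooth_on_compose[of S f "{0<..}" sqrt]) auto
qed

section \<open>Symmetry of second derivatives\<close>

lemma has_real_derivative_on_line:
  fixes f :: "'a::real_normed_vector \<Rightarrow> real"
  assumes "(f has_derivative D) (at (x + \<tau> *\<^sub>R u))"
  shows "((\<lambda>\<tau>. f (x + \<tau> *\<^sub>R u)) has_real_derivative D u) (at \<tau>)"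
proof -
  have "((\<lambda>\<tau>. f (x + \<tau> *\<^sub>R u)) has_derivative (\<lambda>h. D (h *\<^sub>R u))) (at \<tau>)"
    by (rule has_derivative_compose[of "\<lambda>\<tau>. x + \<tau> *\<^sub>R u" "\<lambda>h. h *\<^sub>R u" _ _ f, OF _ assms])
      (auto intro!: derivative_eq_intros)
  then show ?thesis
    by (simp add: has_field_derivative_def linear_cmul[OF has_derivative_linear[OF assms]] mult_commute_abs)
qed

text \<open>The mean value theorem is applied first along \<open>u\<close>, then along
  \<open>v\<close>. The second difference on the left is symmetric in \<open>u\<close> and
  \<open>v\<close>, so the same number arises from both orders of differentiation.\<close>

lemma double_difference_mean_value:
  fixes f :: "'a::euclidean_space \<Rightarrow> real"
  assumes s: "s > 0"
    and S: "\<And>a b. 0 \<le> a \<Longrightarrow> a \<le> s \<Longrightarrow> 0 \<le> b \<Longrightarrow> b \<le> s \<Longrightarrow> x + a *\<^sub>R u + b *\<^sub>R v \<in> S"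
    and f: "smooth_on S f"
  obtains a b where "0 \<le> a" "a \<le> s" "0 \<le> b" "b \<le> s"
    "f (x + s *\<^sub>R u + s *\<^sub>R v) - f (x + s *\<^sub>R u) - f (x + s *\<^sub>R v) + f x =
      s\<^sup>2 * frechet_derivative (\<lambda>x. frechet_derivative f (at x) u) (at (x + a *\<^sub>R u + b *\<^sub>R v)) v"
proof -
  let ?D = "\<lambda>x. frechet_derivative f (at x) u"
  have f': "((\<lambda>a. f (x + b *\<^sub>R v + a *\<^sub>R u)) has_real_derivative ?D (x + a *\<^sub>R u + b *\<^sub>R v)) (at a)"
    if "0 \<le> a" "a \<le> s" "0 \<le> b" "b \<le> s" for a b
    using has_real_derivative_on_line[of f _ "x + b *\<^sub>R v" a u] smooth_on_has_derivative[OF f S[OF that]]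
    by (simp add: add_ac)
  have D': "((\<lambda>b. ?D (x + a *\<^sub>R u + b *\<^sub>R v)) has_real_derivative
      frechet_derivative ?D (at (x + a *\<^sub>R u + b *\<^sub>R v)) v) (at b)"
    if "0 \<le> a" "a \<le> s" "0 \<le> b" "b \<le> s" for a b
    by (intro has_real_derivative_on_line smooth_on_has_derivative[OF _ S[OF that]] smooth_on_frechet_derivative f)
  let ?F = "\<lambda>a. f (x + s *\<^sub>R v + a *\<^sub>R u) - f (x + 0 *\<^sub>R v + a *\<^sub>R u)"
    and ?F' = "\<lambda>a. ?D (x + a *\<^sub>R u + s *\<^sub>R v) - ?D (x + a *\<^sub>R u + 0 *\<^sub>R v)"
  have "(?F has_real_derivative ?F' a) (at a)" if "0 \<le> a" "a \<le> s" for a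
    using s that by (intro DERIV_diff f') auto
  from MVT2[OF s this] obtain a where a: "0 < a" "a < s" "?F s - ?F 0 = (s - 0) * ?F' a"
    by blast
  have "((\<lambda>b. ?D (x + a *\<^sub>R u + b *\<^sub>R v)) has_real_derivative
      frechet_derivative ?D (at (x + a *\<^sub>R u + b *\<^sub>R v)) v) (at b)" if "0 \<le> b" "b \<le> s" for b
    using a that by (intro D') auto
  from MVT2[OF s this] obtain b where b: "0 < b" "b < s"
    "?F' a = (s - 0) * frechet_derivative ?D (at (x + a *\<^sub>R u + b *\<^sub>R v)) v"
    by blast
  show thesis
    using a b by (intro that[of a b]) (auto simp: power2_eq_square add_ac)
qed

lemma symmetric_second_derivative_real:
  fixes f :: "'a::euclidean_space \<Rightarrow> real"
  assumes S: "open S" "x \<in> S" and f: "smooth_on S f"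
  shows "frechet_derivative (\<lambda>x. frechet_derivative f (at x) u) (at x) v =
         frechet_derivative (\<lambda>x. frechet_derivative f (at x) v) (at x) u" (is "?P x = ?Q x")
proof (rule ccontr)
  assume ne: "?P x \<noteq> ?Q x"
  \<comment> \<open>Half the distance: numbers closer than this to \<open>?P x\<close> and to
    \<open>?Q x\<close> respectively cannot coincide.\<close>
  define \<epsilon> where "\<epsilon> = dist (?P x) (?Q x) / 2"
  have "\<epsilon> > 0" using ne by (simp add: \<epsilon>_def)
  have cont: "continuous_on S ?P" "continuous_on S ?Q"
    by (intro smooth_on_continuous_on smooth_on_frechet_derivative f)+
  then obtain d1 d2 where d: "d1 > 0" "\<And>y. y \<in> S \<Longrightarrow> dist y x < d1 \<Longrightarrow> dist (?P y) (?P x) < \<epsilon>"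
    "d2 > 0" "\<And>y. y \<in> S \<Longrightarrow> dist y x < d2 \<Longrightarrow> dist (?Q y) (?Q x) < \<epsilon>"
    unfolding continuous_on_iff using S(2) \<open>\<epsilon> > 0\<close> by metis
  obtain d0 where d0: "d0 > 0" "ball x d0 \<subseteq> S" using S openE by blast
  define d where "d = min d0 (min d1 d2)"
  \<comment> \<open>Keeps the whole parallelogram within \<open>d\<close> of \<open>x\<close>; the
    summand 1 makes the denominator positive even if both vectors are zero.\<close>
  define s where "s = d / (norm u + norm v + 1)"
  have pos: "norm u + norm v + 1 > 0" by (simp add: add_nonneg_pos)
  have "d > 0" using d d0 by (simp add: d_def)
  then have "s > 0" using pos by (simp add: s_def)
  have near: "dist (x + a *\<^sub>R u + b *\<^sub>R v) x < d" if "0 \<le> a" "a \<le> s" "0 \<le> b" "b \<le> s" for a b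
  proof -
    have "dist (x + a *\<^sub>R u + b *\<^sub>R v) x = norm (a *\<^sub>R u + b *\<^sub>R v)"
      by (simp add: dist_norm)
    also have "\<dots> \<le> a * norm u + b * norm v"
      using norm_triangle_ineq[of "a *\<^sub>R u" "b *\<^sub>R v"] that by simp
    also have "\<dots> \<le> s * norm u + s * norm v"
      using that by (intro add_mono mult_right_mono) auto
    also have "\<dots> < s * (norm u + norm v + 1)"
      using \<open>s > 0\<close> by (simp add: algebra_simps)
    also have "\<dots> = d" using pos by (simp add: s_def)
    finally show ?thesis .
  qed
  then have near': "x + a *\<^sub>R u + b *\<^sub>R v \<in> S" if "0 \<le> a" "a \<le> s" "0 \<le> b" "b \<le> s" for a b
    using that d0 by (force simp: d_def dist_commute)
  have near'': "x + a *\<^sub>R v + b *\<^sub>R u \<in> S" if "0 \<le> a" "a \<le> s" "0 \<le> b" "b \<le> s" for a b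
    using near'[of b a] that by (simp add: add_ac)
  obtain a b where 1: "0 \<le> a" "a \<le> s" "0 \<le> b" "b \<le> s"
    "f (x + s *\<^sub>R u + s *\<^sub>R v) - f (x + s *\<^sub>R u) - f (x + s *\<^sub>R v) + f x = s\<^sup>2 * ?P (x + a *\<^sub>R u + b *\<^sub>R v)"
    by (rule double_difference_mean_value[OF \<open>s > 0\<close> near' f])
  obtain a' b' where 2: "0 \<le> a'" "a' \<le> s" "0 \<le> b'" "b' \<le> s"
    "f (x + s *\<^sub>R v + s *\<^sub>R u) - f (x + s *\<^sub>R v) - f (x + s *\<^sub>R u) + f x = s\<^sup>2 * ?Q (x + a' *\<^sub>R v + b' *\<^sub>R u)"
    by (rule double_difference_mean_value[OF \<open>s > 0\<close> near'' f])
  have eq: "?P (x + a *\<^sub>R u + b *\<^sub>R v) = ?Q (x + b' *\<^sub>R u + a' *\<^sub>R v)"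
  proof -
    have "s\<^sup>2 * ?P (x + a *\<^sub>R u + b *\<^sub>R v) = s\<^sup>2 * ?Q (x + a' *\<^sub>R v + b' *\<^sub>R u)"
      unfolding 1(5)[symmetric] 2(5)[symmetric] by (simp add: algebra_simps)
    then show ?thesis using \<open>s > 0\<close> by (simp add: add_ac)
  qed
  have "dist (?P (x + a *\<^sub>R u + b *\<^sub>R v)) (?P x) < \<epsilon>" "dist (?Q (x + b' *\<^sub>R u + a' *\<^sub>R v)) (?Q x) < \<epsilon>"
    using near[OF 1(1-4)] near[OF 2(3,4,1,2)] near'[OF 1(1-4)] near'[OF 2(3,4,1,2)]
    by (auto intro!: d simp: d_def)
  then have "dist (?P x) (?Q x) < 2 * \<epsilon>"
    using dist_triangle2[of "?P x" "?Q x" "?P (x + a *\<^sub>R u + b *\<^sub>R v)"] unfolding eq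
    by (simp add: dist_commute)
  then show False by (simp add: \<epsilon>_def)
qed

lemma symmetric_second_derivative:
  fixes f :: "'a::euclidean_space \<Rightarrow> 'b::euclidean_space"
  assumes S: "open S" "x \<in> S" and f: "smooth_on S f"
  shows "frechet_derivative (\<lambda>x. frechet_derivative f (at x) u) (at x) v =
         frechet_derivative (\<lambda>x. frechet_derivative f (at x) v) (at x) u"
proof (rule euclidean_eqI)
  fix b :: 'b assume "b \<in> Basis"
  have D: "frechet_derivative (\<lambda>x. g x \<bullet> b) (at y) w = frechet_derivative g (at y) w \<bullet> b"
    if "smooth_on S g" "y \<in> S" for g :: "'a \<Rightarrow> 'b" and y w
    using frechet_derivative_at[OF has_derivative_inner_left[OF smooth_on_has_derivative[OF that], of b]]
    by metis
  \<comment> \<open>Projecting commutes with the inner derivative at the points of \<open>S\<close>;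
    openness of \<open>S\<close> is what allows this equality to be differentiated again.\<close>
  have DD: "frechet_derivative (\<lambda>x. frechet_derivative (\<lambda>x. f x \<bullet> b) (at x) w) (at x) w' =
      frechet_derivative (\<lambda>x. frechet_derivative f (at x) w) (at x) w' \<bullet> b" for w w'
  proof -
    have "frechet_derivative (\<lambda>x. frechet_derivative (\<lambda>x. f x \<bullet> b) (at x) w) (at x) =
        frechet_derivative (\<lambda>x. frechet_derivative f (at x) w \<bullet> b) (at x)"
    proof (rule frechet_derivative_transform_within_open[OF _ S])
      show "(\<lambda>x. frechet_derivative (\<lambda>x. f x \<bullet> b) (at x) w) differentiable at x"
        using smooth_on_has_derivative[OF smooth_on_frechet_derivative[OF smooth_on_inner[OF S(1) f smooth_on_const[OF S(1)]]] S(2)]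
        by (auto simp: differentiable_def)
    qed (simp add: D f)
    then show ?thesis by (simp add: D[OF smooth_on_frechet_derivative[OF f] S(2)])
  qed
  show "frechet_derivative (\<lambda>x. frechet_derivative f (at x) u) (at x) v \<bullet> b =
    frechet_derivative (\<lambda>x. frechet_derivative f (at x) v) (at x) u \<bullet> b"
    unfolding DD[symmetric]
    by (intro symmetric_second_derivative_real[OF S] smooth_intros S f)
qed

section \<open>Graphs as submanifolds\<close>

text \<open>\<open>smooth_map\<close> provides its own neighbourhood and extension at each point;
  this glues them.\<close>

lemma smooth_on_local:
  assumes "\<And>x. x \<in> S \<Longrightarrow> \<exists>U. open U \<and> x \<in> U \<and> smooth_on U f"
  shows "smooth_on S f"
proof -
  have "Ck_on k f S" if "\<And>x. x \<in> S \<Longrightarrow> \<exists>U. open U \<and> x \<in> U \<and> Ck_on k f U" for k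
    using that
  proof (induction k arbitrary: f)
    case 0
    then show ?case
      by (metis Ck_on.simps(1) continuous_at_imp_continuous_on continuous_on_eq_continuous_at)
  next
    case (Suc k)
    have "Ck_on k (\<lambda>x. frechet_derivative f (at x) v) S" for v
    proof (rule Suc.IH)
      fix x assume "x \<in> S"
      from Suc.prems[OF this] obtain U where "open U" "x \<in> U" "Ck_on (Suc k) f U" by blast
      then show "\<exists>U. open U \<and> x \<in> U \<and> Ck_on k (\<lambda>x. frechet_derivative f (at x) v) U"
        using Ck_on_SucD(2) by blast
    qed
    moreover have "f differentiable (at x)" if "x \<in> S" for x
      using Suc.prems[OF that] by auto
    ultimately show ?case by simp
  qed
  then show ?thesis using assms unfolding smooth_on_def by metis
qed

text \<open>The chart of a graph is inverted by \<open>fst\<close>, so a map on \<open>M\<close>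
  extends to the ambient space by being constant in the second component, and every object on
  \<open>M\<close> becomes a function on the open set \<open>A\<close>.\<close>

locale graph =
  fixes A :: "'a::euclidean_space set" and Q :: "'a \<Rightarrow> 'b::euclidean_space" and M :: "('a \<times> 'b) set"
  assumes open_A: "open A" and smooth_Q: "smooth_on A Q" and M_eq: "M = (\<lambda>z. (z, Q z)) ` A"
begin

text \<open>The differential at \<open>z\<close> of the parametrisation of the graph.\<close>

definition push :: "'a \<Rightarrow> 'a \<Rightarrow> 'a \<times> 'b" where
  "push z v = (v, frechet_derivative Q (at z) v)"

text \<open>The coordinate expression of a field. No information on tangent fields is lost, since
  \<open>fst\<close> is a left inverse of \<open>push z\<close>.\<close>

definition rep :: "('a \<times> 'b \<Rightarrow> 'a \<times> 'b) \<Rightarrow> 'a \<Rightarrow> 'a" where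
  "rep X z = fst (X (z, Q z))"

lemma lift_in_M [simp]: "z \<in> A \<Longrightarrow> (z, Q z) \<in> M"
  by (simp add: M_eq)

lemma M_cases:
  assumes "p \<in> M"
  obtains z where "z \<in> A" "p = (z, Q z)"
  using assms by (auto simp: M_eq)

lemma fst_push [simp]: "fst (push z v) = v"
  by (simp add: push_def)

lemma push_inject [simp]: "push z u = push z v \<longleftrightarrow> u = v"
  by (auto simp: push_def)

lemma linear_push: "z \<in> A \<Longrightarrow> linear (push z)"
  using has_derivative_linear[OF smooth_on_has_derivative[OF smooth_Q]]
  by (auto simp: linear_iff push_def)

lemma push_add: "z \<in> A \<Longrightarrow> push z (u + v) = push z u + push z v"
  and push_diff: "z \<in> A \<Longrightarrow> push z (u - v) = push z u - push z v"
  and push_scaleR: "z \<in> A \<Longrightarrow> push z (c *\<^sub>R u) = c *\<^sub>R push z u"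
  and push_minus: "z \<in> A \<Longrightarrow> push z (- u) = - push z u"
  and push_0: "z \<in> A \<Longrightarrow> push z 0 = 0"
  using linear_push by (simp_all add: linear_add linear_diff linear_cmul linear_neg linear_0)

lemma push_eq_0_iff: "z \<in> A \<Longrightarrow> push z u = 0 \<longleftrightarrow> u = 0"
  using push_inject[of z u 0] push_0 by metis

lemma lift_has_derivative: "z \<in> A \<Longrightarrow> ((\<lambda>z. (z, Q z)) has_derivative push z) (at z)"
  unfolding push_def
  by (intro has_derivative_Pair has_derivative_ident smooth_on_has_derivative[OF smooth_Q])

text \<open>Forwards, a local extension is composed with the lift; backwards, the extension that is
  constant along the second factor works on all of \<open>A \<times> UNIV\<close>.\<close>

lemma smooth_map_iff: "smooth_map M f \<longleftrightarrow> smooth_on A (\<lambda>z. f (z, Q z))"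
proof
  assume f: "smooth_map M f"
  show "smooth_on A (\<lambda>z. f (z, Q z))"
  proof (rule smooth_on_local)
    fix z assume z: "z \<in> A"
    obtain U F where U: "open U" "(z, Q z) \<in> U" "smooth_on U F" "\<And>x. x \<in> U \<inter> M \<Longrightarrow> F x = f x"
      using f z unfolding smooth_map_def by (meson lift_in_M)
    define V where "V = A \<inter> (\<lambda>z. (z, Q z)) -` U"
    have "continuous_on A (\<lambda>z. (z, Q z))"
      by (intro continuous_intros smooth_on_continuous_on smooth_Q)
    then have V: "open V"
      unfolding V_def by (rule continuous_open_preimage[OF _ open_A U(1)])
    have "smooth_on V (\<lambda>z. F (z, Q z))"
      by (rule smooth_on_compose[OF V _ U(3)])
        (use V in \<open>auto intro!: smooth_intros smooth_on_subset[OF smooth_Q] simp: V_def\<close>)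
    then have "smooth_on V (\<lambda>z. f (z, Q z))"
      by (rule iffD1[OF smooth_on_cong[OF V], rotated]) (auto simp: V_def U(4))
    then show "\<exists>U. open U \<and> z \<in> U \<and> smooth_on U (\<lambda>z. f (z, Q z))"
      using V U z by (auto simp: V_def)
  qed
next
  assume f: "smooth_on A (\<lambda>z. f (z, Q z))"
  have op: "open (A \<times> (UNIV :: 'b set))" using open_A by (simp add: open_Times)
  have "smooth_on (A \<times> (UNIV :: 'b set)) (\<lambda>p. f (fst p, Q (fst p)))"
    by (rule smooth_on_compose[OF op _ f]) (auto intro!: smooth_intros op)
  then show "smooth_map M f"
    unfolding smooth_map_def using op
    by (intro ballI exI[of _ "A \<times> UNIV"] exI[of _ "\<lambda>p. f (fst p, Q (fst p))"]) (auto simp: M_eq)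
qed

lemma smooth_push: "smooth_on A U \<Longrightarrow> smooth_on A (\<lambda>z. push z (U z))"
  unfolding push_def by (intro smooth_intros open_A smooth_on_directional_derivative smooth_Q)

text \<open>A curve in \<open>M\<close> is the lift of its first component, so its velocity is a
  pushed vector; conversely a pushed vector is the velocity of a lifted straight line.\<close>

lemma tangent_space_eq:
  assumes z: "z \<in> A"
  shows "tangent_space M (z, Q z) = range (push z)"
proof (intro equalityI subsetI)
  fix v assume "v \<in> tangent_space M (z, Q z)"
  then obtain c \<epsilon> where c: "\<epsilon> > 0" "c ` {-\<epsilon><..<\<epsilon>} \<subseteq> M" "c 0 = (z, Q z)" "(c has_vector_derivative v) (at 0)"
    unfolding tangent_space_def by blast
  have c1: "((\<lambda>\<tau>. fst (c \<tau>)) has_derivative (\<lambda>h. h *\<^sub>R fst v)) (at 0)"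
    using has_derivative_fst[OF c(4)[unfolded has_vector_derivative_def]] by simp
  have "((\<lambda>\<tau>. (fst (c \<tau>), Q (fst (c \<tau>)))) has_derivative (\<lambda>h. push z (h *\<^sub>R fst v))) (at 0)"
    using has_derivative_compose[OF c1, of "\<lambda>z. (z, Q z)" "push z"] lift_has_derivative[OF z] c(3) by simp
  then have "(c has_derivative (\<lambda>h. push z (h *\<^sub>R fst v))) (at 0)"
  proof (rule has_derivative_transform_within_open)
    fix \<tau> assume "\<tau> \<in> {-\<epsilon><..<\<epsilon>}"
    then have "c \<tau> \<in> M" using c(2) by blast
    then show "(fst (c \<tau>), Q (fst (c \<tau>))) = c \<tau>" by (auto simp: M_eq)
  qed (use c(1) in auto)
  then have "(\<lambda>h. h *\<^sub>R v) = (\<lambda>h. push z (h *\<^sub>R fst v))"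
    using c(4) has_derivative_unique unfolding has_vector_derivative_def by blast
  then have "v = push z (fst v)" by (metis scaleR_one)
  then show "v \<in> range (push z)" by blast
next
  fix v assume "v \<in> range (push z)"
  then obtain u where v: "v = push z u" by blast
  have "isCont (\<lambda>\<tau>. z + \<tau> *\<^sub>R u) (0::real)" by (intro continuous_intros)
  then have "\<forall>\<^sub>F \<tau> in nhds (0::real). z + \<tau> *\<^sub>R u \<in> A"
    using z open_A unfolding continuous_at_open eventually_nhds by (metis (no_types, lifting) add.right_neutral scaleR_zero_left)
  then obtain \<epsilon> where e: "\<epsilon> > 0" "\<And>\<tau>::real. \<bar>\<tau>\<bar> < \<epsilon> \<Longrightarrow> z + \<tau> *\<^sub>R u \<in> A"
    unfolding eventually_nhds_metric by (auto simp: dist_real_def)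
  let ?c = "\<lambda>\<tau>::real. (z + \<tau> *\<^sub>R u, Q (z + \<tau> *\<^sub>R u))"
  have "(\<lambda>\<tau>. z + \<tau> *\<^sub>R u) ` {-\<epsilon><..<\<epsilon>} \<subseteq> A" using e by auto
  then have "smooth_on {-\<epsilon><..<\<epsilon>} ?c"
    by (intro smooth_intros smooth_on_compose[OF _ _ smooth_Q]) auto
  moreover have "(?c has_vector_derivative v) (at 0)"
    unfolding has_vector_derivative_def v push_scaleR[OF z, symmetric]
  proof (rule has_derivative_compose[of "\<lambda>\<tau>. z + \<tau> *\<^sub>R u" "\<lambda>h. h *\<^sub>R u" _ _ "\<lambda>z. (z, Q z)" "push z"])
    show "((\<lambda>z. (z, Q z)) has_derivative push z) (at (z + 0 *\<^sub>R u))"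
      using lift_has_derivative[OF z] by simp
  qed (auto intro!: derivative_eq_intros)
  ultimately show "v \<in> tangent_space M (z, Q z)"
    unfolding tangent_space_def using e by (auto intro!: exI[of _ ?c] exI[of _ \<epsilon>])
qed

lemma vector_fieldI:
  assumes "smooth_on A U" "\<And>z. z \<in> A \<Longrightarrow> X (z, Q z) = push z (U z)"
  shows "vector_field M X"
proof -
  have "smooth_map M X"
    unfolding smooth_map_iff using smooth_push[OF assms(1)]
    by (rule iffD1[OF smooth_on_cong[OF open_A], rotated]) (simp add: assms(2))
  then show ?thesis
    by (auto simp: vector_field_def tangent_space_eq assms(2) elim!: M_cases)
qed

lemma vector_fieldD:
  assumes "vector_field M X"
  shows "smooth_map M X" "smooth_on A (rep X)" "z \<in> A \<Longrightarrow> X (z, Q z) = push z (rep X z)"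
proof -
  show X: "smooth_map M X" using assms by (simp add: vector_field_def)
  show "smooth_on A (rep X)"
    unfolding rep_def using X by (intro smooth_intros open_A) (simp add: smooth_map_iff)
  assume z: "z \<in> A"
  have "X (z, Q z) \<in> range (push z)"
    using assms lift_in_M[OF z] unfolding vector_field_def tangent_space_eq[OF z, symmetric] by blast
  then show "X (z, Q z) = push z (rep X z)" by (auto simp: rep_def)
qed

lemma vector_field_push: "smooth_on A U \<Longrightarrow> vector_field M (\<lambda>p. push (fst p) (U (fst p)))"
  by (rule vector_fieldI) auto

text \<open>A derivative within \<open>M\<close> exists by local extension but is not unique.
  Composed with the lift, whose image is \<open>M\<close>, it becomes a derivative on the open set
  \<open>A\<close>, and there uniqueness identifies it.\<close>

lemma deriv_along_eq:
  assumes X: "vector_field M X" and f: "smooth_map M f" and z: "z \<in> A"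
  shows "deriv_along M X f (z, Q z) = frechet_derivative (\<lambda>z. f (z, Q z)) (at z) (rep X z)"
proof -
  obtain U F where U: "open U" "(z, Q z) \<in> U" "smooth_on U F" "\<And>x. x \<in> U \<inter> M \<Longrightarrow> F x = f x"
    using f z unfolding smooth_map_def by (meson lift_in_M)
  obtain d where d: "d > 0" "ball (z, Q z) d \<subseteq> U" using openE[OF U(1,2)] by blast
  have "(F has_derivative frechet_derivative F (at (z, Q z))) (at (z, Q z) within M)"
    using smooth_on_has_derivative[OF U(3,2)] has_derivative_at_withinI by blast
  then have "(f has_derivative frechet_derivative F (at (z, Q z))) (at (z, Q z) within M)"
    by (rule has_derivative_transform_within[OF _ d(1) lift_in_M[OF z]]) (use d U(4) in \<open>auto simp: dist_commute\<close>)
  then have f': "(f has_derivative frechet_derivative f (at (z, Q z) within M)) (at (z, Q z) within M)"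
    using differentiableI frechet_derivative_works by blast
  have "((\<lambda>z. f (z, Q z)) has_derivative (\<lambda>v. frechet_derivative f (at (z, Q z) within M) (push z v))) (at z within A)"
    using has_derivative_in_compose[OF has_derivative_at_withinI[OF lift_has_derivative[OF z]]
      has_derivative_subset[OF f'], of A] M_eq by auto
  then have "((\<lambda>z. f (z, Q z)) has_derivative (\<lambda>v. frechet_derivative f (at (z, Q z) within M) (push z v))) (at z)"
    using at_within_open[OF z open_A] by simp
  from frechet_derivative_at[OF this] show ?thesis
    by (simp add: deriv_along_def vector_fieldD(3)[OF X z] fun_eq_iff)
qed

lemma vector_field_deriv_along_rep:
  assumes "vector_field M X" "vector_field M Y" "z \<in> A"
  shows "fst (deriv_along M X Y (z, Q z)) = frechet_derivative (rep Y) (at z) (rep X z)"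
proof -
  have "((\<lambda>z. Y (z, Q z)) has_derivative frechet_derivative (\<lambda>z. Y (z, Q z)) (at z)) (at z)"
    by (intro smooth_on_has_derivative[OF _ assms(3)] vector_fieldD(1)[OF assms(2), unfolded smooth_map_iff])
  from has_derivative_fst[OF this] have "(rep Y has_derivative (\<lambda>v. fst (frechet_derivative (\<lambda>z. Y (z, Q z)) (at z) v))) (at z)"
    by (simp add: rep_def[abs_def])
  from frechet_derivative_at[OF this] show ?thesis
    by (simp add: deriv_along_eq[OF assms(1) vector_fieldD(1)[OF assms(2)] assms(3)] fun_eq_iff)
qed

text \<open>Product rule for the second component of \<open>Y\<close>, which is the derivative of
  \<open>Q\<close> in direction \<open>rep Y\<close>. The sum over \<open>Basis\<close> is the
  Hessian of \<open>Q\<close> at the two fields; being symmetric, it cancels in the Lie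
  bracket.\<close>

lemma deriv_along_vector_field:
  assumes X: "vector_field M X" and Y: "vector_field M Y" and z: "z \<in> A"
  shows "snd (deriv_along M X Y (z, Q z)) =
    frechet_derivative Q (at z) (frechet_derivative (rep Y) (at z) (rep X z)) +
    (\<Sum>b\<in>Basis. (rep Y z \<bullet> b) *\<^sub>R frechet_derivative (\<lambda>z. frechet_derivative Q (at z) b) (at z) (rep X z))"
proof -
  let ?DQ = "\<lambda>z. frechet_derivative Q (at z)"
  have Y': "(rep Y has_derivative frechet_derivative (rep Y) (at z)) (at z)"
    by (rule smooth_on_has_derivative[OF vector_fieldD(2)[OF Y] z])
  have eq: "snd (Y (y, Q y)) = (\<Sum>b\<in>Basis. (rep Y y \<bullet> b) *\<^sub>R ?DQ y b)" if "y \<in> A" for y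
    unfolding vector_fieldD(3)[OF Y that] push_def snd_conv
    by (rule derivative_basis_sum[OF smooth_on_has_derivative[OF smooth_Q that]])
  have 1: "((\<lambda>z. snd (Y (z, Q z))) has_derivative (\<lambda>v. snd (frechet_derivative (\<lambda>z. Y (z, Q z)) (at z) v))) (at z)"
    by (intro has_derivative_snd smooth_on_has_derivative[OF _ z] vector_fieldD(1)[OF Y, unfolded smooth_map_iff])
  have "((\<lambda>y. \<Sum>b\<in>Basis. (rep Y y \<bullet> b) *\<^sub>R ?DQ y b) has_derivative
     (\<lambda>v. \<Sum>b\<in>Basis. (rep Y z \<bullet> b) *\<^sub>R frechet_derivative (\<lambda>z. ?DQ z b) (at z) v
        + (frechet_derivative (rep Y) (at z) v \<bullet> b) *\<^sub>R ?DQ z b)) (at z)"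
    by (intro has_derivative_sum has_derivative_scaleR has_derivative_inner_left Y'
        smooth_on_has_derivative[OF smooth_on_frechet_derivative[OF smooth_Q] z])
  then have "((\<lambda>y. snd (Y (y, Q y))) has_derivative
     (\<lambda>v. \<Sum>b\<in>Basis. (rep Y z \<bullet> b) *\<^sub>R frechet_derivative (\<lambda>z. ?DQ z b) (at z) v
        + (frechet_derivative (rep Y) (at z) v \<bullet> b) *\<^sub>R ?DQ z b)) (at z)"
    by (rule has_derivative_transform_within_open[OF _ open_A z]) (simp add: eq)
  from fun_cong[OF has_derivative_unique[OF this 1], of "rep X z", symmetric] show ?thesis
    using derivative_basis_sum[OF smooth_on_has_derivative[OF smooth_Q z], of "frechet_derivative (rep Y) (at z) (rep X z)"]
    by (simp add: deriv_along_eq[OF X vector_fieldD(1)[OF Y] z] sum.distrib add.commute)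
qed

lemma lie_bracket_eq:
  assumes X: "vector_field M X" and Y: "vector_field M Y" and z: "z \<in> A"
  shows "lie_bracket M X Y (z, Q z) =
    push z (frechet_derivative (rep Y) (at z) (rep X z) - frechet_derivative (rep X) (at z) (rep Y z))"
proof -
  let ?B = "\<lambda>u v. \<Sum>b\<in>Basis. (v \<bullet> b) *\<^sub>R frechet_derivative (\<lambda>z. frechet_derivative Q (at z) b) (at z) u"
  have "?B u v = frechet_derivative (\<lambda>z. frechet_derivative Q (at z) u) (at z) v" for u v
    using derivative_basis_sum[OF smooth_on_has_derivative[OF smooth_on_frechet_derivative[OF smooth_Q] z], of u v]
    by (simp add: symmetric_second_derivative[OF open_A z smooth_Q, of u])
  then have "?B u v = ?B v u" for u v
    using symmetric_second_derivative[OF open_A z smooth_Q] by metis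
  from this[of "rep X z" "rep Y z"] show ?thesis
    by (intro prod_eqI)
      (simp_all add: lie_bracket_def vector_field_deriv_along_rep[OF X Y z] vector_field_deriv_along_rep[OF Y X z]
        deriv_along_vector_field[OF X Y z] deriv_along_vector_field[OF Y X z] push_def
        linear_diff[OF has_derivative_linear[OF smooth_on_has_derivative[OF smooth_Q z]]])
qed

lemma vector_field_lie_bracket:
  assumes "vector_field M X" "vector_field M Y"
  shows "vector_field M (lie_bracket M X Y)"
  by (rule vector_fieldI[OF _ lie_bracket_eq[OF assms]])
    (intro smooth_intros smooth_on_directional_derivative open_A vector_fieldD assms)

lemma rep_lie_bracket:
  assumes "vector_field M X" "vector_field M Y" "z \<in> A"
  shows "rep (lie_bracket M X Y) z = frechet_derivative (rep Y) (at z) (rep X z) - frechet_derivative (rep X) (at z) (rep Y z)"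
  by (simp add: rep_def[of "lie_bracket M X Y"] lie_bracket_eq[OF assms])

end

section \<open>Levi-Civita connections in a chart\<close>

text \<open>\<open>G\<close> and \<open>\<Gamma>\<close> are the metric and the Christoffel symbol
  in the chart; \<open>G'\<close> and \<open>\<Gamma>'\<close> are their derivatives in the base
  point alone, along the first vector argument. Symmetry of \<open>\<Gamma>\<close> and
  \<open>\<Gamma>_metric\<close> characterise the Levi-Civita connection, so an explicit symbol only
  has to be checked against them.\<close>

locale graph_metric = graph A Q M
  for A :: "'a::euclidean_space set" and Q :: "'a \<Rightarrow> 'b::euclidean_space" and M +
  fixes g :: "('a \<times> 'b) metric" and G :: "'a \<Rightarrow> 'a \<Rightarrow> 'a \<Rightarrow> real"
    and G' :: "'a \<Rightarrow> 'a \<Rightarrow> 'a \<Rightarrow> 'a \<Rightarrow> real"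
    and \<Gamma> :: "'a \<Rightarrow> 'a \<Rightarrow> 'a \<Rightarrow> 'a" and \<Gamma>' :: "'a \<Rightarrow> 'a \<Rightarrow> 'a \<Rightarrow> 'a \<Rightarrow> 'a"
  assumes g_push: "z \<in> A \<Longrightarrow> g (z, Q z) (push z u) (push z v) = G z u v"
    and G_sym: "z \<in> A \<Longrightarrow> G z u v = G z v u"
    and G_linear: "z \<in> A \<Longrightarrow> linear (\<lambda>u. G z u v)"
    and G_pos: "z \<in> A \<Longrightarrow> u \<noteq> 0 \<Longrightarrow> G z u u > 0"
    and G_smooth: "smooth_on A U \<Longrightarrow> smooth_on A V \<Longrightarrow> smooth_on A (\<lambda>z. G z (U z) (V z))"
    and G_deriv: "z \<in> A \<Longrightarrow> (U has_derivative U') (at z) \<Longrightarrow> (V has_derivative V') (at z) \<Longrightarrow>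
      ((\<lambda>z. G z (U z) (V z)) has_derivative
        (\<lambda>x. G' z x (U z) (V z) + G z (U' x) (V z) + G z (U z) (V' x))) (at z)"
    and \<Gamma>_sym: "z \<in> A \<Longrightarrow> \<Gamma> z u v = \<Gamma> z v u"
    and \<Gamma>_linear: "z \<in> A \<Longrightarrow> linear (\<lambda>u. \<Gamma> z u v)"
    and \<Gamma>_smooth: "smooth_on A U \<Longrightarrow> smooth_on A V \<Longrightarrow> smooth_on A (\<lambda>z. \<Gamma> z (U z) (V z))"
    and \<Gamma>_deriv: "z \<in> A \<Longrightarrow> (U has_derivative U') (at z) \<Longrightarrow> (V has_derivative V') (at z) \<Longrightarrow>
      ((\<lambda>z. \<Gamma> z (U z) (V z)) has_derivative
        (\<lambda>x. \<Gamma>' z x (U z) (V z) + \<Gamma> z (U' x) (V z) + \<Gamma> z (U z) (V' x))) (at z)"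
    and \<Gamma>_metric: "z \<in> A \<Longrightarrow> G' z x u v = G z (\<Gamma> z x u) v + G z u (\<Gamma> z x v)"
begin

lemma G_add_left: "z \<in> A \<Longrightarrow> G z (u + u') v = G z u v + G z u' v"
  and G_scaleR_left: "z \<in> A \<Longrightarrow> G z (c *\<^sub>R u) v = c * G z u v"
  and G_minus_left: "z \<in> A \<Longrightarrow> G z (- u) v = - G z u v"
  and G_zero_left: "z \<in> A \<Longrightarrow> G z 0 v = 0"
  and G_diff_left: "z \<in> A \<Longrightarrow> G z (u - u') v = G z u v - G z u' v"
  using linear_add[OF G_linear] linear_cmul[OF G_linear] linear_neg[OF G_linear] linear_0[OF G_linear]
    linear_diff[OF G_linear] by auto

lemma G_add_right: "z \<in> A \<Longrightarrow> G z v (u + u') = G z v u + G z v u'"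
  and G_scaleR_right: "z \<in> A \<Longrightarrow> G z v (c *\<^sub>R u) = c * G z v u"
  and G_minus_right: "z \<in> A \<Longrightarrow> G z v (- u) = - G z v u"
  and G_zero_right: "z \<in> A \<Longrightarrow> G z v 0 = 0"
  and G_diff_right: "z \<in> A \<Longrightarrow> G z v (u - u') = G z v u - G z v u'"
  using G_add_left G_scaleR_left G_minus_left G_zero_left G_diff_left by (simp_all add: G_sym[of z v])

lemmas G_simps = G_add_left G_scaleR_left G_minus_left G_zero_left G_diff_left
  G_add_right G_scaleR_right G_minus_right G_zero_right G_diff_right

lemma \<Gamma>_add_left: "z \<in> A \<Longrightarrow> \<Gamma> z (u + u') v = \<Gamma> z u v + \<Gamma> z u' v"
  and \<Gamma>_scaleR_left: "z \<in> A \<Longrightarrow> \<Gamma> z (c *\<^sub>R u) v = c *\<^sub>R \<Gamma> z u v"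
  and \<Gamma>_diff_left: "z \<in> A \<Longrightarrow> \<Gamma> z (u - u') v = \<Gamma> z u v - \<Gamma> z u' v"
  using linear_add[OF \<Gamma>_linear] linear_cmul[OF \<Gamma>_linear] linear_diff[OF \<Gamma>_linear] by auto

lemma \<Gamma>_add_right: "z \<in> A \<Longrightarrow> \<Gamma> z v (u + u') = \<Gamma> z v u + \<Gamma> z v u'"
  and \<Gamma>_scaleR_right: "z \<in> A \<Longrightarrow> \<Gamma> z v (c *\<^sub>R u) = c *\<^sub>R \<Gamma> z v u"
  and \<Gamma>_diff_right: "z \<in> A \<Longrightarrow> \<Gamma> z v (u - u') = \<Gamma> z v u - \<Gamma> z v u'"
  using \<Gamma>_add_left \<Gamma>_scaleR_left \<Gamma>_diff_left by (simp_all add: \<Gamma>_sym[of z v])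

lemmas \<Gamma>_simps = \<Gamma>_add_left \<Gamma>_scaleR_left \<Gamma>_diff_left \<Gamma>_add_right \<Gamma>_scaleR_right \<Gamma>_diff_right

lemma g_rep:
  assumes "vector_field M X" "vector_field M Y" "z \<in> A"
  shows "g (z, Q z) (X (z, Q z)) (Y (z, Q z)) = G z (rep X z) (rep Y z)"
  by (simp add: vector_fieldD(3)[OF assms(1,3)] vector_fieldD(3)[OF assms(2,3)] g_push assms(3))

lemma smooth_map_g:
  assumes "vector_field M X" "vector_field M Y"
  shows "smooth_map M (\<lambda>p. g p (X p) (Y p))"
proof -
  have "smooth_on A (\<lambda>z. G z (rep X z) (rep Y z))"
    by (intro G_smooth vector_fieldD assms)
  then show ?thesis
    unfolding smooth_map_iff by (rule iffD1[OF smooth_on_cong[OF open_A], rotated]) (simp add: g_rep assms)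
qed

lemma riemannian_metric_g: "riemannian_metric M g"
proof -
  have "g p x y = g p y x \<and> g p (x + y) z = g p x z + g p y z \<and> g p (c *\<^sub>R x) y = c * g p x y \<and> (x \<noteq> 0 \<longrightarrow> g p x x > 0)"
    if "p \<in> M" and tangent: "x \<in> tangent_space M p" "y \<in> tangent_space M p" "z \<in> tangent_space M p" for p x y z c
  proof -
    obtain w where w: "w \<in> A" "p = (w, Q w)" using M_cases[OF \<open>p \<in> M\<close>] by blast
    obtain x' y' z' where "x = push w x'" "y = push w y'" "z = push w z'"
      using tangent unfolding w(2) tangent_space_eq[OF w(1)] by blast
    then show ?thesis
      using w(1) by (simp add: w(2) push_add[symmetric] push_scaleR[symmetric] push_eq_0_iff g_push G_simps G_pos)
        (rule G_sym[OF w(1)])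
  qed
  then show ?thesis
    unfolding riemannian_metric_def using smooth_map_g by blast
qed

definition conn :: "('a \<times> 'b \<Rightarrow> 'a \<times> 'b) \<Rightarrow> ('a \<times> 'b \<Rightarrow> 'a \<times> 'b) \<Rightarrow> 'a \<times> 'b \<Rightarrow> 'a \<times> 'b" where
  "conn X Y p = push (fst p) (frechet_derivative (rep Y) (at (fst p)) (rep X (fst p)) + \<Gamma> (fst p) (rep X (fst p)) (rep Y (fst p)))"

lemma rep_conn: "rep (conn X Y) z = frechet_derivative (rep Y) (at z) (rep X z) + \<Gamma> z (rep X z) (rep Y z)"
  by (simp add: rep_def[of "conn X Y"] conn_def)

lemma conn_lift: "conn X Y (z, Q z) = push z (rep (conn X Y) z)"
  unfolding rep_conn by (simp add: conn_def)

lemma vector_field_conn: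
  assumes "vector_field M X" "vector_field M Y"
  shows "vector_field M (conn X Y)"
proof (rule vector_fieldI)
  show "smooth_on A (rep (conn X Y))"
    unfolding rep_conn[abs_def]
    by (intro smooth_intros \<Gamma>_smooth smooth_on_directional_derivative open_A vector_fieldD assms)
qed (rule conn_lift)

lemma rep_has_derivative:
  "vector_field M X \<Longrightarrow> z \<in> A \<Longrightarrow> (rep X has_derivative frechet_derivative (rep X) (at z)) (at z)"
  by (rule smooth_on_has_derivative[OF vector_fieldD(2)])

text \<open>Existence, which gives the \<open>SOME\<close> in \<open>levi_civita\<close> its
  meaning. Vanishing torsion is the symmetry of \<open>\<Gamma>\<close>, compatibility is
  \<open>\<Gamma>_metric\<close>.\<close>

lemma levi_civita_conn: "levi_civita_connection M g conn"
proof -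
  have "conn (\<lambda>u. f u *\<^sub>R X u + h u *\<^sub>R Y u) Z p = f p *\<^sub>R conn X Z p + h p *\<^sub>R conn Y Z p \<and>
      conn X (\<lambda>u. Y u + Z u) p = conn X Y p + conn X Z p \<and>
      conn X (\<lambda>u. f u *\<^sub>R Y u) p = deriv_along M X f p *\<^sub>R Y p + f p *\<^sub>R conn X Y p \<and>
      conn X Y p - conn Y X p = lie_bracket M X Y p \<and>
      deriv_along M X (\<lambda>u. g u (Y u) (Z u)) p = g p (conn X Y p) (Z p) + g p (Y p) (conn X Z p)"
    if X: "vector_field M X" and Y: "vector_field M Y" and Z: "vector_field M Z"
      and f: "smooth_map M f" and h: "smooth_map M h" and p: "p \<in> M"
    for X Y Z and f h :: "'a \<times> 'b \<Rightarrow> real" and p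
  proof -
    obtain z where z: "z \<in> A" and p: "p = (z, Q z)" using M_cases[OF p] by blast
    note X' = rep_has_derivative[OF X z] and Y' = rep_has_derivative[OF Y z] and Z' = rep_has_derivative[OF Z z]
    have f': "((\<lambda>z. f (z, Q z)) has_derivative frechet_derivative (\<lambda>z. f (z, Q z)) (at z)) (at z)"
      using f z unfolding smooth_map_iff by (rule smooth_on_has_derivative)
    have "conn (\<lambda>u. f u *\<^sub>R X u + h u *\<^sub>R Y u) Z p = f p *\<^sub>R conn X Z p + h p *\<^sub>R conn Y Z p"
      unfolding p conn_lift push_scaleR[OF z, symmetric] push_add[OF z, symmetric] push_inject rep_conn
      by (simp add: rep_def[of "\<lambda>u. f u *\<^sub>R X u + h u *\<^sub>R Y u"] rep_def[of X] rep_def[of Y] z \<Gamma>_simps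
          linear_add[OF has_derivative_linear[OF Z']] linear_cmul[OF has_derivative_linear[OF Z']] scaleR_add_right)
    moreover have "conn X (\<lambda>u. Y u + Z u) p = conn X Y p + conn X Z p"
    proof -
      have "rep (\<lambda>u. Y u + Z u) = (\<lambda>z. rep Y z + rep Z z)" by (simp add: rep_def[abs_def])
      then show ?thesis
        unfolding p conn_lift push_scaleR[OF z, symmetric] push_add[OF z, symmetric] push_inject rep_conn
        by (simp add: frechet_derivative_at[OF has_derivative_add[OF Y' Z'], symmetric] z \<Gamma>_simps)
    qed
    moreover have "conn X (\<lambda>u. f u *\<^sub>R Y u) p = deriv_along M X f p *\<^sub>R Y p + f p *\<^sub>R conn X Y p"
    proof -
      have "rep (\<lambda>u. f u *\<^sub>R Y u) = (\<lambda>z. f (z, Q z) *\<^sub>R rep Y z)" by (simp add: rep_def[abs_def])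
      then show ?thesis
        unfolding p conn_lift vector_fieldD(3)[OF Y z] push_scaleR[OF z, symmetric] push_add[OF z, symmetric] push_inject rep_conn
        by (simp add: frechet_derivative_at[OF has_derivative_scaleR[OF f' Y'], symmetric] z \<Gamma>_simps
            deriv_along_eq[OF X f z] scaleR_add_right)
    qed
    moreover have "conn X Y p - conn Y X p = lie_bracket M X Y p"
      unfolding p conn_lift lie_bracket_eq[OF X Y z] push_diff[OF z, symmetric] push_inject rep_conn
      by (simp add: \<Gamma>_sym[OF z, of "rep X z"])
    moreover have "deriv_along M X (\<lambda>u. g u (Y u) (Z u)) p = g p (conn X Y p) (Z p) + g p (Y p) (conn X Z p)"
    proof -
      have "((\<lambda>z. g (z, Q z) (Y (z, Q z)) (Z (z, Q z))) has_derivative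
         (\<lambda>x. G' z x (rep Y z) (rep Z z) + G z (frechet_derivative (rep Y) (at z) x) (rep Z z)
           + G z (rep Y z) (frechet_derivative (rep Z) (at z) x))) (at z)"
        by (rule has_derivative_transform_within_open[OF G_deriv[OF z Y' Z'] open_A z]) (simp add: g_rep[OF Y Z])
      from fun_cong[OF frechet_derivative_at[OF this], of "rep X z", symmetric] show ?thesis
        unfolding p conn_lift vector_fieldD(3)[OF Y z] vector_fieldD(3)[OF Z z] g_push[OF z] rep_conn
          deriv_along_eq[OF X smooth_map_g[OF Y Z] z]
        by (simp add: \<Gamma>_metric G_simps z)
    qed
    ultimately show ?thesis by blast
  qed
  then show ?thesis
    unfolding levi_civita_connection_def using vector_field_conn by blast
qed

text \<open>The difference \<open>T\<close> of two connections is symmetric, since both have no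
  torsion, and skew for the metric. Using the two properties alternately, three times each, turns
  the product of \<open>T X Y\<close> with \<open>Z\<close> into its own negative.\<close>

lemma levi_civita_connection_unique:
  assumes 1: "levi_civita_connection M g conn1" and 2: "levi_civita_connection M g conn2"
    and X: "vector_field M X" and Y: "vector_field M Y" and p: "p \<in> M"
  shows "conn1 X Y p = conn2 X Y p"
proof -
  obtain z where z: "z \<in> A" and pz: "p = (z, Q z)" using M_cases[OF p] by blast
  \<comment> \<open>The clauses of \<open>levi_civita_connection\<close> also quantify over two
    smooth functions; the zero function instantiates both.\<close>
  have const: "smooth_map M (\<lambda>_. 0 :: real)"
    unfolding smooth_map_iff by (intro smooth_intros open_A)
  have vf: "vector_field M (conn1 X Y)" "vector_field M (conn2 X Y)"
    if "vector_field M X" "vector_field M Y" for X Y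
    using 1 2 that unfolding levi_civita_connection_def by blast+
  have LC: "conn X Y p - conn Y X p = lie_bracket M X Y p \<and>
      deriv_along M X (\<lambda>u. g u (Y u) (Z u)) p = g p (conn X Y p) (Z p) + g p (Y p) (conn X Z p)"
    if "levi_civita_connection M g conn" "vector_field M X" "vector_field M Y" "vector_field M Z" for conn X Y Z
    using that p const unfolding levi_civita_connection_def by blast
  define T where "T X Y = rep (conn1 X Y) z - rep (conn2 X Y) z" for X Y
  have torsion: "T X Y = T Y X" if XY: "vector_field M X" "vector_field M Y" for X Y
  proof -
    have "conn1 X Y p - conn1 Y X p = lie_bracket M X Y p" "conn2 X Y p - conn2 Y X p = lie_bracket M X Y p"
      using LC[OF 1 XY XY(1)] LC[OF 2 XY XY(1)] by simp_all
    then have "rep (conn1 X Y) z - rep (conn1 Y X) z = rep (conn2 X Y) z - rep (conn2 Y X) z"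
      unfolding rep_def pz by (metis fst_diff)
    then show ?thesis by (simp add: T_def algebra_simps)
  qed
  have metric: "G z (T X Y) (rep Z z) = - G z (rep Y z) (T X Z)"
    if XYZ: "vector_field M X" "vector_field M Y" "vector_field M Z" for X Y Z
  proof -
    have "deriv_along M X (\<lambda>u. g u (Y u) (Z u)) p = g p (conn1 X Y p) (Z p) + g p (Y p) (conn1 X Z p)"
      "deriv_along M X (\<lambda>u. g u (Y u) (Z u)) p = g p (conn2 X Y p) (Z p) + g p (Y p) (conn2 X Z p)"
      using LC[OF 1 XYZ] LC[OF 2 XYZ] by simp_all
    then have "G z (rep (conn1 X Y) z) (rep Z z) + G z (rep Y z) (rep (conn1 X Z) z) =
        G z (rep (conn2 X Y) z) (rep Z z) + G z (rep Y z) (rep (conn2 X Z) z)"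
      unfolding pz by (simp add: g_rep z vf XYZ)
    then show ?thesis by (simp add: T_def G_simps z)
  qed
  have "G z (T X Y) (T X Y) = 0"
  proof -
    \<comment> \<open>A field constant in the chart with value \<open>T X Y\<close> at the point, so
      that the product shown to vanish is a squared length.\<close>
    define Z where "Z = (\<lambda>p :: 'a \<times> 'b. push (fst p) (T X Y))"
    have Z: "vector_field M Z" and repZ: "rep Z z = T X Y"
      unfolding Z_def by (auto intro!: vector_field_push smooth_intros open_A simp: rep_def)
    have "G z (T X Y) (rep Z z) = - G z (rep Y z) (T X Z)" by (rule metric[OF X Y Z])
    also have "\<dots> = - G z (T Z X) (rep Y z)" by (simp add: torsion[OF X Z] G_sym[OF z])
    also have "\<dots> = G z (rep X z) (T Z Y)" by (simp add: metric[OF Z X Y])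
    also have "\<dots> = G z (T Y Z) (rep X z)" by (simp add: torsion[OF Z Y] G_sym[OF z])
    also have "\<dots> = - G z (rep Z z) (T Y X)" by (rule metric[OF Y Z X])
    also have "\<dots> = - G z (T X Y) (rep Z z)" by (simp add: torsion[OF Y X] G_sym[OF z])
    finally have "G z (T X Y) (rep Z z) = - G z (T X Y) (rep Z z)" .
    then show ?thesis by (simp add: repZ)
  qed
  then have "T X Y = 0" using G_pos[OF z] by force
  then show ?thesis
    using vector_fieldD(3)[OF vf(1)[OF X Y] z] vector_fieldD(3)[OF vf(2)[OF X Y] z] by (simp add: T_def pz)
qed

lemma levi_civita_connection_levi_civita: "levi_civita_connection M g (levi_civita M g)"
  unfolding levi_civita_def by (rule someI[of _ conn], rule levi_civita_conn)

lemma vector_field_levi_civita: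
  "vector_field M X \<Longrightarrow> vector_field M Y \<Longrightarrow> vector_field M (levi_civita M g X Y)"
  using levi_civita_connection_levi_civita unfolding levi_civita_connection_def by blast

lemma levi_civita_eq:
  "vector_field M X \<Longrightarrow> vector_field M Y \<Longrightarrow> p \<in> M \<Longrightarrow> levi_civita M g X Y p = conn X Y p"
  by (rule levi_civita_connection_unique[OF levi_civita_connection_levi_civita levi_civita_conn])

lemma rep_levi_civita:
  "vector_field M X \<Longrightarrow> vector_field M Y \<Longrightarrow> z \<in> A \<Longrightarrow>
    rep (levi_civita M g X Y) z = frechet_derivative (rep Y) (at z) (rep X z) + \<Gamma> z (rep X z) (rep Y z)"
  unfolding rep_conn[symmetric] by (simp add: rep_def levi_civita_eq)

text \<open>The classical expression of the curvature by Christoffel symbols, with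
  \<open>\<Gamma>'\<close> for their derivatives.\<close>

definition Rm :: "'a \<Rightarrow> 'a \<Rightarrow> 'a \<Rightarrow> 'a \<Rightarrow> 'a" where
  "Rm z x y v = \<Gamma>' z x y v - \<Gamma>' z y x v + \<Gamma> z x (\<Gamma> z y v) - \<Gamma> z y (\<Gamma> z x v)"

text \<open>In the first term the direction \<open>rep Y z\<close> is frozen, so that it is a
  genuine second derivative of \<open>rep Z\<close> and can cancel by symmetry in the
  curvature.\<close>

lemma frechet_derivative_rep_levi_civita:
  assumes Y: "vector_field M Y" and Z: "vector_field M Z" and z: "z \<in> A"
  shows "frechet_derivative (rep (levi_civita M g Y Z)) (at z) x =
    frechet_derivative (\<lambda>w. frechet_derivative (rep Z) (at w) (rep Y z)) (at z) x
    + frechet_derivative (rep Z) (at z) (frechet_derivative (rep Y) (at z) x)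
    + \<Gamma>' z x (rep Y z) (rep Z z) + \<Gamma> z (frechet_derivative (rep Y) (at z) x) (rep Z z)
    + \<Gamma> z (rep Y z) (frechet_derivative (rep Z) (at z) x)"
proof -
  let ?D = "\<lambda>X w. frechet_derivative (rep X) (at w)"
  note Y' = rep_has_derivative[OF Y z] and Z' = rep_has_derivative[OF Z z]
  have "((\<lambda>w. \<Sum>b\<in>Basis. (rep Y w \<bullet> b) *\<^sub>R ?D Z w b) has_derivative
      (\<lambda>x. \<Sum>b\<in>Basis. (rep Y z \<bullet> b) *\<^sub>R frechet_derivative (\<lambda>w. ?D Z w b) (at z) x + (?D Y z x \<bullet> b) *\<^sub>R ?D Z z b)) (at z)"
    by (intro has_derivative_sum has_derivative_scaleR has_derivative_inner_left Y'
        smooth_on_has_derivative[OF smooth_on_frechet_derivative[OF vector_fieldD(2)[OF Z]] z])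
  moreover have "(\<Sum>b\<in>Basis. (rep Y z \<bullet> b) *\<^sub>R frechet_derivative (\<lambda>w. ?D Z w b) (at z) x + (?D Y z x \<bullet> b) *\<^sub>R ?D Z z b) =
      frechet_derivative (\<lambda>w. ?D Z w (rep Y z)) (at z) x + ?D Z z (?D Y z x)" for x
    \<comment> \<open>Swapping the order of differentiation lets the sum over \<open>Basis\<close>
      be folded into one derivative in the direction \<open>rep Y z\<close>.\<close>
    unfolding symmetric_second_derivative[OF open_A z vector_fieldD(2)[OF Z], where v=x]
      derivative_basis_sum[OF smooth_on_has_derivative[OF smooth_on_frechet_derivative[OF vector_fieldD(2)[OF Z]] z], of x "rep Y z"]
      derivative_basis_sum[OF Z', of "?D Y z x"]
    by (simp add: sum.distrib)
  ultimately have "((\<lambda>w. \<Sum>b\<in>Basis. (rep Y w \<bullet> b) *\<^sub>R ?D Z w b) has_derivative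
      (\<lambda>x. frechet_derivative (\<lambda>w. ?D Z w (rep Y z)) (at z) x + ?D Z z (?D Y z x))) (at z)"
    by simp
  then have "((\<lambda>w. (\<Sum>b\<in>Basis. (rep Y w \<bullet> b) *\<^sub>R ?D Z w b) + \<Gamma> w (rep Y w) (rep Z w)) has_derivative
      (\<lambda>x. (frechet_derivative (\<lambda>w. ?D Z w (rep Y z)) (at z) x + ?D Z z (?D Y z x)) +
        (\<Gamma>' z x (rep Y z) (rep Z z) + \<Gamma> z (?D Y z x) (rep Z z) + \<Gamma> z (rep Y z) (?D Z z x)))) (at z)"
    by (intro has_derivative_add \<Gamma>_deriv z Y' Z')
  then have "(rep (levi_civita M g Y Z) has_derivative
      (\<lambda>x. (frechet_derivative (\<lambda>w. ?D Z w (rep Y z)) (at z) x + ?D Z z (?D Y z x)) +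
        (\<Gamma>' z x (rep Y z) (rep Z z) + \<Gamma> z (?D Y z x) (rep Z z) + \<Gamma> z (rep Y z) (?D Z z x)))) (at z)"
  proof (rule has_derivative_transform_within_open[OF _ open_A z])
    fix w assume w: "w \<in> A"
    show "(\<Sum>b\<in>Basis. (rep Y w \<bullet> b) *\<^sub>R ?D Z w b) + \<Gamma> w (rep Y w) (rep Z w) = rep (levi_civita M g Y Z) w"
      unfolding rep_levi_civita[OF Y Z w] derivative_basis_sum[OF rep_has_derivative[OF Z w], of "rep Y w"] ..
  qed
  from fun_cong[OF frechet_derivative_at[OF this], of x, symmetric] show ?thesis
    by (simp add: add.assoc)
qed

text \<open>Tensoriality: second derivatives of \<open>rep Z\<close> cancel by symmetry, first
  derivatives of \<open>rep X\<close> and \<open>rep Y\<close> against the bracket term, and the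
  derivatives of \<open>rep Z\<close> inside \<open>\<Gamma>\<close> between the two iterated
  terms.\<close>

lemma curvature_field_eq:
  assumes X: "vector_field M X" and Y: "vector_field M Y" and Z: "vector_field M Z" and z: "z \<in> A"
  shows "curvature_field M g X Y Z (z, Q z) = push z (Rm z (rep X z) (rep Y z) (rep Z z))"
proof -
  note vf = vector_field_levi_civita vector_field_lie_bracket X Y Z
  have lift: "levi_civita M g U V (z, Q z) = push z (rep (levi_civita M g U V) z)"
    if "vector_field M U" "vector_field M V" for U V
    using vector_fieldD(3)[OF vector_field_levi_civita[OF that] z] .
  note lin = has_derivative_linear[OF rep_has_derivative[OF Z z]]
  show ?thesis
    unfolding curvature_field_def Let_def
    by (simp add: lift vf push_diff[OF z, symmetric] rep_levi_civita z frechet_derivative_rep_levi_civita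
        rep_lie_bracket \<Gamma>_simps linear_diff[OF lin] Rm_def
        symmetric_second_derivative[OF open_A z vector_fieldD(2)[OF Z], of "rep X z" "rep Y z"])
qed

lemma curvature_tensor_eq:
  assumes z: "z \<in> A"
  shows "curvature_tensor M g (z, Q z) (push z x) (push z y) (push z v) = push z (Rm z x y v)"
  unfolding curvature_tensor_def
proof (rule the_equality)
  have "vector_field M (\<lambda>p. push (fst p) x)" for x
    by (intro vector_field_push smooth_intros open_A)
  then show "\<exists>X Y Z. vector_field M X \<and> vector_field M Y \<and> vector_field M Z \<and>
      X (z, Q z) = push z x \<and> Y (z, Q z) = push z y \<and> Z (z, Q z) = push z v \<and>
      push z (Rm z x y v) = curvature_field M g X Y Z (z, Q z)"
    by (intro exI[of _ "\<lambda>p. push (fst p) x"] exI[of _ "\<lambda>p. push (fst p) y"] exI[of _ "\<lambda>p. push (fst p) v"])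
      (simp add: curvature_field_eq z rep_def)
qed (auto simp: curvature_field_eq z rep_def)

end

section \<open>Holomorphic sectional curvature in a chart\<close>

text \<open>All vectors of \<open>E\<close> project to \<open>F\<close> with the same ratio
  \<open>c\<close> of squared lengths. Cauchy-Schwarz bounds every cosine by \<open>sqrt c\<close>,
  and the projection attains this bound.\<close>

lemma plane_angle_eqI:
  assumes E: "x0 \<in> E" "x0 \<noteq> 0" and F: "y0 \<in> F" "y0 \<noteq> 0"
    and posE: "\<And>x. x \<in> E \<Longrightarrow> x \<noteq> 0 \<Longrightarrow> g p x x > 0" and posF: "\<And>y. y \<in> F \<Longrightarrow> y \<noteq> 0 \<Longrightarrow> g p y y > 0"
    and proj: "\<And>x. x \<in> E \<Longrightarrow> \<exists>w\<in>F. g p w w = c * g p x x \<and> (\<forall>y\<in>F. g p x y = g p w y)"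
    and CS: "\<And>u v. u \<in> F \<Longrightarrow> v \<in> F \<Longrightarrow> (g p u v)\<^sup>2 \<le> g p u u * g p v v"
    and zero: "\<And>y. y \<in> F \<Longrightarrow> g p 0 y = 0"
    and c: "0 \<le> c" "c \<le> 1"
  shows "plane_angle g p E F = arccos (sqrt c)"
  unfolding plane_angle_def
proof (rule cInf_eq_minimum)
  obtain w where w: "w \<in> F" "g p w w = c * g p x0 x0" "\<And>y. y \<in> F \<Longrightarrow> g p x0 y = g p w y"
    using proj[OF E(1)] by blast
  have x0: "g p x0 x0 > 0" using posE E by blast
  have "\<exists>y\<in>F. y \<noteq> 0 \<and> g p x0 y / (sqrt (g p x0 x0) * sqrt (g p y y)) = sqrt c"
  \<comment> \<open>\<open>y0\<close> serves when the projection vanishes: then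
    \<open>c = 0\<close>, and any nonzero vector of \<open>F\<close> has cosine 0.\<close>
  proof (cases "w = 0")
    case True
    then have "g p w w = 0" using zero w(1) by simp
    then have "c = 0" using w(2) x0 by simp
    moreover have "g p x0 y0 = 0" using w(3)[OF F(1)] True zero[OF F(1)] by simp
    ultimately show ?thesis using F by auto
  next
    case False
    then have "c * g p x0 x0 > 0" using posF[OF w(1)] w(2) by simp
    then have "c > 0" using x0 by (simp add: zero_less_mult_iff)
    then have "c * g p x0 x0 / (sqrt (g p x0 x0) * sqrt (c * g p x0 x0)) = sqrt c"
      using x0 by (simp add: real_sqrt_mult field_simps)
    then show ?thesis using w False by (intro bexI[of _ w]) auto
  qed
  then show "arccos (sqrt c) \<in> {arccos (g p x y / (sqrt (g p x x) * sqrt (g p y y))) | x y. x \<in> E \<and> x \<noteq> 0 \<and> y \<in> F \<and> y \<noteq> 0}"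
    using E by force
next
  fix \<theta> assume "\<theta> \<in> {arccos (g p x y / (sqrt (g p x x) * sqrt (g p y y))) | x y. x \<in> E \<and> x \<noteq> 0 \<and> y \<in> F \<and> y \<noteq> 0}"
  then obtain x y where \<theta>: "\<theta> = arccos (g p x y / (sqrt (g p x x) * sqrt (g p y y)))"
    and xy: "x \<in> E" "x \<noteq> 0" "y \<in> F" "y \<noteq> 0" by blast
  obtain w where w: "w \<in> F" "g p w w = c * g p x x" "g p x y = g p w y"
    using proj[OF xy(1)] xy(3) by blast
  have pos: "g p x x > 0" "g p y y > 0" using posE posF xy by blast+
  have "(g p x y)\<^sup>2 \<le> (sqrt c * (sqrt (g p x x) * sqrt (g p y y)))\<^sup>2"
    using CS[OF w(1) xy(3)] w c pos by (simp add: power_mult_distrib mult_ac)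
  then have "\<bar>g p x y\<bar> \<le> \<bar>sqrt c * (sqrt (g p x x) * sqrt (g p y y))\<bar>"
    by (simp only: abs_le_square_iff)
  then have le: "\<bar>g p x y / (sqrt (g p x x) * sqrt (g p y y))\<bar> \<le> sqrt c"
    using pos c by (simp add: abs_mult divide_le_eq)
  show "arccos (sqrt c) \<le> \<theta>"
    unfolding \<theta> using le c real_sqrt_le_1_iff[of c] by (intro arccos_le_arccos) linarith+
qed

section \<open>Algebraic properties of the curvature in coordinates\<close>

context graph_metric
begin

lemma G_Cauchy_Schwarz:
  assumes z: "z \<in> A"
  shows "(G z u v)\<^sup>2 \<le> G z u u * G z v v"
proof (cases "v = 0")
  case True
  then show ?thesis using z by (simp add: G_simps)
next
  case False
  define c where "c = G z u v / G z v v"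
  have v: "G z v v > 0" using G_pos[OF z False] .
  have "0 \<le> G z (u - c *\<^sub>R v) (u - c *\<^sub>R v)"
    using G_pos[OF z, of "u - c *\<^sub>R v"] G_zero_left[OF z] by (cases "u - c *\<^sub>R v = 0") auto
  also have "\<dots> = G z u u - (G z u v)\<^sup>2 / G z v v"
    using v by (simp add: G_simps z G_sym[OF z, of v u] c_def power2_eq_square)
  finally show ?thesis using v by (simp add: field_simps)
qed

text \<open>Constant fields isolate \<open>\<Gamma>'\<close>; its linearity and symmetry then follow
  from those of \<open>\<Gamma>\<close> by uniqueness of derivatives.\<close>

lemma \<Gamma>'_has_derivative: "z \<in> A \<Longrightarrow> ((\<lambda>w. \<Gamma> w u v) has_derivative (\<lambda>x. \<Gamma>' z x u v)) (at z)"
  using \<Gamma>_deriv[of z "\<lambda>_. u" "\<lambda>_. 0" "\<lambda>_. v" "\<lambda>_. 0"] \<Gamma>_scaleR_left[of z 0] \<Gamma>_scaleR_right[of z _ 0] by simp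

lemma \<Gamma>'_linear_left:
  assumes z: "z \<in> A"
  shows "\<Gamma>' z (a *\<^sub>R x + b *\<^sub>R y) u v = a *\<^sub>R \<Gamma>' z x u v + b *\<^sub>R \<Gamma>' z y u v"
proof -
  note L = has_derivative_linear[OF \<Gamma>'_has_derivative[OF z, of u v]]
  show ?thesis using linear_add[OF L, of "a *\<^sub>R x" "b *\<^sub>R y"] linear_cmul[OF L] by simp
qed

lemma \<Gamma>'_sym:
  assumes z: "z \<in> A"
  shows "\<Gamma>' z x u v = \<Gamma>' z x v u"
proof -
  have "((\<lambda>w. \<Gamma> w v u) has_derivative (\<lambda>x. \<Gamma>' z x u v)) (at z)"
    by (rule has_derivative_transform_within_open[OF \<Gamma>'_has_derivative[OF z] open_A z]) (rule \<Gamma>_sym)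
  from has_derivative_unique[OF this \<Gamma>'_has_derivative[OF z]] show ?thesis
    by (simp add: fun_eq_iff)
qed

lemma \<Gamma>'_linear_middle:
  assumes z: "z \<in> A"
  shows "\<Gamma>' z u (a *\<^sub>R x + b *\<^sub>R y) v = a *\<^sub>R \<Gamma>' z u x v + b *\<^sub>R \<Gamma>' z u y v"
proof -
  have "((\<lambda>w. a *\<^sub>R \<Gamma> w x v + b *\<^sub>R \<Gamma> w y v) has_derivative (\<lambda>u. a *\<^sub>R \<Gamma>' z u x v + b *\<^sub>R \<Gamma>' z u y v)) (at z)"
    by (intro has_derivative_add has_derivative_scaleR_right \<Gamma>'_has_derivative z)
  then have "((\<lambda>w. \<Gamma> w (a *\<^sub>R x + b *\<^sub>R y) v) has_derivative (\<lambda>u. a *\<^sub>R \<Gamma>' z u x v + b *\<^sub>R \<Gamma>' z u y v)) (at z)"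
    by (rule has_derivative_transform_within_open[OF _ open_A z]) (simp add: \<Gamma>_simps)
  from has_derivative_unique[OF this \<Gamma>'_has_derivative[OF z]] show ?thesis
    by (simp add: fun_eq_iff)
qed

lemma Rm_antisym: "Rm z y x v = - Rm z x y v"
  by (simp add: Rm_def)

lemma Rm_self: "Rm z x x v = 0"
  by (simp add: Rm_def)

lemma Rm_linear_left:
  assumes z: "z \<in> A"
  shows "Rm z (a *\<^sub>R x + b *\<^sub>R y) u v = a *\<^sub>R Rm z x u v + b *\<^sub>R Rm z y u v"
  unfolding Rm_def \<Gamma>'_linear_left[OF z] \<Gamma>'_linear_middle[OF z]
  by (simp add: z \<Gamma>_simps algebra_simps)

lemma Rm_linear_middle:
  assumes z: "z \<in> A"
  shows "Rm z u (a *\<^sub>R x + b *\<^sub>R y) v = a *\<^sub>R Rm z u x v + b *\<^sub>R Rm z u y v"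
  by (subst (1 2 3) Rm_antisym) (simp add: Rm_linear_left[OF z])

lemma Rm_linear_right:
  assumes z: "z \<in> A"
  shows "Rm z u v (a *\<^sub>R x + b *\<^sub>R y) = a *\<^sub>R Rm z u v x + b *\<^sub>R Rm z u v y"
  unfolding Rm_def \<Gamma>'_sym[OF z, of _ _ "a *\<^sub>R x + b *\<^sub>R y"] \<Gamma>'_linear_middle[OF z]
  by (simp add: z \<Gamma>_simps \<Gamma>'_sym[OF z, of _ x] \<Gamma>'_sym[OF z, of _ y] algebra_simps)

text \<open>Skew-symmetry in the first two arguments turns a change of basis into its
  determinant.\<close>

lemma Rm_area:
  assumes z: "z \<in> A"
  shows "Rm z (a *\<^sub>R x + b *\<^sub>R y) (c *\<^sub>R x + d *\<^sub>R y) v = (a * d - b * c) *\<^sub>R Rm z x y v"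
  unfolding Rm_linear_left[OF z] Rm_linear_middle[OF z] Rm_self Rm_antisym[of z y x]
  by (simp add: algebra_simps)

text \<open>Fields are ambient functions, so fields that agree on \<open>M\<close> need not be
  equal; this permits rewriting on \<open>M\<close> inside a covariant derivative.\<close>

lemma levi_civita_cong:
  assumes "vector_field M X" "vector_field M Y" "vector_field M Z" "\<And>p. p \<in> M \<Longrightarrow> Y p = Z p" "p \<in> M"
  shows "levi_civita M g X Y p = levi_civita M g X Z p"
proof -
  obtain z where z: "z \<in> A" "p = (z, Q z)" using M_cases[OF assms(5)] by blast
  have eq: "rep Y w = rep Z w" if "w \<in> A" for w using that assms(4) by (simp add: rep_def)
  have "(rep Z has_derivative frechet_derivative (rep Y) (at z)) (at z)"
    by (rule has_derivative_transform_within_open[OF rep_has_derivative[OF assms(2) z(1)] open_A z(1)]) (rule eq)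
  from frechet_derivative_at[OF this] show ?thesis
    unfolding z(2) vector_fieldD(3)[OF vector_field_levi_civita[OF assms(1,2)] z(1)]
      vector_fieldD(3)[OF vector_field_levi_civita[OF assms(1,3)] z(1)]
    by (simp add: rep_levi_civita assms z eq)
qed

end

text \<open>\<open>j\<close> is \<open>J\<close> in the chart and \<open>j'\<close> its derivative
  in the base point; \<open>j_parallel\<close> is parallelism of \<open>J\<close> in
  coordinates.\<close>

locale graph_kaehler = graph_metric A Q M g G G' \<Gamma> \<Gamma>'
  for A :: "'a::euclidean_space set" and Q :: "'a \<Rightarrow> 'b::euclidean_space" and M g G G' \<Gamma> \<Gamma>' +
  fixes J :: "'a \<times> 'b \<Rightarrow> 'a \<times> 'b \<Rightarrow> 'a \<times> 'b" and j :: "'a \<Rightarrow> 'a \<Rightarrow> 'a" and j' :: "'a \<Rightarrow> 'a \<Rightarrow> 'a \<Rightarrow> 'a"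
  assumes J_push: "z \<in> A \<Longrightarrow> J (z, Q z) (push z v) = push z (j z v)"
    and j_linear: "z \<in> A \<Longrightarrow> linear (j z)"
    and j_j: "z \<in> A \<Longrightarrow> j z (j z v) = - v"
    and j_G: "z \<in> A \<Longrightarrow> G z (j z u) (j z v) = G z u v"
    and j_smooth: "smooth_on A U \<Longrightarrow> smooth_on A (\<lambda>z. j z (U z))"
    and j_deriv: "z \<in> A \<Longrightarrow> (U has_derivative U') (at z) \<Longrightarrow>
      ((\<lambda>z. j z (U z)) has_derivative (\<lambda>x. j' z x (U z) + j z (U' x))) (at z)"
    and j_parallel: "z \<in> A \<Longrightarrow> j' z x v + \<Gamma> z x (j z v) = j z (\<Gamma> z x v)"
begin

lemma j_add: "z \<in> A \<Longrightarrow> j z (u + v) = j z u + j z v"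
  and j_scaleR: "z \<in> A \<Longrightarrow> j z (c *\<^sub>R u) = c *\<^sub>R j z u"
  using linear_add[OF j_linear] linear_cmul[OF j_linear] by auto

lemma G_j_left: "z \<in> A \<Longrightarrow> G z (j z u) v = - G z u (j z v)"
  using j_G[of z "j z u" v] by (simp add: j_j G_simps)

lemma G_j_self: "z \<in> A \<Longrightarrow> G z u (j z u) = 0"
  using G_j_left[of z u u] G_sym[of z u "j z u"] by simp

lemma vector_field_J: "vector_field M X \<Longrightarrow> vector_field M (\<lambda>p. J p (X p))"
  by (rule vector_fieldI[of "\<lambda>z. j z (rep X z)"])
    (auto intro: j_smooth vector_fieldD simp: vector_fieldD(3) J_push)

lemma levi_civita_J:
  assumes X: "vector_field M X" and Y: "vector_field M Y" and p: "p \<in> M"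
  shows "levi_civita M g X (\<lambda>p. J p (Y p)) p = J p (levi_civita M g X Y p)"
proof -
  obtain z where z: "z \<in> A" "p = (z, Q z)" using M_cases[OF p] by blast
  have eq: "rep (\<lambda>p. J p (Y p)) w = j w (rep Y w)" if "w \<in> A" for w
    using that by (simp add: rep_def[of "\<lambda>p. J p (Y p)"] vector_fieldD(3)[OF Y] J_push)
  have "(rep (\<lambda>p. J p (Y p)) has_derivative (\<lambda>x. j' z x (rep Y z) + j z (frechet_derivative (rep Y) (at z) x))) (at z)"
    by (rule has_derivative_transform_within_open[OF j_deriv[OF z(1) rep_has_derivative[OF Y z(1)]] open_A z(1)])
      (simp add: eq)
  from fun_cong[OF frechet_derivative_at[OF this], of "rep X z", symmetric] show ?thesis
    unfolding z(2) vector_fieldD(3)[OF vector_field_levi_civita[OF X Y] z(1)] J_push[OF z(1)]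
      vector_fieldD(3)[OF vector_field_levi_civita[OF X vector_field_J[OF Y]] z(1)]
      rep_levi_civita[OF X Y z(1)] rep_levi_civita[OF X vector_field_J[OF Y] z(1)] push_inject eq[OF z(1)]
    by (simp add: j_add z j_parallel[OF z(1), symmetric])
qed

lemma kaehler_metric_g: "kaehler_metric M g J"
proof -
  have "J p x \<in> tangent_space M p \<and> J p (x + y) = J p x + J p y \<and> J p (c *\<^sub>R x) = c *\<^sub>R J p x \<and>
      J p (J p x) = - x \<and> g p (J p x) (J p y) = g p x y"
    if "p \<in> M" and tangent: "x \<in> tangent_space M p" "y \<in> tangent_space M p" for p x y c
  proof -
    obtain w where w: "w \<in> A" "p = (w, Q w)" using M_cases[OF \<open>p \<in> M\<close>] by blast
    obtain x' y' where "x = push w x'" "y = push w y'"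
      using tangent unfolding w(2) tangent_space_eq[OF w(1)] by blast
    then show ?thesis
      using w(1) by (simp add: w(2) push_add[symmetric] push_scaleR[symmetric] push_minus[symmetric]
          g_push J_push j_G j_j j_add j_scaleR tangent_space_eq)
  qed
  then show ?thesis
    unfolding kaehler_metric_def using riemannian_metric_g vector_field_J levi_civita_J by blast
qed

text \<open>Covariant derivatives commute with \<open>J\<close>, hence so does the curvature
  operator; the identity is read off from fields constant in the chart.\<close>

lemma Rm_j:
  assumes z: "z \<in> A"
  shows "Rm z x y (j z v) = j z (Rm z x y v)"
proof -
  define X Y V where "X = (\<lambda>p :: 'a \<times> 'b. push (fst p) x)" and "Y = (\<lambda>p :: 'a \<times> 'b. push (fst p) y)"
    and "V = (\<lambda>p :: 'a \<times> 'b. push (fst p) v)"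
  have XYV: "vector_field M X" "vector_field M Y" "vector_field M V"
    unfolding X_def Y_def V_def by (intro vector_field_push smooth_intros open_A)+
  have p: "(z, Q z) \<in> M" using z by simp
  let ?C = "levi_civita M g"
  \<comment> \<open>\<open>J\<close> leaves the inner derivative only at points of \<open>M\<close>,
    which is why the outer derivative is rewritten by \<open>levi_civita_cong\<close>.\<close>
  have CC: "?C X (?C Y (\<lambda>p. J p (V p))) (z, Q z) = J (z, Q z) (?C X (?C Y V) (z, Q z))"
    if "vector_field M X" "vector_field M Y" for X Y
    using levi_civita_cong[of X "?C Y (\<lambda>p. J p (V p))" "\<lambda>p. J p (?C Y V p)" "(z, Q z)"]
    by (simp add: that XYV p levi_civita_J vector_field_levi_civita vector_field_J)
  have tangent: "?C X Y (z, Q z) = push z (rep (?C X Y) z)" if "vector_field M X" "vector_field M Y" for X Y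
    using vector_fieldD(3)[OF vector_field_levi_civita[OF that] z] .
  have "curvature_field M g X Y (\<lambda>p. J p (V p)) (z, Q z) = J (z, Q z) (curvature_field M g X Y V (z, Q z))"
    unfolding curvature_field_def Let_def
    by (simp add: CC XYV p levi_civita_J vector_field_lie_bracket tangent vector_field_levi_civita J_push z
        push_diff[OF z, symmetric] linear_diff[OF j_linear[OF z]])
  then have "push z (Rm z x y (rep (\<lambda>p. J p (V p)) z)) = push z (j z (Rm z x y v))"
    unfolding curvature_field_eq[OF XYV z] curvature_field_eq[OF XYV(1,2) vector_field_J[OF XYV(3)] z] J_push[OF z]
    by (simp add: X_def Y_def V_def rep_def)
  then show ?thesis
    by (simp add: rep_def V_def J_push z)
qed

lemma independent_j:
  assumes z: "z \<in> A" and x: "x \<noteq> 0"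
  shows "push z x \<noteq> push z (j z x)" "independent {push z x, push z (j z x)}"
proof -
  have ne: "x \<noteq> c *\<^sub>R j z x" for c
    using G_pos[OF z x] G_j_self[OF z, of x] G_scaleR_right[OF z, of x c "j z x"] by auto
  have jx: "j z x \<noteq> 0" using ne[of 0] x j_j[OF z, of x] linear_0[OF j_linear[OF z]] by auto
  show "push z x \<noteq> push z (j z x)" using ne[of 1] by simp
  then show "independent {push z x, push z (j z x)}"
    using ne jx z by (auto simp: independent_insert span_singleton push_scaleR[symmetric] push_eq_0_iff)
qed

lemma span_j:
  assumes z: "z \<in> A"
  shows "span {push z x, push z (j z x)} = {push z (a *\<^sub>R x + b *\<^sub>R j z x) | a b. True}"
proof -
  have "v \<in> span {push z x, push z (j z x)} \<longleftrightarrow> (\<exists>a b. v = push z (a *\<^sub>R x + b *\<^sub>R j z x))" for v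
    by (simp add: span_breakdown_eq push_add[OF z] push_scaleR[OF z] diff_diff_eq)
  then show ?thesis by blast
qed

text \<open>A nonzero vector of the plane and its image under \<open>J\<close> are independent, so
  they already fill dimension 2.\<close>

lemma holomorphic_planeE:
  assumes z: "z \<in> A" and E: "holomorphic_plane M J (z, Q z) E"
  obtains x where "x \<noteq> 0" "E = span {push z x, push z (j z x)}"
proof -
  have E': "subspace E" "dim E = 2" "E \<subseteq> range (push z)" "J (z, Q z) ` E \<subseteq> E"
    using E by (auto simp: holomorphic_plane_def tangent_space_eq[OF z])
  have "\<not> E \<subseteq> {0}" using E'(2) dim_eq_0[of E] by auto
  then obtain e where "e \<in> E" "e \<noteq> 0" by blast
  then obtain x where x: "push z x \<in> E" "x \<noteq> 0" using E'(3) push_0[OF z] by blast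
  have jx: "push z (j z x) \<in> E"
    using subsetD[OF E'(4) imageI[OF x(1)]] unfolding J_push[OF z] .
  have "E \<subseteq> span {push z x, push z (j z x)}"
    using independent_j[OF z x(2)] E'(2) x(1) jx by (intro card_ge_dim_independent) auto
  moreover have "span {push z x, push z (j z x)} \<subseteq> E"
    using E'(1) x(1) jx by (intro span_minimal) auto
  ultimately show thesis using that x(2) by blast
qed

text \<open>The \<open>THE\<close> requires one value for all bases of the plane. By
  \<open>Rm_area\<close> and \<open>Rm_j\<close> every basis is governed by the single vector
  R(x,jx)x, and numerator and denominator both scale with the squared determinant. The assumption
  \<open>R\<close> is metric skew-symmetry at this vector, to be read off from the explicit
  curvature.\<close>

lemma sectional_curvature_eq:
  assumes z: "z \<in> A" and x: "x \<noteq> 0" and R: "G z (Rm z x (j z x) x) x = 0"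
  shows "sectional_curvature M g (z, Q z) (span {push z x, push z (j z x)}) =
    - G z (Rm z x (j z x) x) (j z x) / (G z x x)\<^sup>2"
proof -
  let ?V = "Rm z x (j z x) x" and ?p = "(z, Q z)" and ?P = "G z x x"
  have P: "?P > 0" using G_pos[OF z x] .
  have V: "G z (j z ?V) x = - G z ?V (j z x)" "G z (j z ?V) (j z x) = 0"
    using R by (simp_all add: G_j_left[OF z] j_j[OF z] G_simps z)
  have ratio: "g ?p (curvature_tensor M g ?p (push z u) (push z v) (push z v)) (push z u) /
      (g ?p (push z u) (push z u) * g ?p (push z v) (push z v) - (g ?p (push z u) (push z v))\<^sup>2) =
      - G z ?V (j z x) / ?P\<^sup>2"
    if uv: "u = a *\<^sub>R x + b *\<^sub>R j z x" "v = c *\<^sub>R x + d *\<^sub>R j z x" and \<Delta>: "a * d - b * c \<noteq> 0" for u v a b c d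
  proof -
    have "G z (Rm z u v v) u = (a * d - b * c) * G z (c *\<^sub>R ?V + d *\<^sub>R j z ?V) u"
      unfolding Rm_area[OF z, of a x b "j z x" c d v, folded uv] G_scaleR_left[OF z]
        Rm_linear_right[OF z, of x "j z x" c x d "j z x", folded uv(2)] Rm_j[OF z] ..
    also have "\<dots> = - (a * d - b * c)\<^sup>2 * G z ?V (j z x)"
      by (simp add: uv(1) G_simps z V R power2_eq_square algebra_simps)
    finally have num: "G z (Rm z u v v) u = (a * d - b * c)\<^sup>2 * (- G z ?V (j z x))" by simp
    have "G z u u = (a\<^sup>2 + b\<^sup>2) * ?P" "G z v v = (c\<^sup>2 + d\<^sup>2) * ?P" "G z u v = (a * c + b * d) * ?P"
      by (simp_all add: uv G_simps z j_G G_j_self G_sym[OF z, of "j z x" x] power2_eq_square algebra_simps)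
    then have den: "G z u u * G z v v - (G z u v)\<^sup>2 = (a * d - b * c)\<^sup>2 * ?P\<^sup>2"
      by (simp add: power2_eq_square algebra_simps)
    show ?thesis
      unfolding curvature_tensor_eq[OF z] g_push[OF z] num den using \<Delta> by simp
  qed
  show ?thesis
    unfolding sectional_curvature_def
  proof (rule the_equality)
    show "\<exists>u v. u \<noteq> v \<and> independent {u, v} \<and> span {u, v} = span {push z x, push z (j z x)} \<and>
        - G z ?V (j z x) / ?P\<^sup>2 = g ?p (curvature_tensor M g ?p u v v) u / (g ?p u u * g ?p v v - (g ?p u v)\<^sup>2)"
      using independent_j[OF z x] ratio[of x 1 0 "j z x" 0 1]
      by (intro exI[of _ "push z x"] exI[of _ "push z (j z x)"]) simp
  next
    fix \<kappa> assume "\<exists>u v. u \<noteq> v \<and> independent {u, v} \<and> span {u, v} = span {push z x, push z (j z x)} \<and>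
        \<kappa> = g ?p (curvature_tensor M g ?p u v v) u / (g ?p u u * g ?p v v - (g ?p u v)\<^sup>2)"
    then obtain u v where uv: "u \<noteq> v" "independent {u, v}" "span {u, v} = span {push z x, push z (j z x)}"
      and \<kappa>: "\<kappa> = g ?p (curvature_tensor M g ?p u v v) u / (g ?p u u * g ?p v v - (g ?p u v)\<^sup>2)" by blast
    have "u \<in> span {u, v}" "v \<in> span {u, v}" by (simp_all add: span_base)
    then obtain a b c d where u: "u = push z (a *\<^sub>R x + b *\<^sub>R j z x)" and v: "v = push z (c *\<^sub>R x + d *\<^sub>R j z x)"
      unfolding uv(3) span_j[OF z] by blast
    \<comment> \<open>With determinant zero, d u = b v and c u = a v. As \<open>u\<close> is no
      multiple of \<open>v\<close>, this forces c = d = 0; but these are the coordinates of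
      \<open>v\<close>, which is nonzero.\<close>
    have "a * d - b * c \<noteq> 0"
    proof
      assume "a * d - b * c = 0"
      then have "d *\<^sub>R u = b *\<^sub>R v" "c *\<^sub>R u = a *\<^sub>R v"
        unfolding u v push_scaleR[OF z, symmetric] by (simp_all add: scaleR_add_right mult.commute)
      moreover have "v \<noteq> 0" and ne: "u \<noteq> r *\<^sub>R v" for r
        using uv(1,2) by (auto simp: independent_insert span_singleton)
      moreover have "u = (s / r) *\<^sub>R v" if "r *\<^sub>R u = s *\<^sub>R v" "r \<noteq> 0" for r s
        using arg_cong[OF that(1), of "\<lambda>w. inverse r *\<^sub>R w"] that(2) by (simp add: divide_inverse mult.commute)
      ultimately have "d = 0" "c = 0" by blast+
      then show False using \<open>v \<noteq> 0\<close> push_0[OF z] by (simp add: v)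
    qed
    from ratio[OF refl refl this] show "\<kappa> = - G z ?V (j z x) / ?P\<^sup>2"
      unfolding \<kappa> u v .
  qed
qed

end

section \<open>Radial Kaehler metrics\<close>

locale complex_structure =
  fixes im :: "'v::euclidean_space \<Rightarrow> 'v"
  assumes linear_im: "linear im" and im_im [simp]: "im (im v) = - v"
    and inner_im_im [simp]: "inner (im u) (im v) = inner u v"
begin

lemma inner_im_right: "inner u (im v) = - inner (im u) v"
  using inner_im_im[of u "im v"] by simp

lemma inner_im_self [simp]: "inner (im u) u = 0"
  using inner_im_right[of u u] by (simp add: inner_commute)

lemma im_add [simp]: "im (u + v) = im u + im v"
  and im_diff [simp]: "im (u - v) = im u - im v"
  and im_minus [simp]: "im (- u) = - im u"
  and im_scaleR [simp]: "im (k *\<^sub>R u) = k *\<^sub>R im u"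
  using linear_im by (simp_all add: linear_add linear_diff linear_neg linear_cmul)

lemma bounded_linear_im: "bounded_linear im"
  using linear_im by (simp add: linear_conv_bounded_linear)

lemmas has_derivative_im = bounded_linear.has_derivative[OF bounded_linear_im]

text \<open>The Christoffel symbol of the radial metric. It is built from z, iz and inner products,
  hence unitarily invariant; metric compatibility will determine \<open>c\<close> and
  \<open>d\<close>.\<close>

definition Gam :: "real \<Rightarrow> real \<Rightarrow> real \<Rightarrow> 'v \<Rightarrow> 'v \<Rightarrow> 'v \<Rightarrow> 'v" where
  "Gam \<alpha> c d z u v =
     \<alpha> *\<^sub>R (inner (im z) v *\<^sub>R im u + inner (im z) u *\<^sub>R im v - inner u v *\<^sub>R z)
     + c *\<^sub>R ((inner z u * inner (im z) v + inner z v * inner (im z) u) *\<^sub>R im z - (inner z u * inner z v) *\<^sub>R z)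
     - d *\<^sub>R ((inner (im z) u * inner (im z) v) *\<^sub>R z)"

text \<open>Derivative of \<open>Gam\<close> in \<open>z\<close> along \<open>x\<close> with frozen
  coefficients. As \<open>Gam\<close> is linear in its coefficients, their own derivatives
  contribute another \<open>Gam\<close>. \<open>dGform\<close> and \<open>dJmap\<close> follow the
  same pattern.\<close>

definition dGam :: "real \<Rightarrow> real \<Rightarrow> real \<Rightarrow> 'v \<Rightarrow> 'v \<Rightarrow> 'v \<Rightarrow> 'v \<Rightarrow> 'v" where
  "dGam \<alpha> c d z x u v =
     \<alpha> *\<^sub>R (inner (im x) v *\<^sub>R im u + inner (im x) u *\<^sub>R im v - inner u v *\<^sub>R x)
     + c *\<^sub>R ((inner x u * inner (im z) v + inner z u * inner (im x) v
               + inner x v * inner (im z) u + inner z v * inner (im x) u) *\<^sub>R im z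
              + (inner z u * inner (im z) v + inner z v * inner (im z) u) *\<^sub>R im x
              - (inner x u * inner z v + inner z u * inner x v) *\<^sub>R z - (inner z u * inner z v) *\<^sub>R x)
     - d *\<^sub>R ((inner (im x) u * inner (im z) v + inner (im z) u * inner (im x) v) *\<^sub>R z
              + (inner (im z) u * inner (im z) v) *\<^sub>R x)"

definition Gform :: "real \<Rightarrow> real \<Rightarrow> 'v \<Rightarrow> 'v \<Rightarrow> 'v \<Rightarrow> real" where
  "Gform \<alpha> \<beta> z u v = inner u v + \<alpha> * (inner (im z) u * inner (im z) v) + \<beta> * (inner z u * inner z v)"

definition dGform :: "real \<Rightarrow> real \<Rightarrow> 'v \<Rightarrow> 'v \<Rightarrow> 'v \<Rightarrow> 'v \<Rightarrow> real" where
  "dGform \<alpha> \<beta> z x u v = \<alpha> * (inner (im x) u * inner (im z) v + inner (im z) u * inner (im x) v)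
     + \<beta> * (inner x u * inner z v + inner z u * inner x v)"

text \<open>Multiplication by i on the orthogonal complement of the complex line of z; for \<beta> =
  - \<alpha> / w, with w as in the overview, it sends z to iz / w and iz to - w z.\<close>

definition Jmap :: "real \<Rightarrow> real \<Rightarrow> 'v \<Rightarrow> 'v \<Rightarrow> 'v" where
  "Jmap \<alpha> \<beta> z v = im v + \<beta> *\<^sub>R (inner z v *\<^sub>R im z) - \<alpha> *\<^sub>R (inner (im z) v *\<^sub>R z)"

definition dJmap :: "real \<Rightarrow> real \<Rightarrow> 'v \<Rightarrow> 'v \<Rightarrow> 'v \<Rightarrow> 'v" where
  "dJmap \<alpha> \<beta> z x v = \<beta> *\<^sub>R (inner x v *\<^sub>R im z + inner z v *\<^sub>R im x)
     - \<alpha> *\<^sub>R (inner (im x) v *\<^sub>R z + inner (im z) v *\<^sub>R x)"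

lemma Gam_add_right: "Gam \<alpha> c d z u (v + v') = Gam \<alpha> c d z u v + Gam \<alpha> c d z u v'"
  and Gam_scaleR_right: "Gam \<alpha> c d z u (r *\<^sub>R v) = r *\<^sub>R Gam \<alpha> c d z u v"
  by (simp_all add: Gam_def inner_simps algebra_simps)

text \<open>Calculus is reduced to algebra at one point: \<open>\<alpha>1\<close> and
  \<open>\<alpha>2\<close> are free reals in the place of the derivatives of \<alpha> with respect
  to \<rho>, and \<open>w1\<close>, \<open>\<beta>1\<close>, \<open>c1\<close>, \<open>d1\<close>
  are the values that differentiation then forces.\<close>

context
  fixes z :: 'v and \<alpha> \<alpha>1 \<alpha>2 w w1 \<beta> \<beta>1 c c1 d d1 \<rho> :: real
  assumes \<rho>: "\<rho> = inner z z" and w: "w = 1 + \<rho> * \<alpha>" and w0: "w \<noteq> 0" and w1: "w1 = \<alpha> + \<rho> * \<alpha>1"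
    and \<beta>: "\<beta> = - \<alpha> / w" and \<beta>1: "\<beta>1 = - \<alpha>1 / w + \<alpha> * w1 / w\<^sup>2"
    and c: "c = (\<alpha>1 - \<alpha>\<^sup>2) / w" and c1: "c1 = (\<alpha>2 - 2 * \<alpha> * \<alpha>1) / w - (\<alpha>1 - \<alpha>\<^sup>2) * w1 / w\<^sup>2"
    and d: "d = 2 * \<alpha>\<^sup>2 + w * \<alpha>1" and d1: "d1 = 4 * \<alpha> * \<alpha>1 + w1 * \<alpha>1 + w * \<alpha>2"
begin

lemma Jmap_inner: "inner z (Jmap \<alpha> \<beta> z v) = - w * inner (im z) v"
    "inner (im z) (Jmap \<alpha> \<beta> z v) = inner z v / w"
proof -
  show "inner z (Jmap \<alpha> \<beta> z v) = - w * inner (im z) v"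
    by (simp add: Jmap_def inner_simps inner_im_right \<rho>[symmetric] w algebra_simps)
  have "1 + \<beta> * \<rho> = 1 / w" using w0 by (simp add: \<beta> w field_simps)
  then have "inner z v * (1 + \<beta> * \<rho>) = inner z v / w" by simp
  then show "inner (im z) (Jmap \<alpha> \<beta> z v) = inner z v / w"
    by (simp add: Jmap_def inner_simps \<rho>[symmetric] algebra_simps)
qed

lemma Jmap_Jmap: "Jmap \<alpha> \<beta> z (Jmap \<alpha> \<beta> z v) = - v"
proof -
  have 1: "- \<beta> * w = \<alpha>" "\<beta> = - \<alpha> / w" using w0 by (simp_all add: \<beta>)
  have "Jmap \<alpha> \<beta> z (Jmap \<alpha> \<beta> z v) =
      - v - (\<beta> * inner z v) *\<^sub>R z - (\<alpha> * inner (im z) v) *\<^sub>R im z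
      - (\<beta> * w * inner (im z) v) *\<^sub>R im z - (\<alpha> * inner z v / w) *\<^sub>R z"
    by (subst Jmap_def) (simp only: Jmap_inner, simp add: Jmap_def algebra_simps)
  also have "\<dots> = - v"
    using w0 by (simp add: \<beta>)
  finally show ?thesis .
qed

lemma Gform_Jmap: "Gform \<alpha> \<beta> z (Jmap \<alpha> \<beta> z u) v = inner (im u) v"
proof -
  have "inner (Jmap \<alpha> \<beta> z u) v = inner (im u) v + \<beta> * inner z u * inner (im z) v - \<alpha> * inner (im z) u * inner z v"
    by (simp add: Jmap_def inner_simps)
  then show ?thesis
    unfolding Gform_def Jmap_inner using w0 by (simp add: \<beta>)
qed

lemma Gform_Jmap_Jmap: "Gform \<alpha> \<beta> z (Jmap \<alpha> \<beta> z u) (Jmap \<alpha> \<beta> z v) = Gform \<alpha> \<beta> z u v"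
proof -
  have "Gform \<alpha> \<beta> z (Jmap \<alpha> \<beta> z u) (Jmap \<alpha> \<beta> z v) = - inner u (im (Jmap \<alpha> \<beta> z v))"
    by (simp add: Gform_Jmap inner_im_right)
  also have "\<dots> = Gform \<alpha> \<beta> z u v"
    by (simp add: Jmap_def Gform_def inner_simps inner_commute[of u] mult_ac)
  finally show ?thesis .
qed

lemma one_plus_\<beta>\<rho>: "1 + \<beta> * \<rho> = 1 / w"
  using w0 by (simp add: \<beta> w field_simps)

lemma Gam_inner:
  "inner z (Gam \<alpha> c d z u v) = - \<alpha> * (2 * inner (im z) u * inner (im z) v + \<rho> * inner u v)
     - c * \<rho> * inner z u * inner z v - d * \<rho> * inner (im z) u * inner (im z) v"
  "inner (im z) (Gam \<alpha> c d z u v) = (\<alpha> + c * \<rho>) * (inner z u * inner (im z) v + inner z v * inner (im z) u)"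
  by (simp_all add: Gam_def inner_simps inner_im_right \<rho>[symmetric] algebra_simps)

text \<open>Lowering the index leaves only \<alpha>, \<beta> and their derivatives, as in the Koszul
  formula. The identities \<open>coeffs\<close> express this; the first one determines
  \<open>c\<close> and the last one \<open>d\<close>.\<close>

lemma Gform_Gam:
  "Gform \<alpha> \<beta> z (Gam \<alpha> c d z u v) x =
    \<alpha> * (inner (im z) v * inner (im u) x + inner (im z) u * inner (im v) x) + \<beta> * inner u v * inner z x
    + \<alpha>1 * ((inner z u * inner (im z) v + inner z v * inner (im z) u) * inner (im z) x
        - inner (im z) u * inner (im z) v * inner z x)
    + \<beta>1 * inner z u * inner z v * inner z x"
proof -
  have coeffs: "c + \<alpha> * (\<alpha> + c * \<rho>) = \<alpha>1" "- \<alpha> * (1 + \<beta> * \<rho>) = \<beta>" "- c * (1 + \<beta> * \<rho>) = \<beta>1"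
    "d * (1 + \<beta> * \<rho>) + 2 * \<alpha> * \<beta> = \<alpha>1"
    \<comment> \<open>\<open>w\<close> stays an atom while denominators are cleared and is expanded
      to 1 + \<rho> \<alpha> only afterwards.\<close>
    using w0 unfolding one_plus_\<beta>\<rho> by (simp_all add: \<beta> \<beta>1 c d w1 field_simps) (simp_all add: w power2_eq_square algebra_simps)
  have "Gform \<alpha> \<beta> z (Gam \<alpha> c d z u v) x =
    \<alpha> * (inner (im z) v * inner (im u) x + inner (im z) u * inner (im v) x)
    + (- \<alpha> * (1 + \<beta> * \<rho>)) * inner u v * inner z x
    + (c + \<alpha> * (\<alpha> + c * \<rho>)) * (inner z u * inner (im z) v + inner z v * inner (im z) u) * inner (im z) x
    + (- c * (1 + \<beta> * \<rho>)) * inner z u * inner z v * inner z x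
    - (d * (1 + \<beta> * \<rho>) + 2 * \<alpha> * \<beta>) * inner (im z) u * inner (im z) v * inner z x"
    unfolding Gform_def Gam_inner by (simp add: Gam_def inner_simps algebra_simps)
  then show ?thesis unfolding coeffs by (simp add: algebra_simps)
qed

text \<open>The factor \<open>2 * inner z x\<close> is the derivative of \<rho> along
  \<open>x\<close>. After inserting the lowered symbol, the terms with \<open>inner (im u) v\<close>
  cancel because i is skew.\<close>

lemma Gam_metric:
  "2 * inner z x * (\<alpha>1 * (inner (im z) u * inner (im z) v) + \<beta>1 * (inner z u * inner z v)) + dGform \<alpha> \<beta> z x u v =
    Gform \<alpha> \<beta> z (Gam \<alpha> c d z x u) v + Gform \<alpha> \<beta> z u (Gam \<alpha> c d z x v)"
proof -
  have "Gform \<alpha> \<beta> z u (Gam \<alpha> c d z x v) = Gform \<alpha> \<beta> z (Gam \<alpha> c d z x v) u"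
    by (simp add: Gform_def inner_commute mult.commute)
  moreover have "inner (im v) u = - inner (im u) v" "inner v u = inner u v"
    using inner_im_right[of u v] by (simp_all add: inner_commute)
  ultimately show ?thesis
    unfolding Gform_Gam dGform_def by (simp add: algebra_simps)
qed

lemma Gam_coeffs:
  "\<beta> = - \<alpha> / w" "\<beta>1 = - c / w" "c * w = \<alpha>1 - \<alpha>\<^sup>2" "d / w = \<alpha>1 - 2 * \<alpha> * \<beta>"
  using w0 by (simp_all add: \<beta> \<beta>1 c d w1 field_simps) (simp_all add: w power2_eq_square algebra_simps)

text \<open>Both sides are expanded in x, ix, v, z, iz and compared through
  \<open>Gam_coeffs\<close>; the coefficient of ix vanishes because \<beta> = - \<alpha> /
  w.\<close>

lemma Gam_parallel:
  "(2 * inner z x) *\<^sub>R (\<beta>1 *\<^sub>R (inner z v *\<^sub>R im z) - \<alpha>1 *\<^sub>R (inner (im z) v *\<^sub>R z)) + dJmap \<alpha> \<beta> z x v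
    + Gam \<alpha> c d z x (Jmap \<alpha> \<beta> z v) = Jmap \<alpha> \<beta> z (Gam \<alpha> c d z x v)" (is "?L = ?R")
proof -
  define a b a' b' k where "a = inner z x" and "b = inner (im z) x" and "a' = inner z v" and "b' = inner (im z) v"
    and "k = 1 / w"
  note ab = a_def[symmetric] b_def[symmetric] a'_def[symmetric] b'_def[symmetric]
  have J: "inner z (Jmap \<alpha> \<beta> z v) = - w * b'" "inner (im z) (Jmap \<alpha> \<beta> z v) = k * a'"
    by (simp_all add: Jmap_inner ab k_def)
  have xJ: "inner x (Jmap \<alpha> \<beta> z v) = - inner (im x) v + \<beta> * a' * b - \<alpha> * b' * a"
    by (simp add: Jmap_def inner_simps inner_im_right[of x v] inner_commute[of x z] inner_commute[of x "im z"] ab)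
  have imJ: "im (Jmap \<alpha> \<beta> z v) = - v - (\<beta> * a') *\<^sub>R z - (\<alpha> * b') *\<^sub>R im z"
    by (simp add: Jmap_def ab)
  have "?L = (- \<alpha> * b') *\<^sub>R x + ((\<beta> + \<alpha> * k) * a') *\<^sub>R im x + (- \<alpha> * b) *\<^sub>R v
      + (\<beta> * inner x v + (2 * \<beta>1 + c * k) * (a * a') - (\<alpha>\<^sup>2 + c * w) * (b * b')) *\<^sub>R im z
      + ((- 2 * \<alpha>1 + \<alpha>\<^sup>2 + c * w) * (a * b') - (2 * \<alpha> * \<beta> + d * k) * (a' * b)) *\<^sub>R z"
    unfolding Gam_def[of _ _ _ _ _ "Jmap \<alpha> \<beta> z v"] dJmap_def J xJ imJ ab
    \<comment> \<open>Pairing with an arbitrary vector turns the vector identity into ring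
      arithmetic.\<close>
    by (rule vector_eq_ldot[THEN iffD1, OF allI]) (simp add: inner_simps algebra_simps power2_eq_square)
  also have "\<dots> = (- \<alpha> * b') *\<^sub>R x + (- \<alpha> * b) *\<^sub>R v
      + (\<beta> * inner x v + \<beta>1 * (a * a') - \<alpha>1 * (b * b')) *\<^sub>R im z + (- \<alpha>1 * (a * b' + a' * b)) *\<^sub>R z"
  proof -
    have 1: "\<beta> + \<alpha> * k = 0" "2 * \<beta>1 + c * k = \<beta>1" "\<alpha>\<^sup>2 + c * w = \<alpha>1" "2 * \<alpha> * \<beta> + d * k = \<alpha>1"
      using Gam_coeffs by (simp_all add: k_def)
    then have 2: "- 2 * \<alpha>1 + \<alpha>\<^sup>2 + c * w = - \<alpha>1" by simp
    show ?thesis unfolding 1 2 by (simp add: algebra_simps)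
  qed
  also have "\<dots> = (- \<alpha> * b') *\<^sub>R x + (- \<alpha> * b) *\<^sub>R v
      + ((- \<alpha> * (1 + \<beta> * \<rho>)) * inner x v + (- c * (1 + \<beta> * \<rho>)) * (a * a') - (d * (1 + \<beta> * \<rho>) + 2 * \<alpha> * \<beta>) * (b * b')) *\<^sub>R im z
      - ((c + \<alpha> * (\<alpha> + c * \<rho>)) * (a * b' + a' * b)) *\<^sub>R z"
  proof -
    have 1: "- \<alpha> * (1 + \<beta> * \<rho>) = \<beta>" "- c * (1 + \<beta> * \<rho>) = \<beta>1" "d * (1 + \<beta> * \<rho>) + 2 * \<alpha> * \<beta> = \<alpha>1"
      unfolding one_plus_\<beta>\<rho> using Gam_coeffs by simp_all
    have 2: "c + \<alpha> * (\<alpha> + c * \<rho>) = \<alpha>1"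
      using Gam_coeffs(3) by (simp add: w algebra_simps power2_eq_square)
    show ?thesis unfolding 1 2 by simp
  qed
  also have "\<dots> = ?R"
    unfolding Jmap_def[of _ _ _ "Gam \<alpha> c d z x v"] Gam_inner ab
    by (simp add: Gam_def ab algebra_simps)
  finally show ?thesis .
qed

text \<open>The left side is R(x,y)x for y = Jx, written out: derivatives of the symbol along x and
  along y, then the two quadratic terms. Everything lies in the span of x, ix, z, iz, with
  coefficients in the scalars \<open>a\<close>, \<open>b\<close>, \<open>N\<close>.\<close>

lemma Gam_curvature:
  fixes x
  defines "y \<equiv> Jmap \<alpha> \<beta> z x" and "P \<equiv> Gform \<alpha> \<beta> z x x"
    and "T \<equiv> w * (inner (im z) x)\<^sup>2 + (inner z x)\<^sup>2 / w"
  shows "(Gam (2 * inner z x * \<alpha>1) (2 * inner z x * c1) (2 * inner z x * d1) z y x + dGam \<alpha> c d z x y x)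
    - (Gam (2 * inner z y * \<alpha>1) (2 * inner z y * c1) (2 * inner z y * d1) z x x + dGam \<alpha> c d z y x x)
    + Gam \<alpha> c d z x (Gam \<alpha> c d z y x) - Gam \<alpha> c d z y (Gam \<alpha> c d z x x) =
    (4 * \<alpha> * P + 4 * \<alpha>1 * T) *\<^sub>R y
    + (4 * \<alpha>1 * P + 2 * \<alpha>2 * T) *\<^sub>R ((inner z x / w) *\<^sub>R im z - (w * inner (im z) x) *\<^sub>R z)"
proof -
  define a b k N e where "a = inner z x" and "b = inner (im z) x" and "k = 1 / w" and "N = inner x x" and "e = \<beta> - \<alpha>"
  note ab = a_def[symmetric] b_def[symmetric] N_def[symmetric]
  have y: "y = im x + (\<beta> * a) *\<^sub>R im z - (\<alpha> * b) *\<^sub>R z"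
    by (simp add: y_def Jmap_def ab)
  have imy: "im y = - x - (\<alpha> * b) *\<^sub>R im z - (\<beta> * a) *\<^sub>R z"
    by (simp add: y algebra_simps)
  have P: "P = N + \<alpha> * b\<^sup>2 + \<beta> * a\<^sup>2"
    by (simp add: P_def Gform_def ab power2_eq_square)
  have zy: "inner z y = - w * b" "inner (im z) y = k * a"
    by (simp_all add: y_def Jmap_inner ab k_def)
  have xz: "inner x z = a" "inner x (im z) = b" "inner (im x) (im z) = a" "inner (im x) z = - b"
    using inner_im_right[of x z] by (simp_all add: a_def b_def inner_commute)
  have xx: "inner x (im x) = 0"
    by (simp add: inner_im_right)
  have xy: "inner x y = e * (a * b)" "inner (im x) y = P" "inner (im y) x = - P"
    by (simp_all add: y imy inner_simps xx xz ab P e_def power2_eq_square algebra_simps)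
  have yx: "inner y x = e * (a * b)" "inner y z = - w * b" "inner y (im z) = k * a"
    using xy(1) zy by (simp_all add: inner_commute)
  note xy = xy yx
  have yix: "inner y (im x) = P" using xy(2) by (simp add: inner_commute)
  \<comment> \<open>\<open>p\<close> and \<open>q\<close> are the coordinates of \<Gamma>(x,x) along
    z and iz; \<open>h\<close> is that of \<Gamma>(y,x) along iz, whose coordinate along z turns out
    to be zero.\<close>
  define p q h where "p = - \<alpha> * N - c * a\<^sup>2 - d * b\<^sup>2" and "q = 2 * c * (a * b)" and "h = c * k * a\<^sup>2 - \<alpha>1 * b\<^sup>2"
  have Gxx: "Gam \<alpha> c d z x x = (2 * \<alpha> * b) *\<^sub>R im x + p *\<^sub>R z + q *\<^sub>R im z"
    by (simp add: Gam_def ab p_def q_def algebra_simps power2_eq_square scaleR_2[symmetric])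
  have Gyx: "Gam \<alpha> c d z y x = (- \<alpha> * b) *\<^sub>R x + (\<alpha> * k * a) *\<^sub>R im x + h *\<^sub>R im z"
  proof -
    have "Gam \<alpha> c d z y x = (- \<alpha> * b) *\<^sub>R x + (\<alpha> * k * a) *\<^sub>R im x
        + ((- 2 * \<alpha> * \<beta> - d * k + (\<alpha>\<^sup>2 + c * w)) * (a * b)) *\<^sub>R z + (c * k * a\<^sup>2 - (\<alpha>\<^sup>2 + c * w) * b\<^sup>2) *\<^sub>R im z"
      unfolding Gam_def ab zy xy imy by (rule vector_eq_ldot[THEN iffD1, OF allI]) (simp add: inner_simps e_def algebra_simps power2_eq_square)
    moreover have "- 2 * \<alpha> * \<beta> - d * k + (\<alpha>\<^sup>2 + c * w) = 0" "\<alpha>\<^sup>2 + c * w = \<alpha>1"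
      using Gam_coeffs by (simp_all add: k_def)
    ultimately show ?thesis by (simp add: h_def)
  qed
  have Gxix: "Gam \<alpha> c d z x (im x) = (- \<alpha> * b) *\<^sub>R x + (\<alpha> * a) *\<^sub>R im x + ((c - d) * (a * b)) *\<^sub>R z + (c * (a\<^sup>2 - b\<^sup>2)) *\<^sub>R im z"
    by (simp add: Gam_def inner_im_right ab algebra_simps power2_eq_square)
  have Gxiz: "Gam \<alpha> c d z x (im z) = (\<alpha> * \<rho>) *\<^sub>R im x - ((2 * \<alpha> + d * \<rho>) * b) *\<^sub>R z + (c * \<rho> * a) *\<^sub>R im z"
    by (rule vector_eq_ldot[THEN iffD1, OF allI]) (simp add: inner_simps Gam_def inner_im_right xz ab \<rho>[symmetric] algebra_simps)
  have Gyix: "Gam \<alpha> c d z y (im x) = (- \<alpha> * a * (1 + k)) *\<^sub>R x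
      + (- \<alpha> * \<beta> * a\<^sup>2 - \<alpha> * P - c * w * b\<^sup>2 - d * k * a\<^sup>2) *\<^sub>R z - ((\<alpha>\<^sup>2 + c * (w + k)) * (a * b)) *\<^sub>R im z"
    unfolding Gam_def zy yix imy inner_im_right[of z x] inner_im_im ab im_im
    by (rule vector_eq_ldot[THEN iffD1, OF allI]) (simp add: inner_simps algebra_simps power2_eq_square)
  have Gyz: "Gam \<alpha> c d z y z = ((\<alpha> + c * \<rho>) * w * b) *\<^sub>R z + ((\<alpha> + c * \<rho>) * k * a) *\<^sub>R im z"
    unfolding Gam_def zy xy inner_im_self \<rho>[symmetric] by (simp add: algebra_simps)
  have Gyiz: "Gam \<alpha> c d z y (im z) = (- \<alpha> * \<rho>) *\<^sub>R x - ((\<alpha> * \<beta> * \<rho> + 2 * \<alpha> * k + d * \<rho> * k) * a) *\<^sub>R z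
      - ((\<alpha>\<^sup>2 + c * w) * \<rho> * b) *\<^sub>R im z"
    unfolding Gam_def zy xy inner_im_right[of z z] inner_im_self inner_im_im im_im \<rho>[symmetric] imy
    by (rule vector_eq_ldot[THEN iffD1, OF allI]) (simp add: inner_simps algebra_simps power2_eq_square)
  \<comment> \<open>Coordinates along x, ix, z, iz of the derivative of \<Gamma>(y,x) along x and of
    \<Gamma>(x,x) along y, with the vector arguments held constant.\<close>
  define X1 X2 X3 X4 Y1 Y2 Y3 Y4 where
    X1_def: "X1 = (- 2 * \<alpha>1 - \<alpha> * e + c * w - d * k) * (a * b)"
    and X2_def: "X2 = 2 * \<alpha>1 * k * a\<^sup>2 + \<alpha> * P + c * (k * a\<^sup>2 - w * b\<^sup>2)"
    and X3_def: "X3 = 2 * a\<^sup>2 * b * (- \<alpha>1 * \<beta> - \<alpha>1 * e + c1 * w - d1 * k) - c * (e * a\<^sup>2 * b - w * b * N) - d * P * b"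
    and X4_def: "X4 = - 2 * a * \<alpha>1 * \<alpha> * b\<^sup>2 + 2 * a * c1 * (k * a\<^sup>2 - w * b\<^sup>2) + c * (e * a * b\<^sup>2 + N * k * a + a * P)"
    and Y1_def: "Y1 = - 2 * c * (a * b)"
    and Y2_def: "Y2 = - 4 * w * b\<^sup>2 * \<alpha>1 - 2 * \<alpha> * P - \<alpha> * N - c * a\<^sup>2 - d * b\<^sup>2"
    and Y3_def: "Y3 = 2 * w * b * (\<alpha>1 * N + c1 * a\<^sup>2 + d1 * b\<^sup>2) - c * 2 * a\<^sup>2 * b * (\<beta> + e) + 2 * d * P * b
          + \<alpha> * b * (\<alpha> * N + c * a\<^sup>2 + d * b\<^sup>2)"
    and Y4_def: "Y4 = - 4 * w * a * b\<^sup>2 * c1 + c * (2 * e * a * b\<^sup>2 - 2 * a * P) - 2 * c * \<alpha> * a * b\<^sup>2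
          - \<beta> * a * (\<alpha> * N + c * a\<^sup>2 + d * b\<^sup>2)"
  have D1: "Gam (2 * a * \<alpha>1) (2 * a * c1) (2 * a * d1) z y x + dGam \<alpha> c d z x y x =
      X1 *\<^sub>R x
      + X2 *\<^sub>R im x
      + X3 *\<^sub>R z
      + X4 *\<^sub>R im z"
    unfolding X1_def X2_def X3_def X4_def Gam_def dGam_def zy xy imy inner_im_self ab
    by (rule vector_eq_ldot[THEN iffD1, OF allI]) (simp add: inner_simps algebra_simps power2_eq_square)
  have D2: "Gam (2 * (- w * b) * \<alpha>1) (2 * (- w * b) * c1) (2 * (- w * b) * d1) z x x + dGam \<alpha> c d z y x x =
      Y1 *\<^sub>R x
      + Y2 *\<^sub>R im x
      + Y3 *\<^sub>R z
      + Y4 *\<^sub>R im z"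
    unfolding Y1_def Y2_def Y3_def Y4_def Gam_def dGam_def zy xy inner_im_self ab
    unfolding imy
    by (rule vector_eq_ldot[THEN iffD1, OF allI]) (simp add: inner_simps y algebra_simps power2_eq_square)
  define Z3 where "Z3 = - \<alpha> * \<beta> * a\<^sup>2 - \<alpha> * P - c * w * b\<^sup>2 - d * k * a\<^sup>2"
  \<comment> \<open>Coordinates of the curvature vector: the derivative parts combined with the
    quadratic terms.\<close>
  define K1 K2 K3 K4 where
    K1_def: "K1 = X1 - Y1 - \<alpha>\<^sup>2 * k * a * b + 2 * \<alpha>\<^sup>2 * a * b * (1 + k) + q * \<alpha> * \<rho>"
    and K2_def: "K2 = X2 - Y2 - 2 * \<alpha>\<^sup>2 * b\<^sup>2 + \<alpha>\<^sup>2 * k * a\<^sup>2 + h * \<alpha> * \<rho>"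
    and K3_def: "K3 = X3 - Y3 - \<alpha> * b * p + \<alpha> * k * a * (c - d) * (a * b) - h * (2 * \<alpha> + d * \<rho>) * b
      - 2 * \<alpha> * b * Z3 - p * (\<alpha> + c * \<rho>) * w * b + q * (\<alpha> * \<beta> * \<rho> + 2 * \<alpha> * k + d * \<rho> * k) * a"
    and K4_def: "K4 = X4 - Y4 - \<alpha> * b * q + \<alpha> * k * a * c * (a\<^sup>2 - b\<^sup>2) + h * c * \<rho> * a
      + 2 * \<alpha> * b * (\<alpha>\<^sup>2 + c * (w + k)) * (a * b) - p * (\<alpha> + c * \<rho>) * k * a + q * (\<alpha>\<^sup>2 + c * w) * \<rho> * b"
  have T: "T = w * b\<^sup>2 + k * a\<^sup>2" by (simp add: T_def ab k_def)
  note scalars = X1_def X2_def X3_def X4_def Y1_def Y2_def Y3_def Y4_def Z3_def p_def q_def h_def e_def P T k_def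
    c d c1 d1 w1 \<beta>
  have kw: "k * w = 1" using w0 by (simp add: k_def)
  have \<alpha>w1: "\<alpha> * w1 = \<alpha>\<^sup>2 + (w - 1) * \<alpha>1" by (simp add: w w1 power2_eq_square algebra_simps)
  have ck: "c = (\<alpha>1 - \<alpha>\<^sup>2) * k" and \<beta>k: "\<beta> = - \<alpha> * k" and c1k: "c1 = (\<alpha>2 - 2 * \<alpha> * \<alpha>1) * k - c * w1 * k"
    by (simp_all add: c \<beta> c1 k_def power2_eq_square)
  \<comment> \<open>In \<open>K3\<close> and \<open>K4\<close> every \<rho> sits in one of these
    three combinations. Once it is eliminated, \<open>kw\<close> and \<open>\<alpha>w1\<close> are
    the only relations among the remaining scalars.\<close>
  have c\<rho>: "c * \<rho> = w1 * k - \<alpha>" and d\<rho>: "2 * \<alpha> + d * \<rho> = w * (\<alpha> + w1)"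
    and \<beta>d\<rho>: "\<alpha> * \<beta> * \<rho> + 2 * \<alpha> * k + d * \<rho> * k = k * (\<alpha> + w * w1)"
  proof -
    have "c * \<rho> * w = w1 - \<alpha> * w"
      by (simp add: mult.commute[of c \<rho>] mult.assoc Gam_coeffs(3)) (simp add: w w1 power2_eq_square algebra_simps)
    then show "c * \<rho> = w1 * k - \<alpha>" using w0 by (simp add: k_def field_simps)
    show d\<rho>: "2 * \<alpha> + d * \<rho> = w * (\<alpha> + w1)" by (simp add: d w w1 power2_eq_square algebra_simps)
    have "\<alpha> * \<beta> * \<rho> + 2 * \<alpha> * k + d * \<rho> * k = k * (2 * \<alpha> + d * \<rho> - \<alpha> * \<alpha> * \<rho>)"
      by (simp add: \<beta>k algebra_simps)
    also have "\<dots> = k * (\<alpha> + w * w1)" unfolding d\<rho> by (simp add: w algebra_simps)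
    finally show "\<alpha> * \<beta> * \<rho> + 2 * \<alpha> * k + d * \<rho> * k = k * (\<alpha> + w * w1)" .
  qed
  have "(Gam (2 * a * \<alpha>1) (2 * a * c1) (2 * a * d1) z y x + dGam \<alpha> c d z x y x)
      - (Gam (2 * (- w * b) * \<alpha>1) (2 * (- w * b) * c1) (2 * (- w * b) * d1) z x x + dGam \<alpha> c d z y x x)
      + Gam \<alpha> c d z x (Gam \<alpha> c d z y x) - Gam \<alpha> c d z y (Gam \<alpha> c d z x x) =
      K1 *\<^sub>R x + K2 *\<^sub>R im x + K3 *\<^sub>R z + K4 *\<^sub>R im z"
    unfolding D1 D2 Gxx Gyx Gam_add_right Gam_scaleR_right Gxix Gxiz Gyix Gyz Gyiz Z3_def[symmetric] K1_def K2_def K3_def K4_def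
    by (rule vector_eq_ldot[THEN iffD1, OF allI]) (simp add: inner_simps algebra_simps power2_eq_square)
  moreover have "K1 = 0"
    unfolding K1_def using w0 by (simp add: scalars field_simps) (simp add: w algebra_simps power2_eq_square)
  moreover have "K2 = 4 * \<alpha> * P + 4 * \<alpha>1 * T"
    unfolding K2_def using w0 by (simp add: scalars field_simps) (simp add: w algebra_simps power2_eq_square)
  moreover have "K3 = - (4 * \<alpha> * P + 4 * \<alpha>1 * T) * (\<alpha> * b) - (4 * \<alpha>1 * P + 2 * \<alpha>2 * T) * (w * b)"
  proof -
    \<comment> \<open>Up to the factor \<open>b\<close>, \<open>K3\<close> is linear in N, a^2, b^2,
      and so are P and T. Comparing the three coefficients separately keeps each identity small;
      \<open>K4\<close> is treated alike with the factor \<open>a\<close>.\<close>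
    define L1 L2 L3 where
      L1_def: "L1 = c * w - 3 * d - 2 * w * \<alpha>1 + 2 * \<alpha>\<^sup>2 + \<alpha> * (\<alpha> + c * \<rho>) * w"
      and L2_def: "L2 = 2 * (- \<alpha>1 * \<beta> - \<alpha>1 * e + c1 * w - d1 * k) - c * e - 3 * d * \<beta> - 2 * w * c1 + 2 * c * (\<beta> + e)
        + \<alpha> * k * (c - d) - c * k * (2 * \<alpha> + d * \<rho>) + 2 * \<alpha> * (2 * \<alpha> * \<beta> + d * k) + c * (\<alpha> + c * \<rho>) * w
        + 2 * c * (\<alpha> * \<beta> * \<rho> + 2 * \<alpha> * k + d * \<rho> * k)"
      and L3_def: "L3 = - 3 * d * \<alpha> - 2 * w * d1 + \<alpha>1 * (2 * \<alpha> + d * \<rho>) + 2 * \<alpha> * (\<alpha>\<^sup>2 + c * w) + d * (\<alpha> + c * \<rho>) * w"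
    have "K3 = b * (L1 * N + L2 * a\<^sup>2 + L3 * b\<^sup>2)"
      unfolding K3_def X3_def Y3_def Z3_def p_def q_def h_def P L1_def L2_def L3_def
      by (simp add: algebra_simps power2_eq_square)
    moreover have "L1 = - \<alpha> * (4 * \<alpha>) - w * (4 * \<alpha>1)"
      unfolding L1_def \<beta>d\<rho> d\<rho> c\<rho>
      unfolding e_def c1k d d1 \<beta>k ck using kw \<alpha>w1 by algebra
    moreover have "L2 = - \<alpha> * (4 * \<alpha> * \<beta> + 4 * \<alpha>1 * k) - w * (4 * \<alpha>1 * \<beta> + 2 * \<alpha>2 * k)"
      unfolding L2_def \<beta>d\<rho> d\<rho> c\<rho>
      unfolding e_def c1k d d1 \<beta>k ck using kw \<alpha>w1 by algebra
    moreover have "L3 = - \<alpha> * (4 * \<alpha> * \<alpha> + 4 * \<alpha>1 * w) - w * (4 * \<alpha>1 * \<alpha> + 2 * \<alpha>2 * w)"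
      unfolding L3_def \<beta>d\<rho> d\<rho> c\<rho>
      unfolding e_def c1k d d1 \<beta>k ck using kw \<alpha>w1 by algebra
    ultimately show ?thesis
      unfolding P T by (simp only:) (simp add: algebra_simps power2_eq_square)
  qed
  moreover have "K4 = (4 * \<alpha> * P + 4 * \<alpha>1 * T) * (\<beta> * a) + (4 * \<alpha>1 * P + 2 * \<alpha>2 * T) * (a * k)"
  proof -
    define L1 L2 L3 where
      L1_def: "L1 = c * k + 3 * c + \<alpha> * \<beta> + \<alpha> * (\<alpha> + c * \<rho>) * k"
      and L2_def: "L2 = 2 * c1 * k + 4 * c * \<beta> + \<alpha> * k * c + c * k * (c * \<rho>) + c * (\<alpha> + c * \<rho>) * k"
      and L3_def: "L3 = - 2 * \<alpha>1 * \<alpha> + 2 * c1 * w - c * e + 3 * c * \<alpha> + \<beta> * d - \<alpha> * k * c - \<alpha>1 * (c * \<rho>)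
        + 2 * \<alpha> * (\<alpha>\<^sup>2 + c * (w + k)) + d * (\<alpha> + c * \<rho>) * k + 2 * (\<alpha>\<^sup>2 + c * w) * (c * \<rho>)"
    have "K4 = a * (L1 * N + L2 * a\<^sup>2 + L3 * b\<^sup>2)"
      unfolding K4_def X4_def Y4_def p_def q_def h_def P L1_def L2_def L3_def
      by (simp add: algebra_simps power2_eq_square)
    moreover have "L1 = \<beta> * (4 * \<alpha>) + k * (4 * \<alpha>1)"
      unfolding L1_def \<beta>d\<rho> d\<rho> c\<rho>
      unfolding e_def c1k d d1 \<beta>k ck using kw \<alpha>w1 by algebra
    moreover have "L2 = \<beta> * (4 * \<alpha> * \<beta> + 4 * \<alpha>1 * k) + k * (4 * \<alpha>1 * \<beta> + 2 * \<alpha>2 * k)"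
      unfolding L2_def \<beta>d\<rho> d\<rho> c\<rho>
      unfolding e_def c1k d d1 \<beta>k ck by (simp add: algebra_simps power2_eq_square)
    moreover have "L3 = \<beta> * (4 * \<alpha> * \<alpha> + 4 * \<alpha>1 * w) + k * (4 * \<alpha>1 * \<alpha> + 2 * \<alpha>2 * w)"
      unfolding L3_def \<beta>d\<rho> d\<rho> c\<rho>
      unfolding e_def c1k d d1 \<beta>k ck using kw \<alpha>w1 by algebra
    ultimately show ?thesis
      unfolding P T by (simp only:) (simp add: algebra_simps power2_eq_square)
  qed
  \<comment> \<open>Since y = ix + \<beta> a iz - \<alpha> b z, the coordinates found regroup into
    the two vectors of the claim.\<close>
  moreover have "0 *\<^sub>R x + l *\<^sub>R im x + (- l * (\<alpha> * b) - m * (w * b)) *\<^sub>R z + (l * (\<beta> * a) + m * (a * k)) *\<^sub>R im z =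
      l *\<^sub>R y + m *\<^sub>R ((a / w) *\<^sub>R im z - (w * b) *\<^sub>R z)" for l m
    by (simp add: y k_def algebra_simps)
  ultimately show ?thesis
    unfolding zy ab by (simp only:)
qed

end

end

lemma smooth_on_has_real_derivative:
  fixes f :: "real \<Rightarrow> real"
  assumes "smooth_on S f" "x \<in> S"
  shows "(f has_real_derivative deriv f x) (at x)"
proof -
  note D = smooth_on_has_derivative[OF assms]
  have "frechet_derivative f (at x) = (*) (frechet_derivative f (at x) 1)"
  proof
    fix h
    show "frechet_derivative f (at x) h = frechet_derivative f (at x) 1 * h"
      using linear_cmul[OF has_derivative_linear[OF D], of h 1] by (simp only: real_scaleR_def mult_1_right mult.commute[of "frechet_derivative f (at x) 1"])
  qed
  with D have "(f has_real_derivative frechet_derivative f (at x) 1) (at x)"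
    by (simp add: has_field_derivative_def)
  from this DERIV_imp_deriv[OF this] show ?thesis by simp
qed

lemma smooth_on_deriv:
  fixes f :: "real \<Rightarrow> real"
  assumes "open S" "smooth_on S f"
  shows "smooth_on S (deriv f)"
proof -
  have "frechet_derivative f (at x) 1 = deriv f x" if "x \<in> S" for x
    using fun_cong[OF frechet_derivative_at[OF smooth_on_has_real_derivative[OF assms(2) that, unfolded has_field_derivative_def]], of 1]
    by simp
  from iffD1[OF smooth_on_cong[OF assms(1) this] smooth_on_frechet_derivative[OF assms(2)]] show ?thesis .
qed

section \<open>Derivatives and smoothness of the explicit tensors\<close>

context complex_structure
begin

lemma Gform_has_derivative:
  assumes "(A has_derivative A') (at z)" "(B has_derivative B') (at z)"
    "(U has_derivative U') (at z)" "(V has_derivative V') (at z)"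
  shows "((\<lambda>z. Gform (A z) (B z) z (U z) (V z)) has_derivative
    (\<lambda>x. A' x * (inner (im z) (U z) * inner (im z) (V z)) + B' x * (inner z (U z) * inner z (V z))
      + dGform (A z) (B z) z x (U z) (V z)
      + Gform (A z) (B z) z (U' x) (V z) + Gform (A z) (B z) z (U z) (V' x))) (at z)"
  unfolding Gform_def dGform_def
  by (rule has_derivative_eq_rhs, (rule has_derivative_add has_derivative_diff has_derivative_scaleR has_derivative_mult
      has_derivative_inner has_derivative_im has_derivative_ident assms)+)
    (simp add: algebra_simps)

lemma Gam_has_derivative:
  assumes "(A has_derivative A') (at z)" "(C has_derivative C') (at z)" "(D has_derivative D') (at z)"
    "(U has_derivative U') (at z)" "(V has_derivative V') (at z)"
  shows "((\<lambda>z. Gam (A z) (C z) (D z) z (U z) (V z)) has_derivative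
    (\<lambda>x. Gam (A' x) (C' x) (D' x) z (U z) (V z) + dGam (A z) (C z) (D z) z x (U z) (V z)
      + Gam (A z) (C z) (D z) z (U' x) (V z) + Gam (A z) (C z) (D z) z (U z) (V' x))) (at z)"
  unfolding Gam_def dGam_def
  by (rule has_derivative_eq_rhs, (rule has_derivative_add has_derivative_diff has_derivative_scaleR has_derivative_mult
      has_derivative_inner has_derivative_im has_derivative_ident assms)+)
    (simp add: algebra_simps)

lemma Jmap_has_derivative:
  assumes "(A has_derivative A') (at z)" "(B has_derivative B') (at z)" "(V has_derivative V') (at z)"
  shows "((\<lambda>z. Jmap (A z) (B z) z (V z)) has_derivative
    (\<lambda>x. B' x *\<^sub>R (inner z (V z) *\<^sub>R im z) - A' x *\<^sub>R (inner (im z) (V z) *\<^sub>R z)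
      + dJmap (A z) (B z) z x (V z) + Jmap (A z) (B z) z (V' x))) (at z)"
  unfolding Jmap_def dJmap_def
  by (rule has_derivative_eq_rhs, (rule has_derivative_add has_derivative_diff has_derivative_scaleR has_derivative_mult
      has_derivative_inner has_derivative_im has_derivative_ident assms)+)
    (simp add: algebra_simps)

lemma smooth_on_im: "open S \<Longrightarrow> smooth_on S U \<Longrightarrow> smooth_on S (\<lambda>z. im (U z))"
  by (rule smooth_on_bounded_linear[OF bounded_linear_im])

lemma Gform_smooth:
  "open S \<Longrightarrow> smooth_on S A \<Longrightarrow> smooth_on S B \<Longrightarrow> smooth_on S U \<Longrightarrow> smooth_on S V \<Longrightarrow>
    smooth_on S (\<lambda>z. Gform (A z) (B z) z (U z) (V z))"
  unfolding Gform_def by (intro smooth_intros smooth_on_im)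

lemma Gam_smooth:
  "open S \<Longrightarrow> smooth_on S A \<Longrightarrow> smooth_on S C \<Longrightarrow> smooth_on S D \<Longrightarrow> smooth_on S U \<Longrightarrow> smooth_on S V \<Longrightarrow>
    smooth_on S (\<lambda>z. Gam (A z) (C z) (D z) z (U z) (V z))"
  unfolding Gam_def by (intro smooth_intros smooth_on_im)

lemma Jmap_smooth:
  "open S \<Longrightarrow> smooth_on S A \<Longrightarrow> smooth_on S B \<Longrightarrow> smooth_on S V \<Longrightarrow> smooth_on S (\<lambda>z. Jmap (A z) (B z) z (V z))"
  unfolding Jmap_def by (intro smooth_intros smooth_on_im)

lemma Gform_sym: "Gform \<alpha> \<beta> z u v = Gform \<alpha> \<beta> z v u"
  by (simp add: Gform_def inner_commute mult.commute)

lemma Gform_linear: "linear (\<lambda>u. Gform \<alpha> \<beta> z u v)"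
  by (rule linearI) (simp_all add: Gform_def inner_simps algebra_simps)

lemma Gform_add_self:
  "Gform \<alpha> \<beta> z (u + v) (u + v) = Gform \<alpha> \<beta> z u u + 2 * Gform \<alpha> \<beta> z v u + Gform \<alpha> \<beta> z v v"
proof -
  have "inner u v = inner v u" by (rule inner_commute)
  then show ?thesis by (simp add: Gform_def inner_add_left inner_add_right algebra_simps)
qed

lemma Gam_sym: "Gam \<alpha> c d z u v = Gam \<alpha> c d z v u"
  by (simp add: Gam_def inner_commute algebra_simps)

lemma Gam_linear: "linear (\<lambda>u. Gam \<alpha> c d z u v)"
  unfolding Gam_sym[of _ _ _ _ _ v] by (rule linearI) (simp_all add: Gam_def inner_simps algebra_simps)

lemma Jmap_linear: "linear (Jmap \<alpha> \<beta> z)"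
  by (rule linearI) (simp_all add: Jmap_def inner_simps algebra_simps)

text \<open>The Euclidean projection to the complex line of z. It is orthogonal for
  \<open>Gform\<close> too, which differs from the inner product only by terms in z and iz.\<close>

definition proj_perp :: "'v \<Rightarrow> 'v \<Rightarrow> 'v" where
  "proj_perp z u = (inner z u / inner z z) *\<^sub>R z + (inner (im z) u / inner z z) *\<^sub>R im z"

lemma proj_perp_orthogonal:
  assumes "z \<noteq> 0"
  shows "inner z (u - proj_perp z u) = 0" "inner (im z) (u - proj_perp z u) = 0"
  using assms by (simp_all add: proj_perp_def inner_simps inner_im_right)

end

locale radial_kaehler = complex_structure im + graph A Q M
  for im :: "'v::euclidean_space \<Rightarrow> 'v" and A :: "'v set" and Q :: "'v \<Rightarrow> 'b::euclidean_space" and M +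
  fixes P :: "real set" and \<alpha> :: "real \<Rightarrow> real" and w \<beta> :: "real \<Rightarrow> real"
    and g :: "('v \<times> 'b) metric" and J :: "'v \<times> 'b \<Rightarrow> 'v \<times> 'b \<Rightarrow> 'v \<times> 'b"
  assumes open_P: "open P" and A_eq: "A = {z. inner z z \<in> P}" and P_pos: "r \<in> P \<Longrightarrow> r > 0"
    and smooth_\<alpha>: "smooth_on P \<alpha>" and w_eq: "w r = 1 + r * \<alpha> r" and w_pos: "r \<in> P \<Longrightarrow> w r > 0"
    and \<beta>_eq: "\<beta> r = - \<alpha> r / w r"
    and g_Gform: "z \<in> A \<Longrightarrow> g (z, Q z) (push z u) (push z v) = Gform (\<alpha> (inner z z)) (\<beta> (inner z z)) z u v"
    and J_Jmap: "z \<in> A \<Longrightarrow> J (z, Q z) (push z v) = push z (Jmap (\<alpha> (inner z z)) (\<beta> (inner z z)) z v)"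
begin

text \<open>At \<rho> = \<open>inner z z\<close> these functions take values that satisfy the
  assumptions of the pointwise calculus, so its lemmas apply at every point of
  \<open>A\<close>.\<close>

definition "\<alpha>1 = deriv \<alpha>"
definition "\<alpha>2 = deriv \<alpha>1"
definition "w1 r = \<alpha> r + r * \<alpha>1 r"
definition "\<beta>1 r = - \<alpha>1 r / w r + \<alpha> r * w1 r / (w r)\<^sup>2"
definition "c r = (\<alpha>1 r - (\<alpha> r)\<^sup>2) / w r"
definition "c1 r = (\<alpha>2 r - 2 * \<alpha> r * \<alpha>1 r) / w r - (\<alpha>1 r - (\<alpha> r)\<^sup>2) * w1 r / (w r)\<^sup>2"
definition "d r = 2 * (\<alpha> r)\<^sup>2 + w r * \<alpha>1 r"
definition "d1 r = 4 * \<alpha> r * \<alpha>1 r + w1 r * \<alpha>1 r + w r * \<alpha>2 r"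

lemma w_nz: "r \<in> P \<Longrightarrow> w r \<noteq> 0"
  using w_pos by force

lemma smooth_\<alpha>1: "smooth_on P \<alpha>1"
  unfolding \<alpha>1_def by (intro smooth_on_deriv open_P smooth_\<alpha>)

lemma smooth_scalars: "smooth_on P \<beta>" "smooth_on P c" "smooth_on P d"
proof -
  have w: "smooth_on P w"
    unfolding w_eq[abs_def] by (intro smooth_intros open_P smooth_\<alpha>)
  show "smooth_on P \<beta>"
    unfolding \<beta>_eq[abs_def] by (intro smooth_intros open_P smooth_\<alpha> w w_nz)
  show "smooth_on P c" "smooth_on P d"
    unfolding c_def[abs_def] d_def[abs_def] power2_eq_square
    by (intro smooth_intros open_P smooth_\<alpha> smooth_\<alpha>1 w w_nz; assumption)+
qed

lemma scalar_derivs: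
  assumes r: "r \<in> P"
  shows "(\<alpha> has_real_derivative \<alpha>1 r) (at r)" "(\<beta> has_real_derivative \<beta>1 r) (at r)"
    "(c has_real_derivative c1 r) (at r)" "(d has_real_derivative d1 r) (at r)"
proof -
  show \<alpha>: "(\<alpha> has_real_derivative \<alpha>1 r) (at r)"
    unfolding \<alpha>1_def by (rule smooth_on_has_real_derivative[OF smooth_\<alpha> r])
  have \<alpha>1: "(\<alpha>1 has_real_derivative \<alpha>2 r) (at r)"
    unfolding \<alpha>2_def by (rule smooth_on_has_real_derivative[OF smooth_\<alpha>1 r])
  have w: "(w has_real_derivative w1 r) (at r)"
    unfolding w_eq[abs_def] w1_def by (auto intro!: derivative_eq_intros \<alpha>)
  note nz = w_nz[OF r]
  show "(\<beta> has_real_derivative \<beta>1 r) (at r)"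
    unfolding \<beta>_eq[abs_def] \<beta>1_def using nz
    by (auto intro!: derivative_eq_intros \<alpha> w simp: field_simps power2_eq_square)
  show "(c has_real_derivative c1 r) (at r)"
    unfolding c_def[abs_def] c1_def using nz
    by (auto intro!: derivative_eq_intros \<alpha> \<alpha>1 w simp: field_simps power2_eq_square)
  show "(d has_real_derivative d1 r) (at r)"
    unfolding d_def[abs_def] d1_def
    by (auto intro!: derivative_eq_intros \<alpha> \<alpha>1 w simp: field_simps power2_eq_square)
qed

lemma radial_has_derivative:
  assumes "(f has_real_derivative f1) (at (inner z z))"
  shows "((\<lambda>z. f (inner z z)) has_derivative (\<lambda>x. 2 * inner z x * f1)) (at z)"
proof -
  have "((\<lambda>z. inner z z) has_derivative (\<lambda>x. 2 * inner z x)) (at z)"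
    by (rule has_derivative_eq_rhs[OF has_derivative_inner[OF has_derivative_ident has_derivative_ident]])
      (simp add: inner_commute)
  from has_derivative_compose[OF this assms[unfolded has_field_derivative_def]] show ?thesis
    by (simp add: mult.commute)
qed

lemma in_P: "z \<in> A \<Longrightarrow> inner z z \<in> P"
  by (simp add: A_eq)

lemma radial_smooth: "smooth_on P f \<Longrightarrow> smooth_on A (\<lambda>z. f (inner z z))"
  by (rule smooth_on_compose[OF open_A, of _ P]) (auto intro!: smooth_intros open_A simp: in_P)

lemma nonzero: "z \<in> A \<Longrightarrow> z \<noteq> 0"
  using in_P P_pos by force

abbreviation "j z \<equiv> Jmap (\<alpha> (inner z z)) (\<beta> (inner z z)) z"
abbreviation "G z \<equiv> Gform (\<alpha> (inner z z)) (\<beta> (inner z z)) z"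
abbreviation "\<Gamma> z \<equiv> Gam (\<alpha> (inner z z)) (c (inner z z)) (d (inner z z)) z"

text \<open>The squared \<open>g\<close>-length of the component of \<open>u\<close> in the complex line of \<open>z\<close>, times \<open>inner z z\<close>.\<close>

definition perp_sq :: "'v \<Rightarrow> 'v \<Rightarrow> real" where
  "perp_sq z u = w (inner z z) * (inner (im z) u)\<^sup>2 + (inner z u)\<^sup>2 / w (inner z z)"

text \<open>z and iz are eigenvectors of \<open>G\<close> relative to the Euclidean metric, with
  reciprocal eigenvalues 1 / w and w.\<close>

lemma G_z: "z \<in> A \<Longrightarrow> G z z v = inner z v / w (inner z z)" "z \<in> A \<Longrightarrow> G z (im z) v = w (inner z z) * inner (im z) v"
proof -
  assume z: "z \<in> A"
  have "1 + inner z z * \<beta> (inner z z) = 1 / w (inner z z)"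
    using w_nz[OF in_P[OF z]] by (simp add: \<beta>_eq w_eq field_simps)
  moreover have "G z z v = inner z v * (1 + inner z z * \<beta> (inner z z))"
    by (simp add: Gform_def algebra_simps)
  ultimately show "G z z v = inner z v / w (inner z z)" by simp
  show "G z (im z) v = w (inner z z) * inner (im z) v"
    by (simp add: Gform_def inner_im_right w_eq algebra_simps)
qed

text \<open>Pythagoras: \<open>G\<close> is Euclidean on the complement of the complex line of z,
  and line and complement are orthogonal for both metrics.\<close>

lemma G_decompose:
  assumes z: "z \<in> A"
  shows "G z u u = inner (u - proj_perp z u) (u - proj_perp z u) + perp_sq z u / inner z z"
    and "G z (proj_perp z u) v = (inner z u * inner z v / w (inner z z) + w (inner z z) * inner (im z) u * inner (im z) v) / inner z z"
    and "G z (proj_perp z u) (proj_perp z u) = perp_sq z u / inner z z"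
proof -
  let ?r = "u - proj_perp z u"
  note lin = linear_add[OF Gform_linear] linear_cmul[OF Gform_linear]
  show 2: "G z (proj_perp z u) v = (inner z u * inner z v / w (inner z z) + w (inner z z) * inner (im z) u * inner (im z) v) / inner z z" for v
    unfolding proj_perp_def lin G_z[OF z] by (simp add: add_divide_distrib mult_ac)
  have zp: "inner z (proj_perp z u) = inner z u" "inner (im z) (proj_perp z u) = inner (im z) u"
    using proj_perp_orthogonal[OF nonzero[OF z], of u] by (simp_all add: inner_diff_right)
  show 3: "G z (proj_perp z u) (proj_perp z u) = perp_sq z u / inner z z"
    unfolding 2 zp perp_sq_def by (simp add: power2_eq_square)
  have "G z u u = G z (?r + proj_perp z u) (?r + proj_perp z u)" by simp
  also have "\<dots> = G z ?r ?r + 2 * G z (proj_perp z u) ?r + G z (proj_perp z u) (proj_perp z u)"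
    by (rule Gform_add_self)
  also have "G z (proj_perp z u) ?r = 0"
    unfolding 2 proj_perp_orthogonal[OF nonzero[OF z]] by simp
  also have "G z ?r ?r = inner ?r ?r"
    unfolding Gform_def proj_perp_orthogonal[OF nonzero[OF z]] by simp
  finally show "G z u u = inner ?r ?r + perp_sq z u / inner z z"
    by (simp add: 3)
qed

lemma perp_sq_nonneg: "z \<in> A \<Longrightarrow> perp_sq z u \<ge> 0"
  using w_pos[OF in_P] by (simp add: perp_sq_def less_imp_le)

lemma perp_sq_le: "z \<in> A \<Longrightarrow> perp_sq z u / inner z z \<le> G z u u"
  by (simp add: G_decompose(1))

lemma G_positive:
  assumes z: "z \<in> A" and u: "u \<noteq> 0"
  shows "G z u u > 0"
proof (rule ccontr)
  note W = w_pos[OF in_P[OF z]] and R = P_pos[OF in_P[OF z]]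
  assume "\<not> G z u u > 0"
  then have "inner (u - proj_perp z u) (u - proj_perp z u) + perp_sq z u / inner z z \<le> 0"
    by (simp add: G_decompose(1)[OF z])
  moreover have "inner (u - proj_perp z u) (u - proj_perp z u) \<ge> 0" "perp_sq z u / inner z z \<ge> 0"
    using perp_sq_nonneg[OF z] R by simp_all
  ultimately have "inner (u - proj_perp z u) (u - proj_perp z u) = 0" "perp_sq z u / inner z z = 0" by linarith+
  then have 1: "u = proj_perp z u" and "perp_sq z u = 0" using R by auto
  then have "w (inner z z) * (inner (im z) u)\<^sup>2 = 0" "(inner z u)\<^sup>2 / w (inner z z) = 0"
    using W unfolding perp_sq_def
    by (smt (verit) divide_nonneg_pos mult_nonneg_nonneg zero_le_power2)+
  then have "proj_perp z u = 0" using W by (simp add: proj_perp_def)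
  then show False using 1 u by simp
qed

text \<open>In the three derivative parameters, the summand with \<open>2 * inner z x\<close> is the
  chain rule through the radial coefficients; \<open>dGform\<close>, \<open>dGam\<close> and
  \<open>dJmap\<close> account for the explicit z.\<close>

sublocale graph_kaehler A Q M g G
  "\<lambda>z x u v. 2 * inner z x * (\<alpha>1 (inner z z) * (inner (im z) u * inner (im z) v) + \<beta>1 (inner z z) * (inner z u * inner z v))
    + dGform (\<alpha> (inner z z)) (\<beta> (inner z z)) z x u v"
  \<Gamma>
  "\<lambda>z x u v. Gam (2 * inner z x * \<alpha>1 (inner z z)) (2 * inner z x * c1 (inner z z)) (2 * inner z x * d1 (inner z z)) z u v
    + dGam (\<alpha> (inner z z)) (c (inner z z)) (d (inner z z)) z x u v"
  J j
  "\<lambda>z x v. (2 * inner z x) *\<^sub>R (\<beta>1 (inner z z) *\<^sub>R (inner z v *\<^sub>R im z) - \<alpha>1 (inner z z) *\<^sub>R (inner (im z) v *\<^sub>R z))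
    + dJmap (\<alpha> (inner z z)) (\<beta> (inner z z)) z x v"
proof (intro graph_kaehler.intro graph_metric.intro graph_axioms graph_metric_axioms.intro graph_kaehler_axioms.intro,
    goal_cases)
  \<comment> \<open>The cases are numbered by the assumptions of \<open>graph_metric\<close>, 1 to
    11, followed by those of \<open>graph_kaehler\<close>, 12 to 18.\<close>
  case (6 z U U' V V')
  note D = scalar_derivs[OF in_P[OF 6(1)], THEN radial_has_derivative]
  show ?case
    by (rule has_derivative_eq_rhs[OF Gform_has_derivative[OF D(1,2) 6(2,3)]]) (simp add: algebra_simps)
next
  case (10 z U U' V V')
  note D = scalar_derivs[OF in_P[OF 10(1)], THEN radial_has_derivative]
  show ?case by (rule Gam_has_derivative[OF D(1,3,4) 10(2,3)])
next
  case (17 z U U')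
  note D = scalar_derivs[OF in_P[OF 17(1)], THEN radial_has_derivative]
  show ?case
    by (rule has_derivative_eq_rhs[OF Jmap_has_derivative[OF D(1,2) 17(2)]]) (simp add: algebra_simps)
next
  case (11 z x u v)
  show ?case
    by (rule Gam_metric[OF refl w_eq w_nz[OF in_P[OF 11]] w1_def \<beta>_eq \<beta>1_def c_def c1_def d_def d1_def])
next
  case (18 z x v)
  show ?case
    by (rule Gam_parallel[OF refl w_eq w_nz[OF in_P[OF 18]] w1_def \<beta>_eq \<beta>1_def c_def c1_def d_def d1_def])
next
  case (5 U V)
  then show ?case by (intro Gform_smooth open_A radial_smooth smooth_\<alpha> smooth_scalars)
next
  case (9 U V)
  then show ?case by (intro Gam_smooth open_A radial_smooth smooth_\<alpha> smooth_scalars)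
next
  case (16 U)
  then show ?case by (intro Jmap_smooth open_A radial_smooth smooth_\<alpha> smooth_scalars)
qed (auto intro: g_Gform Gform_sym Gform_linear G_positive Gam_sym Gam_linear J_Jmap Jmap_linear
    Jmap_Jmap[OF refl w_eq w_nz[OF in_P] w1_def \<beta>_eq \<beta>1_def c_def c1_def d_def d1_def]
    Gform_Jmap_Jmap[OF refl w_eq w_nz[OF in_P] w1_def \<beta>_eq \<beta>1_def c_def c1_def d_def d1_def])

lemma Rm_j_self:
  assumes z: "z \<in> A"
  shows "Rm z x (j z x) x =
    (4 * \<alpha> (inner z z) * G z x x + 4 * \<alpha>1 (inner z z) * perp_sq z x) *\<^sub>R j z x
    + (4 * \<alpha>1 (inner z z) * G z x x + 2 * \<alpha>2 (inner z z) * perp_sq z x) *\<^sub>R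
      ((inner z x / w (inner z z)) *\<^sub>R im z - (w (inner z z) * inner (im z) x) *\<^sub>R z)"
  unfolding Rm_def perp_sq_def
  by (rule Gam_curvature[OF refl w_eq w_nz[OF in_P[OF z]] w1_def \<beta>_eq \<beta>1_def c_def c1_def d_def d1_def])

text \<open>Identifies the second vector of the curvature formula through the action of J on the
  complex line: z goes to iz / w and iz to - w z.\<close>

lemma j_line:
  assumes z: "z \<in> A"
  shows "(inner z x / w (inner z z)) *\<^sub>R im z - (w (inner z z) * inner (im z) x) *\<^sub>R z = inner z z *\<^sub>R j z (proj_perp z x)"
proof -
  let ?r = "inner z z"
  have r: "?r \<noteq> 0" using P_pos[OF in_P[OF z]] by simp
  have "1 + ?r * \<beta> ?r = 1 / w ?r"
    using w_nz[OF in_P[OF z]] by (simp add: \<beta>_eq w_eq field_simps)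
  moreover have "j z z = (1 + ?r * \<beta> ?r) *\<^sub>R im z"
    by (simp add: Jmap_def algebra_simps)
  ultimately have jz: "j z z = (1 / w ?r) *\<^sub>R im z" by simp
  have jiz: "j z (im z) = - w ?r *\<^sub>R z"
    by (simp add: Jmap_def inner_im_right w_eq algebra_simps)
  show ?thesis
    unfolding proj_perp_def linear_add[OF Jmap_linear] linear_cmul[OF Jmap_linear] jz jiz
    using r by (simp add: scaleR_add_right scaleR_diff_right mult_ac)
qed

lemma perp_sq_eq: "z \<in> A \<Longrightarrow> perp_sq z u = inner z z * G z (proj_perp z u) u"
  using P_pos[OF in_P[of z]] by (simp add: G_decompose(2) perp_sq_def power2_eq_square)

text \<open>R(x,Jx)x is paired with Jx. As J is an isometry and \<open>perp_sq z x\<close> is \<rho>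
  G(x',x) with x' = \<open>proj_perp z x\<close>, each term is a polynomial in
  \<open>G z x x\<close> and \<open>perp_sq z x\<close>. The product with x vanishes because
  G(Jx',x) is the constant Kaehler form at x' and x, which is zero.\<close>

lemma sectional_curvature_radial:
  assumes z: "z \<in> A" and x: "x \<noteq> 0"
  shows "sectional_curvature M g (z, Q z) (span {push z x, push z (j z x)}) =
    - (4 * \<alpha> (inner z z) + 8 * \<alpha>1 (inner z z) * (perp_sq z x / G z x x) + 2 * \<alpha>2 (inner z z) * (perp_sq z x / G z x x)\<^sup>2)"
proof -
  let ?P = "G z x x" and ?T = "perp_sq z x" and ?r = "inner z z" and ?y = "proj_perp z x"
  have "G z (j z ?y) x = 0" 
  proof -
    have "G z (j z ?y) x = inner (im ?y) x"
      by (rule Gform_Jmap[OF refl w_eq w_nz[OF in_P[OF z]] w1_def \<beta>_eq \<beta>1_def c_def c1_def d_def d1_def])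
    then show ?thesis by (simp add: proj_perp_def inner_simps)
  qed
  then have "G z (Rm z x (j z x) x) x = 0"
    unfolding Rm_j_self[OF z] j_line[OF z] by (simp add: G_simps z G_j_left G_j_self)
  moreover have "G z (Rm z x (j z x) x) (j z x) = 4 * \<alpha> ?r * ?P\<^sup>2 + 8 * \<alpha>1 ?r * ?P * ?T + 2 * \<alpha>2 ?r * ?T\<^sup>2"
    unfolding Rm_j_self[OF z] j_line[OF z]
    by (simp add: G_simps z j_G perp_sq_eq[OF z] power2_eq_square algebra_simps)
  moreover have "?P \<noteq> 0" using G_pos[OF z x] by simp
  ultimately show ?thesis
    by (subst sectional_curvature_eq[OF z x]) (simp_all add: field_simps power2_eq_square)
qed

lemma G_orthogonal: "inner z u = 0 \<Longrightarrow> inner (im z) u = 0 \<Longrightarrow> G z v u = inner v u"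
  by (simp add: Gform_def)

lemma metric_complement_radial:
  assumes z: "z \<in> A" and D: "D = push z ` {u. inner z u = 0 \<and> inner (im z) u = 0}"
  shows "metric_complement M g (z, Q z) D = push z ` {v. proj_perp z v = v}"
proof -
  have "(\<forall>u. inner z u = 0 \<and> inner (im z) u = 0 \<longrightarrow> G z v u = 0) \<longleftrightarrow> proj_perp z v = v" for v
  proof
    let ?r = "v - proj_perp z v"
    have r: "inner z ?r = 0" "inner (im z) ?r = 0"
      by (rule proj_perp_orthogonal[OF nonzero[OF z]])+
    assume "\<forall>u. inner z u = 0 \<and> inner (im z) u = 0 \<longrightarrow> G z v u = 0"
    \<comment> \<open>The test vector is the component of \<open>v\<close> itself that is orthogonal
      to the complex line.\<close>
    then have "inner v ?r = 0" using r G_orthogonal by metis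
    moreover have "inner (proj_perp z v) ?r = 0"
      using r by (simp add: proj_perp_def inner_add_left)
    ultimately have "inner ?r ?r = 0" by (simp only: inner_diff_left)
    then show "proj_perp z v = v" by simp
  next
    assume v: "proj_perp z v = v"
    show "\<forall>u. inner z u = 0 \<and> inner (im z) u = 0 \<longrightarrow> G z v u = 0"
    proof (intro allI impI)
      fix u assume u: "inner z u = 0 \<and> inner (im z) u = 0"
      have "G z (proj_perp z v) u = 0" using u by (simp add: G_decompose(2)[OF z])
      then show "G z v u = 0" unfolding v .
    qed
  qed
  moreover have "metric_complement M g (z, Q z) D =
      push z ` {v. \<forall>u. inner z u = 0 \<and> inner (im z) u = 0 \<longrightarrow> G z v u = 0}"
    unfolding metric_complement_def tangent_space_eq[OF z] D by (auto simp: g_push[OF z])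
  ultimately show ?thesis by simp
qed

text \<open>On a x + b Jx both \<open>perp_sq\<close> and \<open>G\<close> are multiples of a^2 +
  b^2, so all nonzero vectors of the plane make the same angle with the complex line.\<close>

lemma plane_angle_radial:
  assumes z: "z \<in> A" and x: "x \<noteq> 0"
    and D: "D = push z ` {u. inner z u = 0 \<and> inner (im z) u = 0}"
  shows "inner z z * (cos (plane_angle g (z, Q z) (span {push z x, push z (j z x)}) (metric_complement M g (z, Q z) D)))\<^sup>2 =
    perp_sq z x / G z x x"
proof -
  let ?r = "inner z z"
  define s where "s = perp_sq z x / (?r * G z x x)"
  have r: "?r > 0" using P_pos[OF in_P[OF z]] .
  have P: "G z x x > 0" using G_pos[OF z x] .
  have s: "0 \<le> s" "s \<le> 1"
    using perp_sq_nonneg[OF z] perp_sq_le[OF z, of x] r P by (simp_all add: s_def field_simps)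
  have span: "\<exists>a b. v = push z (a *\<^sub>R x + b *\<^sub>R j z x)" if "v \<in> span {push z x, push z (j z x)}" for v
    using that unfolding span_j[OF z] by blast
  have perp: "perp_sq z (a *\<^sub>R x + b *\<^sub>R j z x) = s * ?r * G z (a *\<^sub>R x + b *\<^sub>R j z x) (a *\<^sub>R x + b *\<^sub>R j z x)" for a b
  proof -
    note J = Jmap_inner[OF refl w_eq w_nz[OF in_P[OF z]] w1_def \<beta>_eq \<beta>1_def c_def c1_def d_def d1_def, of x]
    \<comment> \<open>J exchanges the products with z and iz up to the factors w and 1 / w; with the
      weights in \<open>perp_sq\<close> the mixed terms cancel.\<close>
    have "perp_sq z (a *\<^sub>R x + b *\<^sub>R j z x) = (a\<^sup>2 + b\<^sup>2) * perp_sq z x"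
      unfolding perp_sq_def inner_add_right inner_scaleR_right J
      using w_nz[OF in_P[OF z]] by (simp add: field_simps power2_eq_square)
    moreover have "G z (a *\<^sub>R x + b *\<^sub>R j z x) (a *\<^sub>R x + b *\<^sub>R j z x) = (a\<^sup>2 + b\<^sup>2) * G z x x"
      by (simp add: G_simps z j_G G_j_self G_sym[OF z, of "j z x" x] power2_eq_square algebra_simps)
    ultimately show ?thesis using r P by (simp add: s_def)
  qed
  have "plane_angle g (z, Q z) (span {push z x, push z (j z x)}) (push z ` {v. proj_perp z v = v}) = arccos (sqrt s)"
  proof (rule plane_angle_eqI[where ?x0.0 = "push z x" and ?y0.0 = "push z z"])
    show "push z z \<in> push z ` {v. proj_perp z v = v}"
      using nonzero[OF z] by (intro imageI) (simp add: proj_perp_def)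
    fix v assume "v \<in> span {push z x, push z (j z x)}"
    then obtain a b where v: "v = push z (a *\<^sub>R x + b *\<^sub>R j z x)" using span by blast
    let ?u = "a *\<^sub>R x + b *\<^sub>R j z x"
    have idem: "proj_perp z (proj_perp z ?u) = proj_perp z ?u"
      using proj_perp_orthogonal[OF nonzero[OF z], of ?u] by (simp add: proj_perp_def inner_diff_right)
    have "G z ?u y = G z (proj_perp z ?u) y" if "proj_perp z y = y" for y
    proof -
      have "G z (proj_perp z y) (?u - proj_perp z ?u) = 0"
        unfolding G_decompose(2)[OF z] proj_perp_orthogonal[OF nonzero[OF z]] by simp
      then show ?thesis unfolding that by (simp add: G_simps z G_sym[OF z, of y])
    qed
    then show "\<exists>y\<in>push z ` {v. proj_perp z v = v}. g (z, Q z) y y = s * g (z, Q z) v v \<and>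
        (\<forall>y'\<in>push z ` {v. proj_perp z v = v}. g (z, Q z) v y' = g (z, Q z) y y')"
      using r idem by (intro bexI[of _ "push z (proj_perp z ?u)"])
        (auto simp: v g_push[OF z] G_decompose(3)[OF z] perp)
  next
    fix u v assume "u \<in> push z ` {v. proj_perp z v = v}" "v \<in> push z ` {v. proj_perp z v = v}"
    then show "(g (z, Q z) u v)\<^sup>2 \<le> g (z, Q z) u u * g (z, Q z) v v"
      using G_Cauchy_Schwarz[OF z] by (auto simp: g_push[OF z])
  next
    fix v assume "v \<in> push z ` {v. proj_perp z v = v}"
    then obtain y where "v = push z y" by blast
    then show "g (z, Q z) 0 v = 0"
      using g_push[OF z, of 0 y] by (simp add: push_0 z G_simps)
  qed (use z x nonzero s in \<open>auto simp: push_eq_0_iff span_base g_push G_pos dest!: span\<close>)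
  then have "cos (plane_angle g (z, Q z) (span {push z x, push z (j z x)}) (metric_complement M g (z, Q z) D)) = sqrt s"
    unfolding metric_complement_radial[OF z D]
    using s real_sqrt_ge_zero[OF s(1)] by (simp add: cos_arccos del: real_sqrt_ge_0_iff)
  then show ?thesis using s r P by (simp add: s_def)
qed

lemma quasi_constant_radial:
  assumes D: "\<And>z. z \<in> A \<Longrightarrow> D (z, Q z) = push z ` {u. inner z u = 0 \<and> inner (im z) u = 0}"
  shows "quasi_constant_hsc M g J D"
  unfolding quasi_constant_hsc_def
proof (intro exI ballI allI impI)
  define K where "K = (\<lambda>(p :: 'v \<times> 'b) \<theta>. let r = inner (fst p) (fst p) in
    - (4 * \<alpha> r + 8 * \<alpha>1 r * (r * (cos \<theta>)\<^sup>2) + 2 * \<alpha>2 r * (r * (cos \<theta>)\<^sup>2)\<^sup>2))"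
  fix p E assume "p \<in> M" and E: "holomorphic_plane M J p E"
  then obtain z where z: "z \<in> A" "p = (z, Q z)" using M_cases by blast
  obtain x where x: "x \<noteq> 0" "E = span {push z x, push z (j z x)}"
    using holomorphic_planeE[OF z(1) E[unfolded z(2)]] by blast
  show "sectional_curvature M g p E = K p (plane_angle g p E (metric_complement M g p (D p)))"
    unfolding z(2) x(2) K_def Let_def sectional_curvature_radial[OF z(1) x(1)] fst_conv
      plane_angle_radial[OF z(1) x(1) D[OF z(1)]] ..
qed

lemma sectional_curvature_D:
  assumes z: "z \<in> A" and D: "D = push z ` {u. inner z u = 0 \<and> inner (im z) u = 0}"
    and E: "holomorphic_plane M J (z, Q z) E" "E \<subseteq> D"
  shows "sectional_curvature M g (z, Q z) E = - 4 * \<alpha> (inner z z)"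
proof -
  obtain x where x: "x \<noteq> 0" "E = span {push z x, push z (j z x)}"
    using holomorphic_planeE[OF z E(1)] by blast
  have "push z x \<in> D" using E(2) x(2) span_base by blast
  then have "perp_sq z x = 0" by (auto simp: D perp_sq_def)
  then show ?thesis
    unfolding x(2) sectional_curvature_radial[OF z x(1)] by simp
qed

text \<open>For u orthogonal to z and iz, h(\<rho>) is stationary along u and the Christoffel symbol
  of u and z vanishes; only h(\<rho>) u remains.\<close>

lemma levi_civita_radial:
  assumes z: "z \<in> A" and h: "smooth_on P h"
    and \<xi>: "\<And>z. z \<in> A \<Longrightarrow> \<xi> (z, Q z) = push z (h (inner z z) *\<^sub>R z)"
    and X: "vector_field M X" "X (z, Q z) \<in> push z ` {u. inner z u = 0 \<and> inner (im z) u = 0}"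
  shows "levi_civita M g X \<xi> (z, Q z) = h (inner z z) *\<^sub>R X (z, Q z)"
proof -
  have smooth: "smooth_on A (\<lambda>z. h (inner z z) *\<^sub>R z)"
    by (intro smooth_intros open_A radial_smooth h)
  have vf: "vector_field M \<xi>"
    by (rule vector_fieldI[OF smooth \<xi>])
  obtain u where u: "X (z, Q z) = push z u" "inner z u = 0" "inner (im z) u = 0" using X(2) by blast
  have repX: "rep X z = u" by (simp add: rep_def u)
  have "((\<lambda>z. h (inner z z)) has_derivative (\<lambda>x. 2 * inner z x * deriv h (inner z z))) (at z)"
    by (rule radial_has_derivative[OF smooth_on_has_real_derivative[OF h in_P[OF z]]])
  from has_derivative_scaleR[OF this has_derivative_ident]
  have "(rep \<xi> has_derivative (\<lambda>x. h (inner z z) *\<^sub>R x + (2 * inner z x * deriv h (inner z z)) *\<^sub>R z)) (at z)"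
    by (rule has_derivative_transform_within_open[OF _ open_A z]) (simp add: rep_def \<xi>)
  from fun_cong[OF frechet_derivative_at[OF this], of u, symmetric]
  have "frechet_derivative (rep \<xi>) (at z) u = h (inner z z) *\<^sub>R u" by (simp add: u)
  moreover have "\<Gamma> z u (rep \<xi> z) = 0"
    by (simp add: Gam_def rep_def \<xi> z u inner_commute[of u z])
  ultimately show ?thesis
    unfolding vector_fieldD(3)[OF vector_field_levi_civita[OF X(1) vf] z] rep_levi_civita[OF X(1) vf z] repX u(1)
    by (simp add: push_scaleR z)
qed

end

section \<open>Rotational hypersurfaces of type II\<close>

lemma complex_structure_imaginary: "complex_structure (\<lambda>v :: complex ^ 'n. \<i> *s v)"
proof (rule complex_structure.intro)
  show "linear (\<lambda>v :: complex ^ 'n. \<i> *s v)"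
    by (rule linearI) (simp_all add: vec_eq_iff algebra_simps scaleR_conv_of_real)
  fix u v :: "complex ^ 'n"
  show "\<i> *s (\<i> *s v) = - v" by (simp add: vec_eq_iff)
  show "inner (\<i> *s u) (\<i> *s v) = inner u v"
    by (simp add: inner_vec_def inner_complex_def algebra_simps)
qed

locale rotational_type_II =
  fixes I :: "real set" and t q :: "real \<Rightarrow> real"
  assumes open_I: "open I" and interval_I: "is_interval I"
    and smooth_t: "smooth_on I t" and smooth_q: "smooth_on I q"
    and natural_param: "s \<in> I \<Longrightarrow> (deriv t s)\<^sup>2 - (deriv q s)\<^sup>2 = 1"
    and t_pos: "s \<in> I \<Longrightarrow> t s > 0" and t'_ge: "s \<in> I \<Longrightarrow> deriv t s \<ge> 1"
begin

text \<open>The squared radius determines the point of the meridian; \<open>\<sigma>\<close> recovers the parameter \<open>s\<close> from it.\<close>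

definition P :: "real set" where "P = (\<lambda>s. (t s)\<^sup>2) ` I"
definition \<sigma> :: "real \<Rightarrow> real" where "\<sigma> = the_inv_into I (\<lambda>s. (t s)\<^sup>2)"
definition \<alpha> :: "real \<Rightarrow> real" where "\<alpha> r = (deriv t (\<sigma> r) - 1) / r"
definition w :: "real \<Rightarrow> real" where "w r = 1 + r * \<alpha> r"
definition \<beta> :: "real \<Rightarrow> real" where "\<beta> r = - \<alpha> r / w r"
definition A :: "(complex ^ 'n) set" where "A = {z. inner z z \<in> P}"
definition Q :: "complex ^ 'n \<Rightarrow> real" where "Q z = q (\<sigma> (inner z z))"

lemma t_inj: "inj_on t I"
proof (rule linorder_inj_onI')
  fix x y assume "x \<in> I" "y \<in> I" "x < y"
  have "s \<in> I" if "x \<le> s" "s \<le> y" for s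
    using interval_I \<open>x \<in> I\<close> \<open>y \<in> I\<close> that by (meson mem_is_interval_1_I)
  then have "t x < t y"
    using smooth_on_has_real_derivative[OF smooth_t] t'_ge
    by (intro DERIV_pos_imp_increasing[OF \<open>x < y\<close>]) (metis less_le_trans zero_less_one)
  then show "t x \<noteq> t y" by simp
qed

lemma t_sq_inj: "inj_on (\<lambda>s. (t s)\<^sup>2) I"
proof (rule inj_onI)
  fix x y assume xy: "x \<in> I" "y \<in> I" and "(t x)\<^sup>2 = (t y)\<^sup>2"
  then have "t x = t y"
    using t_pos[OF xy(1)] t_pos[OF xy(2)] by (simp add: power2_eq_iff_nonneg)
  then show "x = y" using inj_onD[OF t_inj] xy by blast
qed

lemma \<sigma>_t: "s \<in> I \<Longrightarrow> \<sigma> ((t s)\<^sup>2) = s"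
  unfolding \<sigma>_def by (rule the_inv_into_f_f[OF t_sq_inj])

lemma P_cases:
  assumes "r \<in> P"
  obtains s where "s \<in> I" "r = (t s)\<^sup>2" "\<sigma> r = s"
  using assms \<sigma>_t by (auto simp: P_def)

lemma t_sq_has_derivative: "s \<in> I \<Longrightarrow> ((\<lambda>s. (t s)\<^sup>2) has_real_derivative 2 * t s * deriv t s) (at s)"
  by (auto intro!: derivative_eq_intros smooth_on_has_real_derivative[OF smooth_t])

lemma continuous_t_sq: "continuous_on I (\<lambda>s. (t s)\<^sup>2)"
  by (intro continuous_intros smooth_on_continuous_on smooth_t)

lemma open_P: "open P"
  unfolding P_def by (rule invariance_of_domain[OF continuous_t_sq open_I t_sq_inj])

lemma smooth_t': "smooth_on I (deriv t)"
  by (rule smooth_on_deriv[OF open_I smooth_t])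

lemma t'_pos: "s \<in> I \<Longrightarrow> deriv t s > 0"
  using t'_ge by force

lemma \<sigma>_has_derivative:
  assumes "r \<in> P"
  shows "(\<sigma> has_real_derivative inverse (2 * t (\<sigma> r) * deriv t (\<sigma> r))) (at r)"
proof -
  obtain s where s: "s \<in> I" "r = (t s)\<^sup>2" "\<sigma> r = s" by (rule P_cases[OF assms])
  show ?thesis
    unfolding s(3) s(2)
    unfolding has_field_derivative_def
    by (rule has_derivative_inverse_strong[OF open_I s(1) continuous_t_sq \<sigma>_t
          t_sq_has_derivative[OF s(1), unfolded has_field_derivative_def]])
      (use t_pos[OF s(1)] t'_pos[OF s(1)] in \<open>auto simp: fun_eq_iff field_simps \<sigma>_t[OF s(1)]\<close>)
qed

text \<open>The derivative of \<open>\<sigma>\<close> is a smooth function on \<open>I\<close>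
  evaluated at \<open>\<sigma>\<close>, so bootstrapping applies.\<close>

lemma smooth_\<sigma>: "smooth_on P \<sigma>"
proof (rule smooth_on_autonomous[OF open_P \<sigma>_has_derivative])
  show "smooth_on I (\<lambda>s. inverse (2 * t s * deriv t s))"
    using t_pos t'_pos by (intro smooth_intros open_I smooth_t smooth_t') force
  show "\<sigma> ` P \<subseteq> I" by (auto elim!: P_cases)
qed

lemma smooth_compose_\<sigma>: "smooth_on I f \<Longrightarrow> smooth_on P (\<lambda>r. f (\<sigma> r))"
  by (rule smooth_on_compose[OF open_P smooth_\<sigma>]) (auto elim!: P_cases)

lemma P_pos: "r \<in> P \<Longrightarrow> r > 0"
  by (metis P_cases t_pos zero_less_power)

lemma smooth_\<alpha>: "smooth_on P \<alpha>"
  unfolding \<alpha>_def[abs_def] using P_pos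
  by (intro smooth_intros open_P smooth_compose_\<sigma> smooth_t') force

lemma w_t': "r \<in> P \<Longrightarrow> w r = deriv t (\<sigma> r)"
  using P_pos[of r] by (simp add: w_def \<alpha>_def)

lemma w_pos: "r \<in> P \<Longrightarrow> w r > 0"
  by (metis P_cases w_t' t'_pos)

text \<open>The parameters of a point over z are s = \<sigma>(|z|^2) and n = z / t(s).\<close>

lemma hypersurface_eq_graph: "rotational_hypersurface I t q = (\<lambda>z. (z, Q z)) ` (A :: (complex ^ 'n) set)"
proof (intro equalityI subsetI)
  fix p :: "(complex ^ 'n) \<times> real" assume "p \<in> rotational_hypersurface I t q"
  then obtain s n where s: "s \<in> I" "norm n = 1" "p = (t s *\<^sub>R n, q s)"
    by (auto simp: rotational_hypersurface_def rot_point_def)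
  have "inner (t s *\<^sub>R n) (t s *\<^sub>R n) = (t s)\<^sup>2"
    using s(2) by (simp add: dot_square_norm power2_eq_square)
  then show "p \<in> (\<lambda>z. (z, Q z)) ` A"
    using s \<sigma>_t[OF s(1)] by (intro image_eqI[of _ _ "t s *\<^sub>R n"]) (simp_all add: A_def P_def Q_def)
next
  fix p :: "(complex ^ 'n) \<times> real" assume "p \<in> (\<lambda>z. (z, Q z)) ` A"
  then obtain z where z: "inner z z \<in> P" "p = (z, Q z)" by (auto simp: A_def)
  obtain s where s: "s \<in> I" "inner z z = (t s)\<^sup>2" "\<sigma> (inner z z) = s" by (rule P_cases[OF z(1)])
  have "norm z = t s" using s(2) t_pos[OF s(1)] by (simp add: norm_eq_sqrt_inner)
  then have "(s, z /\<^sub>R t s) \<in> I \<times> sphere 0 1" "p = rot_point t q (s, z /\<^sub>R t s)"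
    using s t_pos[OF s(1)] by (auto simp: z(2) Q_def rot_point_def)
  then show "p \<in> rotational_hypersurface I t q"
    unfolding rotational_hypersurface_def by blast
qed

lemma rot_param_eq:
  fixes z :: "complex ^ 'n"
  assumes "z \<in> A"
  shows "rot_param I t q (z, Q z) = (\<sigma> (inner z z), z /\<^sub>R t (\<sigma> (inner z z)))"
proof -
  obtain s where s: "s \<in> I" "inner z z = (t s)\<^sup>2" "\<sigma> (inner z z) = s"
    using assms P_cases by (auto simp: A_def)
  have norm: "norm z = t s" using s(2) t_pos[OF s(1)] by (simp add: norm_eq_sqrt_inner)
  have "inj_on (rot_point t q) (I \<times> sphere (0 :: complex ^ 'n) 1)"
  proof (rule inj_onI, clarsimp simp: rot_point_def)
    fix a b and m n :: "complex ^ 'n"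
    assume ab: "a \<in> I" "b \<in> I" and mn: "norm m = 1" "norm n = 1" "t a *\<^sub>R m = t b *\<^sub>R n"
    have "t a = t b"
      using arg_cong[OF mn(3), of norm] mn(1,2) t_pos ab by (simp add: less_imp_le)
    then show "a = b \<and> m = n"
      using inj_onD[OF t_inj _ ab] mn(3) t_pos[OF ab(2)] by auto
  qed
  then show ?thesis
    unfolding rot_param_def s(3)
    by (rule the_inv_into_f_eq) (use s norm t_pos[OF s(1)] in \<open>auto simp: rot_point_def Q_def\<close>)
qed

lemma smooth_Q: "smooth_on (A :: (complex ^ 'n) set) Q"
  and open_A: "open (A :: (complex ^ 'n) set)"
proof -
  have "open ((\<lambda>z :: complex ^ 'n. inner z z) -` P)"
    by (rule open_vimage[OF open_P]) (intro continuous_intros)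
  then show op: "open (A :: (complex ^ 'n) set)" by (simp add: A_def vimage_def)
  show "smooth_on (A :: (complex ^ 'n) set) Q"
    unfolding Q_def[abs_def]
    by (rule smooth_on_compose[OF op smooth_on_inner[OF op smooth_on_ident[OF op] smooth_on_ident[OF op]]
          smooth_compose_\<sigma>[OF smooth_q]]) (auto simp: A_def)
qed

lemma graph_hypersurface: "graph (A :: (complex ^ 'n) set) Q (rotational_hypersurface I t q)"
  by unfold_locales (rule open_A smooth_Q hypersurface_eq_graph)+

end

section \<open>The given structures of the hypersurface in the chart\<close>

lemma span_pair_orthogonal:
  fixes x a b :: "(complex ^ 'n) \<times> real"
  shows "(\<forall>y\<in>span {a, b}. lorentz x y = 0) \<longleftrightarrow> lorentz x a = 0 \<and> lorentz x b = 0"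
proof
  assume "lorentz x a = 0 \<and> lorentz x b = 0"
  then have "span {a, b} \<subseteq> {y. lorentz x y = 0}"
    by (intro span_minimal) (auto simp: subspace_def lorentz_def inner_add_right distrib_left algebra_simps)
  then show "\<forall>y\<in>span {a, b}. lorentz x y = 0" by blast
qed (simp add: span_base)

text \<open>Fixing \<open>M\<close> also fixes the dimension type \<open>'n\<close>, over which the
  \<open>A\<close> and \<open>Q\<close> of \<open>rotational_type_II\<close> are
  polymorphic.\<close>

locale rotational_hypersurface_II = rotational_type_II I t q for I t q +
  fixes M :: "((complex ^ 'n) \<times> real) set"
  assumes M_def: "M = rotational_hypersurface I t q"
begin

sublocale complex_structure "\<lambda>v :: complex ^ 'n. \<i> *s v"
  by (rule complex_structure_imaginary)

sublocale graph "A :: (complex ^ 'n) set" Q M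
  unfolding M_def by (rule graph_hypersurface)

text \<open>A dictionary at one point, with \<tau>, t', q' the values of t and of the derivatives on
  the meridian; it reduces the comparison with the radial structures to field arithmetic. The
  natural parameter enters by replacing q'^2 with t'^2 - 1.\<close>

lemma meridian:
  fixes z :: "complex ^ 'n"
  assumes z: "z \<in> A"
  obtains \<tau> t' q' where "\<tau> > 0" "t' > 0" "inner z z = \<tau>\<^sup>2" "w (inner z z) = t'"
    "\<alpha> (inner z z) = (t' - 1) / \<tau>\<^sup>2" "\<beta> (inner z z) = - (t' - 1) / (\<tau>\<^sup>2 * t')"
    "\<And>u. push z u = (u, q' / (\<tau> * t') * inner z u)"
    "rot_xi_bar I t q (z, Q z) = push z ((t' / \<tau>) *\<^sub>R z)"
    "rot_xi_tilde I t q (z, Q z) = push z ((1 / \<tau>) *\<^sub>R (\<i> *s z))"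
    "rot_t' I t q (z, Q z) = t'"
    "\<And>u. rot_eta_bar I t q (z, Q z) (push z u) = inner z u / (\<tau> * t')"
    "\<And>u. rot_eta_tilde I t q (z, Q z) (push z u) = inner (\<i> *s z) u / \<tau>"
    "\<And>u v. lorentz (push z u) (push z v) = inner u v - (t'\<^sup>2 - 1) * (inner z u * inner z v) / (\<tau> * t')\<^sup>2"
proof -
  let ?r = "inner z z"
  have r: "?r \<in> P" using z by (simp add: A_def)
  then obtain s where s: "s \<in> I" "?r = (t s)\<^sup>2" "\<sigma> ?r = s" by (rule P_cases)
  have t: "t s > 0" "deriv t s > 0" by (rule t_pos t'_pos s(1))+
  have q: "(q has_real_derivative deriv q s) (at s)"
    by (rule smooth_on_has_real_derivative[OF smooth_q s(1)])
  have "((\<lambda>z. inner z z) has_derivative (\<lambda>u. 2 * inner z u)) (at z)"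
    by (rule has_derivative_eq_rhs[OF has_derivative_inner[OF has_derivative_ident has_derivative_ident]])
      (simp add: inner_commute)
  \<comment> \<open>Chain rule for q(\<sigma>(|z|^2)): the 2 from the square cancels the 2 in the
    derivative of \<open>\<sigma>\<close>.\<close>
  from has_derivative_compose[OF has_derivative_compose[OF this \<sigma>_has_derivative[OF r, unfolded has_field_derivative_def]]
      q[folded s(3), unfolded has_field_derivative_def]]
  have "(Q has_derivative (\<lambda>u. deriv q s / (t s * deriv t s) * inner z u)) (at z)"
    unfolding Q_def[abs_def] by (rule has_derivative_eq_rhs) (simp add: s(3) fun_eq_iff field_simps)
  from frechet_derivative_at[OF this, symmetric]
  have push: "push z u = (u, deriv q s / (t s * deriv t s) * inner z u)" for u
    by (simp add: push_def)
  have w: "w ?r = deriv t s" by (simp add: w_t'[OF r] s(3))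
  have a: "\<alpha> ?r = (deriv t s - 1) / (t s)\<^sup>2" by (simp add: \<alpha>_def s(2) \<sigma>_t[OF s(1)])
  have b: "\<beta> ?r = - (deriv t s - 1) / ((t s)\<^sup>2 * deriv t s)" by (simp only: \<beta>_def w a divide_divide_eq_left minus_divide_left)
  note param = rot_param_eq[OF z, unfolded s(3)]
  have xi: "rot_xi_bar I t q (z, Q z) = push z ((deriv t s / t s) *\<^sub>R z)"
    using t by (simp add: rot_xi_bar_def param push s(2) field_simps power2_eq_square)
  have "inner z (\<i> *s z) = 0" using inner_im_right[of z z] by simp
  then have xi': "rot_xi_tilde I t q (z, Q z) = push z ((1 / t s) *\<^sub>R (\<i> *s z))"
    using im_scaleR[of "inverse (t s)" z] by (simp add: rot_xi_tilde_def param J0_def push inverse_eq_divide)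
  have t': "rot_t' I t q (z, Q z) = deriv t s" by (simp add: rot_t'_def param)
  have lor: "lorentz (push z u) (push z v) = inner u v - ((deriv t s)\<^sup>2 - 1) * (inner z u * inner z v) / (t s * deriv t s)\<^sup>2" for u v
  proof -
    have "(deriv t s)\<^sup>2 - 1 = deriv q s * deriv q s"
      using natural_param[OF s(1)] by (simp add: power2_eq_square)
    then show ?thesis by (simp add: lorentz_def push power2_eq_square)
  qed
  have eta: "rot_eta_bar I t q (z, Q z) (push z u) = inner z u / (t s * deriv t s)" for u
    using t unfolding rot_eta_bar_def xi lor by (simp add: s(2) field_simps power2_eq_square)
  have eta': "rot_eta_tilde I t q (z, Q z) (push z u) = inner (\<i> *s z) u / t s" for u
    using \<open>inner z (\<i> *s z) = 0\<close> unfolding rot_eta_tilde_def xi' lor by simp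
  show thesis
    by (rule that[OF t s(2) w a b push xi xi' t' eta eta' lor])
qed

text \<open>Along z the time-like part contributes - (t'^2 - 1) and the deformation t' - 1, both
  over (\<tau> t')^2; the sum - t' (t' - 1) yields \<beta>.\<close>

lemma rot_g_push:
  assumes z: "z \<in> A"
  shows "rot_g I t q (z, Q z) (push z u) (push z v) = Gform (\<alpha> (inner z z)) (\<beta> (inner z z)) z u v"
proof -
  obtain \<tau> t' where m: "\<tau> > 0" "t' > 0" "\<alpha> (inner z z) = (t' - 1) / \<tau>\<^sup>2" "\<beta> (inner z z) = - (t' - 1) / (\<tau>\<^sup>2 * t')"
    "rot_t' I t q (z, Q z) = t'"
    "\<And>u. rot_eta_bar I t q (z, Q z) (push z u) = inner z u / (\<tau> * t')"
    "\<And>u. rot_eta_tilde I t q (z, Q z) (push z u) = inner (\<i> *s z) u / \<tau>"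
    "\<And>u v. lorentz (push z u) (push z v) = inner u v - (t'\<^sup>2 - 1) * (inner z u * inner z v) / (\<tau> * t')\<^sup>2"
    by (rule meridian[OF z]) (rule that; assumption)
  show ?thesis
    unfolding rot_g_def Gform_def m using m(1,2) by (simp add: field_simps power2_eq_square)
qed

text \<open>The first components are compared directly. \<open>J0\<close> annihilates the
  e-component, so that of the image comes from the \<open>rot_xi_bar\<close> term alone, and it must
  match the one prescribed by \<open>push\<close>.\<close>

lemma rot_J_push:
  assumes z: "z \<in> A"
  shows "rot_J I t q (z, Q z) (push z u) = push z (Jmap (\<alpha> (inner z z)) (\<beta> (inner z z)) z u)"
proof -
  obtain \<tau> t' q' where m: "\<tau> > 0" "t' > 0" "inner z z = \<tau>\<^sup>2"
    "\<alpha> (inner z z) = (t' - 1) / \<tau>\<^sup>2" "\<beta> (inner z z) = - (t' - 1) / (\<tau>\<^sup>2 * t')"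
    and push: "\<And>u. push z u = (u, q' / (\<tau> * t') * inner z u)"
    and xi: "rot_xi_bar I t q (z, Q z) = push z ((t' / \<tau>) *\<^sub>R z)"
    "rot_xi_tilde I t q (z, Q z) = push z ((1 / \<tau>) *\<^sub>R (\<i> *s z))"
    and eta: "\<And>u. rot_eta_bar I t q (z, Q z) (push z u) = inner z u / (\<tau> * t')"
    "\<And>u. rot_eta_tilde I t q (z, Q z) (push z u) = inner (\<i> *s z) u / \<tau>"
    by (rule meridian[OF z]) (rule that; assumption)
  let ?a = "inner z u" and ?b = "inner (\<i> *s z) u"
  have iz: "inner z (\<i> *s v) = - inner (\<i> *s z) v" for v by (rule inner_im_right)
  have fst: "fst (rot_J I t q (z, Q z) (push z u)) = Jmap (\<alpha> (inner z z)) (\<beta> (inner z z)) z u"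
  proof -
    have "fst (rot_J I t q (z, Q z) (push z u)) =
        \<i> *s u + (- (?a / \<tau>\<^sup>2) + ?a / (\<tau>\<^sup>2 * t')) *\<^sub>R (\<i> *s z) + (?b / \<tau>\<^sup>2 - ?b * t' / \<tau>\<^sup>2) *\<^sub>R z"
      unfolding rot_J_def eta xi J0_def using m(1,2)
      by (simp add: push algebra_simps power2_eq_square)
    moreover have "- (?a / \<tau>\<^sup>2) + ?a / (\<tau>\<^sup>2 * t') = - (t' - 1) / (\<tau>\<^sup>2 * t') * ?a"
        "?b / \<tau>\<^sup>2 - ?b * t' / \<tau>\<^sup>2 = - ((t' - 1) / \<tau>\<^sup>2 * ?b)"
      using m(1,2) by (simp_all add: field_simps)
    ultimately show ?thesis unfolding Jmap_def m(4,5) by simp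
  qed
  have "snd (rot_J I t q (z, Q z) (push z u)) = - (?b / \<tau>) * (q' / (\<tau> * t') * (t' / \<tau> * inner z z))"
    unfolding rot_J_def eta xi J0_def by (simp add: push iz)
  also have "\<dots> = q' / (\<tau> * t') * inner z (Jmap (\<alpha> (inner z z)) (\<beta> (inner z z)) z u)"
    unfolding Jmap_def inner_diff_right inner_add_right inner_scaleR_right iz m(4,5)
    unfolding m(3) using m(1,2)
    by (simp add: field_simps power2_eq_square)
  finally show ?thesis
    unfolding push[of "Jmap _ _ _ _"] using fst by (simp add: prod_eq_iff)
qed

lemma rot_D_eq:
  assumes z: "z \<in> A"
  shows "rot_D I t q (z, Q z) = push z ` {u. inner z u = 0 \<and> inner (\<i> *s z) u = 0}"
proof -
  obtain \<tau> t' where m: "\<tau> > 0" "t' > 0"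
    "\<And>u. rot_eta_bar I t q (z, Q z) (push z u) = inner z u / (\<tau> * t')"
    "\<And>u. rot_eta_tilde I t q (z, Q z) (push z u) = inner (\<i> *s z) u / \<tau>"
    by (rule meridian[OF z]) (rule that; assumption)
  have "lorentz (push z u) y = lorentz y (push z u)" for u y
    by (simp add: lorentz_def inner_commute mult.commute)
  then have "lorentz (push z u) (rot_xi_bar I t q (z, Q z)) = inner z u / (\<tau> * t')"
    "lorentz (push z u) (rot_xi_tilde I t q (z, Q z)) = inner (\<i> *s z) u / \<tau>" for u
    using m(3,4)[of u] by (simp_all add: rot_eta_bar_def rot_eta_tilde_def)
  then have "(\<forall>y\<in>rot_Dperp I t q (z, Q z). lorentz (push z u) y = 0) \<longleftrightarrow> inner z u = 0 \<and> inner (\<i> *s z) u = 0" for u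
    unfolding rot_Dperp_def span_pair_orthogonal using m(1,2) by simp
  moreover have "rot_D I t q (z, Q z) = push z ` {u. \<forall>y\<in>rot_Dperp I t q (z, Q z). lorentz (push z u) y = 0}"
    unfolding rot_D_def metric_complement_def M_def[symmetric] tangent_space_eq[OF z] by blast
  ultimately show ?thesis by simp
qed

sublocale radial_kaehler "\<lambda>v :: complex ^ 'n. \<i> *s v" A Q M P \<alpha> w \<beta> "rot_g I t q" "rot_J I t q"
  by unfold_locales
    (rule open_P A_def P_pos smooth_\<alpha> w_def w_pos \<beta>_def rot_g_push rot_J_push; assumption)+

lemma rot_xi_eq:
  assumes z: "z \<in> A"
  shows "rot_xi I t q (z, Q z) = push z ((sqrt (w (inner z z)) / sqrt (inner z z)) *\<^sub>R z)"
proof -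
  obtain \<tau> t' where m: "\<tau> > 0" "t' > 0" "inner z z = \<tau>\<^sup>2" "w (inner z z) = t'"
    "rot_xi_bar I t q (z, Q z) = push z ((t' / \<tau>) *\<^sub>R z)" "rot_t' I t q (z, Q z) = t'"
    by (rule meridian[OF z]) (rule that; assumption)
  have "1 / sqrt t' * (t' / \<tau>) = sqrt t' / \<tau>"
    using m(1,2) real_sqrt_mult_self[of t'] by (simp add: field_simps del: real_sqrt_mult_self)
  then show ?thesis
    unfolding rot_xi_def m(4-6) push_scaleR[OF z, symmetric] using m(1) by (simp add: m(3))
qed

end

theorem theorem6p6:
  fixes I :: "real set" and t q :: "real \<Rightarrow> real" and M :: "((complex ^ 'n) \<times> real) set"
  assumes dim: "CARD('n) \<ge> 2"
    and I: "open I" "is_interval I"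
    and smooth: "smooth_on I t" "smooth_on I q"
    and M: "M = rotational_hypersurface I t q"
    and type_II: "timelike_normals M"
    and natural_param: "\<And>s. s \<in> I \<Longrightarrow> (deriv t s)\<^sup>2 - (deriv q s)\<^sup>2 = 1"
    and t_pos: "\<And>s. s \<in> I \<Longrightarrow> t s > 0"
    and t'_ge: "\<And>s. s \<in> I \<Longrightarrow> deriv t s \<ge> 1"
  shows "kaehler_metric M (rot_g I t q) (rot_J I t q) \<and>
    quasi_constant_hsc M (rot_g I t q) (rot_J I t q) (rot_D I t q) \<and>
    (\<exists>a k :: (complex ^ 'n) \<times> real \<Rightarrow> real. \<forall>p\<in>M.
       (\<forall>E. holomorphic_plane M (rot_J I t q) p E \<and> E \<subseteq> rot_D I t q p \<longrightarrow>
            sectional_curvature M (rot_g I t q) p E = a p) \<and>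
       (\<forall>X. vector_field M X \<and> X p \<in> rot_D I t q p \<longrightarrow>
            levi_civita M (rot_g I t q) X (rot_xi I t q) p = (k p / 2) *\<^sub>R X p) \<and>
       a p \<le> 0 \<and> a p + (k p)\<^sup>2 > 0)"
proof -
  interpret rotational_hypersurface_II I t q M
    by unfold_locales (fact I smooth natural_param t_pos t'_ge M)+
  \<comment> \<open>\<open>levi_civita_radial\<close> yields the factor sqrt w / sqrt \<rho>, which
    has to equal \<open>k / 2\<close>; hence the 2 in \<open>k\<close>.\<close>
  define a k where "a = (\<lambda>p :: (complex ^ 'n) \<times> real. - 4 * \<alpha> (inner (fst p) (fst p)))"
    and "k = (\<lambda>p :: (complex ^ 'n) \<times> real. 2 * (sqrt (w (inner (fst p) (fst p))) / sqrt (inner (fst p) (fst p))))"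
  have smooth_h: "smooth_on P (\<lambda>r. sqrt (w r) / sqrt r)"
    unfolding w_def[abs_def]
    by (intro smooth_intros open_P smooth_\<alpha>) (use P_pos w_pos in \<open>force simp: w_def\<close>)+
  have "(\<forall>E. holomorphic_plane M (rot_J I t q) p E \<and> E \<subseteq> rot_D I t q p \<longrightarrow>
          sectional_curvature M (rot_g I t q) p E = a p) \<and>
      (\<forall>X. vector_field M X \<and> X p \<in> rot_D I t q p \<longrightarrow>
          levi_civita M (rot_g I t q) X (rot_xi I t q) p = (k p / 2) *\<^sub>R X p) \<and>
      a p \<le> 0 \<and> a p + (k p)\<^sup>2 > 0" if pM: "p \<in> M" for p
  proof -
    obtain z where z: "z \<in> A" and p: "p = (z, Q z)" using M_cases[OF pM] by blast
    let ?r = "inner z z"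
    have r: "?r > 0" "w ?r > 0" using P_pos w_pos in_P[OF z] by blast+
    \<comment> \<open>The bound t' >= 1 makes \<alpha> nonnegative and thereby gives the sign of
      \<open>a\<close>.\<close>
    have "w ?r \<ge> 1" using P_cases[OF in_P[OF z]] w_t'[OF in_P[OF z]] t'_ge by metis
    then have "\<alpha> ?r \<ge> 0" using r(1) by (simp add: w_def zero_le_mult_iff)
    moreover have "a p + (k p)\<^sup>2 = 4 / ?r"
      using r by (simp add: a_def k_def p power_mult_distrib power_divide) (simp add: w_def field_simps)
    ultimately show ?thesis
      using sectional_curvature_D[OF z rot_D_eq[OF z]] levi_civita_radial[OF z smooth_h rot_xi_eq] r(1)
      unfolding p rot_D_eq[OF z] by (auto simp: a_def k_def)
  qed
  then show ?thesis
    using kaehler_metric_g quasi_constant_radial[OF rot_D_eq] by blast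
qed

end
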